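(* Let $I\subseteq\mathbb R$ be an open interval, $n\ge 1$, and let $f:I\times\mathbb R^n\to\mathbb R^n$ be a continuous function which is $C^3$ in $x$. For $(\tau,\xi)\in I\times\mathbb R^n$ let $\varphi(t,\tau,\xi)$, $t\in I(\tau,\xi)$, be the maximal solution of $\frac{dx}{dt}=f(t,x)$ with $\varphi(\tau,\tau,\xi)=\xi$. For $h\in\mathbb R^n$ write $d^k\varphi(t)=D^k\varphi(t,\tau,\xi)\,h^k$ ($k=1,2,3$, with $d\varphi=d^1\varphi$), $D\varphi(t)=D\varphi(t,\tau,\xi)$, and $D^kf[s]=D^kf(s,\varphi(s,\tau,\xi))$. Then for all $(\tau,\xi)\in I\times\mathbb R^n$, all $t\in I(\tau,\xi)$ and all $h\in\mathbb R^n$, $$d^3\varphi(t)\otimes d\varphi(t)+d\varphi(t)\otimes d^3\varphi(t)-3\,(d^2\varphi(t))^2$$ $$=\big(D\varphi(t)\otimes D\varphi(t)\big)\Big\{\int_\tau^t\big[D\varphi(s)\otimes D\varphi(s)\big]^{-1}\big(D^3f[s]\otimes E+E\otimes D^3f[s]\big)(d\varphi(s))^4\,ds$$ $$+3\int_\tau^t\big[D\varphi(s)\otimes D\varphi(s)\big]^{-1}\big(D^2f[s]\otimes E-E\otimes D^2f[s]\big)\big(d^2\varphi(s)\otimes(d\varphi(s))^2-(d\varphi(s))^2\otimes d^2\varphi(s)\big)\,ds\Big\}.$$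
   Context: Vectors are columns. $E$ is the $n\times n$ unit matrix. $\otimes$ is the Kronecker product, $A\otimes B=[a_{rs}B]$. For a column $v$, $v^k$ denotes the Kronecker product $v\otimes\cdots\otimes v$ ($k$ factors). For a $C^1$ matrix function $M$ of a variable in $\mathbb R^n$, $DM$ is the block matrix $[\frac{\partial}{\partial x_1}M\ \frac{\partial}{\partial x_2}M\ \cdots\ \frac{\partial}{\partial x_n}M]$; for a vector function $g$, $Dg$ is the Jacobi matrix and $D^mg=D(D^{m-1}g)$. $D$ applied to $f$ is with respect to $x$, and $D$ applied to $\varphi$ is with respect to $\xi$. "$C^3$ in $x$" means that the partial derivatives with respect to $x$ up to order $3$ exist and are continuous on $I\times\mathbb R^n$. $I(\tau,\xi)\subseteq I$ is the maximal interval of existence of the solution through $(\tau,\xi)$. *)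

theory Defs
  imports "HOL-Analysis.Analysis"
begin

text \<open>Products of index types replace products of dimensions: the pair \<open>(i, j)\<close> is the
  \<open>j\<close>-th position inside the \<open>i\<close>-th block.\<close>

definition kron_vec :: "real^'a \<Rightarrow> real^'b \<Rightarrow> real^('a \<times> 'b)"  (infixr "\<otimes>\<^sub>v" 75) where
  "v \<otimes>\<^sub>v w = (\<chi> p. v $ fst p * w $ snd p)"

definition kron_mat ::
    "real^'c^'r \<Rightarrow> real^'d^'s \<Rightarrow> real^('c \<times> 'd)^('r \<times> 's)"  (infixr "\<otimes>\<^sub>m" 75) where
  "A \<otimes>\<^sub>m B = (\<chi> p q. A $ fst p $ fst q * B $ snd p $ snd q)"

text \<open>Index types such as \<open>('a \<times> 'b) \<times> 'c\<close> and \<open>'a \<times> ('b \<times> 'c)\<close> are different types, so the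
  strict associativity of the Kronecker product of numerical matrices becomes an explicit
  re-bracketing of indices. Powers of vectors are bracketed to the right throughout.\<close>

definition reindex :: "('j \<Rightarrow> 'i) \<Rightarrow> real^'i \<Rightarrow> real^'j" where
  "reindex \<sigma> v = (\<chi> j. v $ \<sigma> j)"

definition reindex_cols :: "('j \<Rightarrow> 'i) \<Rightarrow> real^'i^'r \<Rightarrow> real^'j^'r" where
  "reindex_cols \<sigma> A = (\<chi> r. reindex \<sigma> (A $ r))"

definition assoc3 :: "'a \<times> 'b \<times> 'c \<Rightarrow> ('a \<times> 'b) \<times> 'c" where
  "assoc3 = (\<lambda>(a, b, c). ((a, b), c))"

definition assoc4 :: "'a \<times> 'b \<times> 'c \<times> 'd \<Rightarrow> ('a \<times> 'b \<times> 'c) \<times> 'd" where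
  "assoc4 = (\<lambda>(a, b, c, d). ((a, b, c), d))"

text \<open>\<open>partial i g x\<close> is meaningful only where \<open>has_partial i g x\<close> holds. In \<open>D_mat\<close>
  the column index \<open>(i, c)\<close> is column \<open>c\<close> of the \<open>i\<close>-th block.\<close>

definition has_partial ::
    "'n::finite \<Rightarrow> (real^'n \<Rightarrow> 'b::real_normed_vector) \<Rightarrow> real^'n \<Rightarrow> bool" where
  "has_partial i g x \<longleftrightarrow> (\<lambda>s. g (x + s *\<^sub>R axis i 1)) differentiable (at 0)"

definition partial ::
    "'n::finite \<Rightarrow> (real^'n \<Rightarrow> 'b::real_normed_vector) \<Rightarrow> real^'n \<Rightarrow> 'b" where
  "partial i g x = vector_derivative (\<lambda>s. g (x + s *\<^sub>R axis i 1)) (at 0)"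

definition D_vec :: "(real^'n \<Rightarrow> real^'m) \<Rightarrow> real^'n \<Rightarrow> real^'n^'m" where
  "D_vec g x = (\<chi> r i. partial i g x $ r)"

definition D_mat :: "(real^'n \<Rightarrow> real^'c^'r) \<Rightarrow> real^'n \<Rightarrow> real^('n \<times> 'c)^'r" where
  "D_mat M x = (\<chi> r p. partial (fst p) M x $ r $ snd p)"

abbreviation D1 :: "(real^'n \<Rightarrow> real^'m) \<Rightarrow> real^'n \<Rightarrow> real^'n^'m" where
  "D1 g \<equiv> D_vec g"

abbreviation D2 :: "(real^'n \<Rightarrow> real^'m) \<Rightarrow> real^'n \<Rightarrow> real^('n \<times> 'n)^'m" where
  "D2 g \<equiv> D_mat (D1 g)"

abbreviation D3 :: "(real^'n \<Rightarrow> real^'m) \<Rightarrow> real^'n \<Rightarrow> real^('n \<times> 'n \<times> 'n)^'m" where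
  "D3 g \<equiv> D_mat (D2 g)"

text \<open>The partial derivatives in \<open>x\<close> up to order \<open>k\<close> exist and are continuous on
  \<open>I \<times> \<real>\<^sup>n\<close>, jointly in \<open>(t, x)\<close>.\<close>

fun C_in_x ::
    "nat \<Rightarrow> real set \<Rightarrow> (real \<Rightarrow> real^'n \<Rightarrow> 'b::real_normed_vector) \<Rightarrow> bool" where
  "C_in_x 0 I f \<longleftrightarrow> continuous_on (I \<times> UNIV) (\<lambda>(t, x). f t x)"
| "C_in_x (Suc k) I f \<longleftrightarrow>
     continuous_on (I \<times> UNIV) (\<lambda>(t, x). f t x) \<and>
     (\<forall>i. (\<forall>t\<in>I. \<forall>x. has_partial i (f t) x) \<and> C_in_x k I (\<lambda>t. partial i (f t)))"

text \<open>Since \<open>I\<close> is open, solutions are considered on open intervals. Maximal means not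
  properly extendable.\<close>

definition solution_through ::
    "(real \<Rightarrow> real^'n \<Rightarrow> real^'n) \<Rightarrow> real set \<Rightarrow> real \<Rightarrow> real^'n \<Rightarrow> real set \<Rightarrow> (real \<Rightarrow> real^'n) \<Rightarrow> bool"
  where
  "solution_through f I \<tau> \<xi> J x \<longleftrightarrow>
     open J \<and> is_interval J \<and> J \<subseteq> I \<and> \<tau> \<in> J \<and> x \<tau> = \<xi> \<and>
     (\<forall>t\<in>J. (x has_vector_derivative f t (x t)) (at t))"

definition maximal_solution ::
    "(real \<Rightarrow> real^'n \<Rightarrow> real^'n) \<Rightarrow> real set \<Rightarrow> real \<Rightarrow> real^'n \<Rightarrow> real set \<Rightarrow> (real \<Rightarrow> real^'n) \<Rightarrow> bool"
  where
  "maximal_solution f I \<tau> \<xi> J x \<longleftrightarrow>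
     solution_through f I \<tau> \<xi> J x \<and>
     (\<forall>J' y. solution_through f I \<tau> \<xi> J' y \<and> J \<subseteq> J' \<and> (\<forall>t\<in>J. y t = x t) \<longrightarrow> J' = J)"

end

theory Submission
  imports Defs
begin

text \<open>The partial derivatives of the flow up to order three are obtained without an existence
  theorem for differential equations. Local solutions are part of the hypotheses, and by Gronwall's
  inequality a family of approximate solutions of a linear equation is uniformly Cauchy, so that
  difference quotients converge to a solution of the variational equation. As the differentiated
  equation is again linear with coefficients that are differentiable in the initial value, the same
  step yields the second and the third derivatives.

  Write \<open>A = Df\<close>, \<open>P = D\<^sup>2f\<close>, \<open>Q = D\<^sup>3f\<close> along the solution, \<open>u\<close>, \<open>v\<close>, \<open>w\<close> for the first three
  directional derivatives. Then \<open>u' = A u\<close>, \<open>v' = A v + P u\<^sup>2\<close> and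
  \<open>w' = A w + 3 P (v \<otimes> u) + Q u\<^sup>3\<close>, so that \<open>w \<otimes> u + u \<otimes> w - 3 v\<^sup>2\<close> solves an inhomogeneous
  equation with coefficient \<open>A \<otimes> E + E \<otimes> A\<close>, whose fundamental matrix is \<open>D\<phi> \<otimes> D\<phi>\<close>. The
  formula is variation of constants.\<close>

section \<open>Gronwall estimates and approximate solutions\<close>

text \<open>Partial derivatives of \<open>\<phi>\<close> in the initial value make sense only where
  neighbouring solutions live on a common time interval. So all estimates are made on a compact
  interval \<open>{a..b}\<close> containing \<open>\<tau>\<close>, in the end the one spanned by
  \<open>\<tau>\<close> and \<open>t\<close>, and for the \<open>p\<close> with
  \<open>{a..b} \<subseteq> J \<tau> p\<close>. That these \<open>p\<close> form an open set is the
  first obstacle; it takes a stability estimate together with an extension argument at the boundary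
  of \<open>J \<tau> p\<close>. The hypotheses give partial derivatives only, so increments are
  estimated coordinate by coordinate. To differentiate a linear equation in the parameter, the
  difference quotients of its coefficients must converge uniformly in time. Joint continuity of
  their partial derivatives yields this by compactness, and is therefore carried along at every
  order. The first derivative stands apart because it linearises a nonlinear equation; from then on
  the initial values (\<open>axis i 1\<close>, then \<open>0\<close>) are the same for all
  parameters and one lemma serves both remaining orders. Symmetry of \<open>D\<^sup>2f\<close> is
  what collects the mixed terms of the third derivative into
  \<open>3 P (v \<otimes> u)\<close>.\<close>

lemma gronwall_unit:
  fixes v :: "real \<Rightarrow> 'a::real_inner"
  assumes v: "\<And>s. s \<in> {0..1} \<Longrightarrow> (v has_vector_derivative v' s) (at s within {0..1})"
    and le: "\<And>s. s \<in> {0..1} \<Longrightarrow> norm (v' s) \<le> T * (K * norm (v s) + e)"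
    and "0 \<le> T" "0 \<le> K" "0 \<le> e"
  shows "norm (v 1) \<le> (norm (v 0) + e) * exp ((2 * K + 1) * T)"
proof -
  define c where "c = (2 * K + 1) * T"
  \<comment> \<open>The squared norm is used because the norm is not differentiable at
    \<open>0\<close>. Adding \<open>e\<^sup>2\<close> absorbs the cross term through
    \<open>2 * norm (v s) * e \<le> (norm (v s))\<^sup>2 + e\<^sup>2\<close>; this accounts for the
    \<open>+ 1\<close> in the exponent.\<close>
  define g where "g = (\<lambda>s. (v s \<bullet> v s + e\<^sup>2) * exp (- c * s))"
  have c: "c \<ge> 0" unfolding c_def using assms by auto
  have cv: "continuous_on {0..1} v"
    using v by (meson continuous_on_vector_derivative)
  have "g 1 \<le> g 0"
  proof (rule DERIV_nonpos_imp_decreasing_open[where f = g and a = 0 and b = 1])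
    show "continuous_on {0..1} g" unfolding g_def by (intro continuous_intros cv)
    fix s :: real assume s: "0 < s" "s < 1"
    have "(v has_vector_derivative v' s) (at s)"
      using v[of s] s by (simp add: at_within_Icc_at)
    then have "(v has_derivative (\<lambda>h. h *\<^sub>R v' s)) (at s)" by (simp add: has_vector_derivative_def)
    from has_derivative_inner[OF this this]
    have "((\<lambda>s. v s \<bullet> v s) has_derivative (\<lambda>h. v s \<bullet> (h *\<^sub>R v' s) + (h *\<^sub>R v' s) \<bullet> v s)) (at s)" .
    then have "((\<lambda>s. v s \<bullet> v s) has_real_derivative (2 * (v s \<bullet> v' s))) (at s)"
      by (simp add: has_field_derivative_def inner_commute mult_commute_abs algebra_simps)
    then have d: "(g has_real_derivative
       (2 * (v s \<bullet> v' s)) * exp (- c * s) + (v s \<bullet> v s + e\<^sup>2) * (exp (- c * s) * (- c))) (at s)"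
      unfolding g_def by (auto intro!: derivative_eq_intros)
    have "2 * (v s \<bullet> v' s) \<le> 2 * (norm (v s) * norm (v' s))"
      by (meson mult_left_mono norm_cauchy_schwarz zero_le_numeral)
    also have "\<dots> \<le> 2 * (norm (v s) * (T * (K * norm (v s) + e)))"
      using le[of s] s by (intro mult_left_mono) auto
    also have "\<dots> = T * (2 * K * (norm (v s))\<^sup>2 + 2 * norm (v s) * e)"
      by (simp add: algebra_simps power2_eq_square)
    also have "\<dots> \<le> T * (2 * K * (norm (v s))\<^sup>2 + ((norm (v s))\<^sup>2 + e\<^sup>2))"
      using sum_squares_bound[of "norm (v s)" e] \<open>0 \<le> T\<close> by (intro mult_left_mono add_left_mono) auto
    also have "\<dots> \<le> c * (v s \<bullet> v s + e\<^sup>2)"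
      unfolding c_def using \<open>0 \<le> T\<close> \<open>0 \<le> K\<close> 
      by (simp add: algebra_simps power2_norm_eq_inner mult_nonneg_nonneg)
    finally have "2 * (v s \<bullet> v' s) - c * (v s \<bullet> v s + e\<^sup>2) \<le> 0" by simp
    then have "(2 * (v s \<bullet> v' s) - c * (v s \<bullet> v s + e\<^sup>2)) * exp (- c * s) \<le> 0"
      by (simp add: mult_nonpos_nonneg)
    then show "\<exists>y. DERIV g s :> y \<and> y \<le> 0" 
      using d by (intro exI[of _ "(2 * (v s \<bullet> v' s)) * exp (- c * s) + (v s \<bullet> v s + e\<^sup>2) * (exp (- c * s) * (- c))"]) (simp add: algebra_simps)
  qed simp
  then have "(v 1 \<bullet> v 1 + e\<^sup>2) * exp (- c) \<le> v 0 \<bullet> v 0 + e\<^sup>2" by (simp add: g_def)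
  then have "(v 1 \<bullet> v 1 + e\<^sup>2) \<le> (v 0 \<bullet> v 0 + e\<^sup>2) * exp c"
    by (simp add: exp_minus field_simps)
  also have "\<dots> \<le> (norm (v 0) + e)\<^sup>2 * exp c"
    using \<open>0 \<le> e\<close> by (intro mult_right_mono) (auto simp: power2_eq_square algebra_simps dot_square_norm)
  \<comment> \<open>Doubling the exponent makes the right-hand side a square, so that the root can
    be taken without halving \<open>c\<close>.\<close>
  also have "\<dots> \<le> (norm (v 0) + e)\<^sup>2 * (exp c * exp c)"
    using c by (intro mult_left_mono) auto
  finally have "(norm (v 1))\<^sup>2 \<le> ((norm (v 0) + e) * exp c)\<^sup>2"
    by (auto simp: power2_norm_eq_inner power_mult_distrib power2_eq_square[of "exp c"] intro: order_trans[rotated])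
  then show ?thesis unfolding c_def
    by (rule power2_le_imp_le) (use \<open>0 \<le> e\<close> in auto)
qed

text \<open>The segment from \<open>\<tau>\<close> to \<open>t\<close> is parametrised over
  \<open>{0..1}\<close>. The factor \<open>t - \<tau>\<close> enters only through its absolute
  value, so both time directions are treated at once.\<close>

lemma gronwall:
  fixes u :: "real \<Rightarrow> 'a::real_inner"
  assumes u: "\<And>s. s \<in> closed_segment \<tau> t \<Longrightarrow>
      \<exists>d. (u has_vector_derivative d) (at s within closed_segment \<tau> t) \<and> norm d \<le> K * norm (u s) + e"
    and "0 \<le> K" "0 \<le> e"
  shows "norm (u t) \<le> (norm (u \<tau>) + e) * exp ((2 * K + 1) * \<bar>t - \<tau>\<bar>)"
proof -
  obtain d where d: "\<And>s. s \<in> closed_segment \<tau> t \<Longrightarrow>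
      (u has_vector_derivative d s) (at s within closed_segment \<tau> t) \<and> norm (d s) \<le> K * norm (u s) + e"
    using u by metis
  define l where "l = (\<lambda>x. \<tau> + x * (t - \<tau>))"
  have l: "l ` {0..1} \<subseteq> closed_segment \<tau> t"
  proof
    fix y assume "y \<in> l ` {0..1}"
    then obtain x where "x \<in> {0..1}" "y = l x" by blast
    then show "y \<in> closed_segment \<tau> t"
      unfolding closed_segment_def l_def by (auto intro!: exI[of _ x] simp: algebra_simps)
  qed
  have "norm ((u \<circ> l) 1) \<le> (norm ((u \<circ> l) 0) + e) * exp ((2 * K + 1) * \<bar>t - \<tau>\<bar>)"
  proof (rule gronwall_unit[where v' = "\<lambda>s. (t - \<tau>) *\<^sub>R d (l s)"])
    fix s :: real assume s: "s \<in> {0..1}"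
    then have ls: "l s \<in> closed_segment \<tau> t" using l by auto
    have "(l has_vector_derivative (t - \<tau>)) (at s within {0..1})"
      unfolding l_def by (auto intro!: derivative_eq_intros)
    then show "(u \<circ> l has_vector_derivative (t - \<tau>) *\<^sub>R d (l s)) (at s within {0..1})"
      using d[OF ls] l
      by (intro vector_diff_chain_within) (auto intro: has_vector_derivative_within_subset)
    show "norm ((t - \<tau>) *\<^sub>R d (l s)) \<le> \<bar>t - \<tau>\<bar> * (K * norm ((u \<circ> l) s) + e)"
      using d[OF ls] by (auto intro: mult_left_mono)
  qed (use assms in auto)
  then show ?thesis by (simp add: l_def)
qed

lemma gronwall_Icc:
  fixes u :: "real \<Rightarrow> 'a::real_inner"
  assumes u: "\<And>s. s \<in> {a..b} \<Longrightarrow>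
      \<exists>d. (u has_vector_derivative d) (at s within {a..b}) \<and> norm d \<le> K * norm (u s) + e"
    and "0 \<le> K" "0 \<le> e" "\<tau> \<in> {a..b}" "t \<in> {a..b}"
  shows "norm (u t) \<le> (norm (u \<tau>) + e) * exp ((2 * K + 1) * (b - a))"
proof -
  have sub: "closed_segment \<tau> t \<subseteq> {a..b}"
    using assms by (auto simp: closed_segment_eq_real_ivl split: if_splits)
  have "norm (u t) \<le> (norm (u \<tau>) + e) * exp ((2 * K + 1) * \<bar>t - \<tau>\<bar>)"
  proof (rule gronwall)
    fix s assume "s \<in> closed_segment \<tau> t"
    with sub u[of s] show "\<exists>d. (u has_vector_derivative d) (at s within closed_segment \<tau> t) \<and> norm d \<le> K * norm (u s) + e"
      by (meson has_vector_derivative_within_subset subsetD)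
  qed (use assms in auto)
  also have "\<dots> \<le> (norm (u \<tau>) + e) * exp ((2 * K + 1) * (b - a))"
    using assms by (intro mult_left_mono) (auto intro!: mult_left_mono)
  finally show ?thesis .
qed

text \<open>Gronwall with error \<open>0\<close>. The zero of \<open>u\<close> may sit anywhere in
  the interval, so a solution can be traced backwards as well as forwards in time.\<close>

lemma linear_ode_unique:
  fixes u :: "real \<Rightarrow> 'a::real_inner"
  assumes u: "\<And>s. s \<in> {a..b} \<Longrightarrow> (u has_vector_derivative A s (u s)) (at s within {a..b})"
    and "\<And>s v. s \<in> {a..b} \<Longrightarrow> norm (A s v) \<le> K * norm v"
    and "\<tau> \<in> {a..b}" "t \<in> {a..b}" "u \<tau> = 0"
  shows "u t = 0"
proof -
  have "norm (u t) \<le> (norm (u \<tau>) + 0) * exp ((2 * \<bar>K\<bar> + 1) * (b - a))"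
  proof (rule gronwall_Icc)
    fix s assume s: "s \<in> {a..b}"
    have "norm (A s (u s)) \<le> \<bar>K\<bar> * norm (u s)"
      using assms(2)[OF s, of "u s"] by (smt (verit) mult_right_mono norm_ge_zero)
    then show "\<exists>d. (u has_vector_derivative d) (at s within {a..b}) \<and> norm d \<le> \<bar>K\<bar> * norm (u s) + 0"
      using u[OF s] by auto
  qed (use assms in auto)
  then show ?thesis using assms by simp
qed

text \<open>Families of approximate solutions of a linear equation converge to a solution; no existence
  theorem for linear equations is needed, as completeness supplies the limit.\<close>

lemma approximate_solutions_converge:
  fixes q :: "'s \<Rightarrow> real \<Rightarrow> 'a::euclidean_space" and F :: "'s filter"
  assumes F: "F \<noteq> bot" and \<tau>: "\<tau> \<in> {a..b}"
    and A: "\<And>t. t \<in> {a..b} \<Longrightarrow> linear (A t)" "\<And>t v. t \<in> {a..b} \<Longrightarrow> norm (A t v) \<le> K * norm v"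
    and B: "\<And>t. t \<in> {a..b} \<Longrightarrow> norm (\<beta> t) \<le> B"
    and q: "\<And>e. 0 < e \<Longrightarrow> \<forall>\<^sub>F s in F. norm (q s \<tau> - c) \<le> e \<and>
       (\<forall>t\<in>{a..b}. \<exists>d. (q s has_vector_derivative d) (at t within {a..b}) \<and>
           norm (d - (A t (q s t) + \<beta> t)) \<le> e * (1 + norm (q s t)))"
  obtains z where "z \<tau> = c"
    "\<And>t. t \<in> {a..b} \<Longrightarrow> (z has_vector_derivative A t (z t) + \<beta> t) (at t within {a..b})"
    "\<And>e. 0 < e \<Longrightarrow> \<forall>\<^sub>F s in F. \<forall>t\<in>{a..b}. norm (q s t - z t) \<le> e"
proof -
  \<comment> \<open>The error is relative to \<open>1 + norm (q s t)\<close>: a difference quotient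
    meets the perturbed coefficient multiplied by the quotient itself, whose size is not known in
    advance.\<close>
  define good where "good = (\<lambda>s e. norm (q s \<tau> - c) \<le> e \<and>
       (\<forall>t\<in>{a..b}. \<exists>d. (q s has_vector_derivative d) (at t within {a..b}) \<and>
           norm (d - (A t (q s t) + \<beta> t)) \<le> e * (1 + norm (q s t))))"
  \<comment> \<open>Nonnegativity is forced by the bound on \<open>A \<tau>\<close> at a single
    basis vector, which has norm \<open>1\<close>.\<close>
  have K0: "0 \<le> K"
  proof -
    have "0 \<le> K * norm (SOME b. b \<in> (Basis :: 'a set))"
      using A(2)[OF \<tau>, of "SOME b. b \<in> (Basis :: 'a set)"] norm_ge_zero order_trans by blast
    then show ?thesis by (simp add: SOME_Basis)
  qed
  have B0: "0 \<le> B" using B[OF \<tau>] norm_ge_zero order_trans by blast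
  \<comment> \<open>A priori bound for all approximations with tolerance at most \<open>1\<close>:
    the error then raises both \<open>K\<close> and \<open>B\<close> by \<open>1\<close>, and the
    initial norm is at most \<open>norm c + 1\<close>.\<close>
  define M where "M = (norm c + 1 + (B + 1)) * exp ((2 * (K + 1) + 1) * (b - a))"
  have M0: "0 \<le> M" unfolding M_def using B0 by auto
  have bound: "norm (q s t) \<le> M" if g: "good s e" and e: "0 < e" "e \<le> 1" and t: "t \<in> {a..b}" for s e t
  proof -
    have "norm (q s t) \<le> (norm (q s \<tau>) + (B + 1)) * exp ((2 * (K + 1) + 1) * (b - a))"
    proof (rule gronwall_Icc)
      fix x assume x: "x \<in> {a..b}"
      obtain d where d: "(q s has_vector_derivative d) (at x within {a..b})"
          "norm (d - (A x (q s x) + \<beta> x)) \<le> e * (1 + norm (q s x))"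
        using g x unfolding good_def by blast
      have "e * (1 + norm (q s x)) \<le> 1 * (1 + norm (q s x))"
        using e by (intro mult_right_mono) auto
      then have "norm d \<le> K * norm (q s x) + B + (1 + norm (q s x))"
        using d(2) A(2)[OF x, of "q s x"] B[OF x] 
          norm_triangle_ineq[of "d - (A x (q s x) + \<beta> x)" "A x (q s x) + \<beta> x"]
          norm_triangle_ineq[of "A x (q s x)" "\<beta> x"] by simp
      then show "\<exists>d. (q s has_vector_derivative d) (at x within {a..b}) \<and> norm d \<le> (K + 1) * norm (q s x) + (B + 1)"
        using d(1) by (intro exI[of _ d]) (simp add: algebra_simps)
    qed (use K0 B0 \<tau> t in auto)
    moreover have "norm (q s \<tau>) \<le> norm c + 1"
      using g e norm_triangle_ineq[of "q s \<tau> - c" c] unfolding good_def by simp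
    ultimately show ?thesis unfolding M_def
      by (smt (verit) exp_gt_zero mult_right_mono)
  qed
  \<comment> \<open>Once the approximations are bounded by \<open>M\<close>, the inhomogeneity
    \<open>\<beta>\<close> cancels in the difference of two of them, and Gronwall bounds that
    difference by a multiple of the sum of their tolerances.\<close>
  define C where "C = (2 + (1 + M)) * exp ((2 * K + 1) * (b - a))"
  have C0: "0 < C" unfolding C_def using M0 by (intro mult_pos_pos) auto
  have cauchy: "norm (q s t - q r t) \<le> C * (e + e')"
    if g: "good s e" "good r e'" and e: "0 < e" "e \<le> 1" "0 < e'" "e' \<le> 1" and t: "t \<in> {a..b}" for s r e e' t
  proof -
    have "norm ((\<lambda>t. q s t - q r t) t) \<le> (norm ((\<lambda>t. q s t - q r t) \<tau>) + (e + e') * (1 + M)) * exp ((2 * K + 1) * (b - a))"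
    proof (rule gronwall_Icc)
      fix x assume x: "x \<in> {a..b}"
      obtain d where d: "(q s has_vector_derivative d) (at x within {a..b})"
          "norm (d - (A x (q s x) + \<beta> x)) \<le> e * (1 + norm (q s x))"
        using g x unfolding good_def by blast
      obtain d' where d': "(q r has_vector_derivative d') (at x within {a..b})"
          "norm (d' - (A x (q r x) + \<beta> x)) \<le> e' * (1 + norm (q r x))"
        using g x unfolding good_def by blast
      have 1: "norm (d - (A x (q s x) + \<beta> x)) \<le> e * (1 + M)"
        using d(2) bound[OF g(1) e(1,2) x] e by (smt (verit) mult_left_mono)
      have 2: "norm (d' - (A x (q r x) + \<beta> x)) \<le> e' * (1 + M)"
        using d'(2) bound[OF g(2) e(3,4) x] e by (smt (verit) mult_left_mono)
      have "d - d' = A x (q s x - q r x) + ((d - (A x (q s x) + \<beta> x)) - (d' - (A x (q r x) + \<beta> x)))"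
        by (simp add: linear_diff[OF A(1)[OF x]])
      also have "norm \<dots> \<le> K * norm (q s x - q r x) + (e * (1 + M) + e' * (1 + M))"
        by (intro order_trans[OF norm_triangle_ineq] add_mono A(2) x order_trans[OF norm_triangle_ineq4] 1 2)
      finally show "\<exists>d. ((\<lambda>t. q s t - q r t) has_vector_derivative d) (at x within {a..b}) \<and>
           norm d \<le> K * norm (q s x - q r x) + (e + e') * (1 + M)"
        using d(1) d'(1) by (intro exI[of _ "d - d'"]) (auto intro: has_vector_derivative_diff simp: algebra_simps)
    qed (use K0 M0 \<tau> t e in auto)
    moreover have "norm (q s \<tau> - q r \<tau>) \<le> e + e'"
      using g norm_triangle_ineq4[of "q s \<tau> - c" "q r \<tau> - c"] unfolding good_def by simp
    ultimately have "norm (q s t - q r t) \<le> (e + e' + (e + e') * (1 + M)) * exp ((2 * K + 1) * (b - a))"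
      by (smt (verit) exp_gt_zero mult_right_mono)
    also have "\<dots> \<le> C * (e + e')"
    proof -
      have "(e + e' + (e + e') * (1 + M)) \<le> (2 + (1 + M)) * (e + e')" using e by (simp add: algebra_simps)
      then show ?thesis unfolding C_def by (smt (verit) exp_gt_zero mult_right_mono mult.assoc mult.commute)
    qed
    finally show ?thesis .
  qed
  \<comment> \<open>A sequence of approximations is extracted from the filter, since the theorem on
    termwise differentiation is about sequences; no countable basis of \<open>F\<close> is
    assumed.\<close>
  define \<epsilon> where "\<epsilon> = (\<lambda>n. 1 / real (Suc n))"
  have \<epsilon>: "0 < \<epsilon> n" "\<epsilon> n \<le> 1" for n by (auto simp: \<epsilon>_def)
  have \<epsilon>0: "\<epsilon> \<longlonglongrightarrow> 0" unfolding \<epsilon>_def using LIMSEQ_inverse_real_of_nat by (simp add: inverse_eq_divide)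
  have ex: "\<exists>s. good s (\<epsilon> n)" for n
  proof -
    have "\<forall>\<^sub>F s in F. good s (\<epsilon> n)" unfolding good_def using q[OF \<epsilon>(1)] .
    then show ?thesis using F eventually_happens by blast
  qed
  then obtain \<sigma> where \<sigma>: "\<And>n. good (\<sigma> n) (\<epsilon> n)" by metis
  have conv: "\<exists>z. \<forall>t\<in>{a..b}. (\<lambda>n. q (\<sigma> n) t) \<longlonglongrightarrow> z t"
  proof (intro bchoice ballI)
    fix t assume t: "t \<in> {a..b}"
    have "Cauchy (\<lambda>n. q (\<sigma> n) t)"
    proof (rule metric_CauchyI)
      fix e :: real assume "0 < e"
      then have "\<forall>\<^sub>F n in sequentially. \<epsilon> n < e / (2 * C)"
        using order_tendstoD(2)[OF \<epsilon>0] C0 by simp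
      then obtain N where N: "\<And>n. n \<ge> N \<Longrightarrow> \<epsilon> n < e / (2 * C)"
        unfolding eventually_sequentially by blast
      have "dist (q (\<sigma> m) t) (q (\<sigma> n) t) < e" if "m \<ge> N" "n \<ge> N" for m n
      proof -
        have "dist (q (\<sigma> m) t) (q (\<sigma> n) t) \<le> C * (\<epsilon> m + \<epsilon> n)"
          unfolding dist_norm by (rule cauchy[OF \<sigma> \<sigma> \<epsilon> \<epsilon> t])
        also have "\<dots> < C * (e / (2 * C) + e / (2 * C))"
          using N[OF that(1)] N[OF that(2)] C0 by (intro mult_strict_left_mono) auto
        also have "\<dots> = e" using C0 by simp
        finally show ?thesis .
      qed
      then show "\<exists>M. \<forall>m\<ge>M. \<forall>n\<ge>M. dist (q (\<sigma> m) t) (q (\<sigma> n) t) < e" by blast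
    qed
    then show "\<exists>x. (\<lambda>n. q (\<sigma> n) t) \<longlonglongrightarrow> x" by (simp add: Cauchy_convergent_iff convergent_def)
  qed
  then obtain z where z: "\<And>t. t \<in> {a..b} \<Longrightarrow> (\<lambda>n. q (\<sigma> n) t) \<longlonglongrightarrow> z t" by blast
  \<comment> \<open>Passing to the limit in the Cauchy estimate shows that every good approximation
    is close to \<open>z\<close>, not only the members of the chosen sequence. This carries
    convergence back to \<open>F\<close>.\<close>
  have est: "norm (q s t - z t) \<le> C * e" if "good s e" "0 < e" "e \<le> 1" "t \<in> {a..b}" for s e t
  proof (rule LIMSEQ_le)
    show "(\<lambda>n. norm (q s t - q (\<sigma> n) t)) \<longlonglongrightarrow> norm (q s t - z t)"
      by (intro tendsto_intros z that)
    show "(\<lambda>n. C * (e + \<epsilon> n)) \<longlonglongrightarrow> C * e"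
      using tendsto_mult[OF tendsto_const tendsto_add[OF tendsto_const \<epsilon>0], of C e] by simp
    show "\<exists>N. \<forall>n\<ge>N. norm (q s t - q (\<sigma> n) t) \<le> C * (e + \<epsilon> n)"
      using cauchy[OF that(1) \<sigma> that(2,3) \<epsilon> that(4)] by blast
  qed
  have "\<exists>d. \<forall>t\<in>{a..b}. (q (\<sigma> n) has_vector_derivative d t) (at t within {a..b}) \<and>
           norm (d t - (A t (q (\<sigma> n) t) + \<beta> t)) \<le> \<epsilon> n * (1 + norm (q (\<sigma> n) t))" for n
    using \<sigma>[of n] unfolding good_def by (intro bchoice) auto
  then obtain d where d: "\<And>n t. t \<in> {a..b} \<Longrightarrow> (q (\<sigma> n) has_vector_derivative d n t) (at t within {a..b})"
     "\<And>n t. t \<in> {a..b} \<Longrightarrow> norm (d n t - (A t (q (\<sigma> n) t) + \<beta> t)) \<le> \<epsilon> n * (1 + norm (q (\<sigma> n) t))"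
    by metis
  \<comment> \<open>The derivatives \<open>d n\<close> converge uniformly to
    \<open>A t (z t) + \<beta> t\<close>: their distance is at most
    \<open>\<epsilon> n * (1 + M)\<close> from the defect plus \<open>K * (C * \<epsilon> n)\<close>
    from replacing the approximation by its limit.\<close>
  have "\<exists>g. \<forall>t\<in>{a..b}. (\<lambda>n. q (\<sigma> n) t) \<longlonglongrightarrow> g t \<and> (g has_derivative (\<lambda>h. h *\<^sub>R (A t (z t) + \<beta> t))) (at t within {a..b})"
  proof (rule has_derivative_sequence)
    show "(q (\<sigma> n) has_derivative (\<lambda>h. h *\<^sub>R d n t)) (at t within {a..b})" if "t \<in> {a..b}" for n t
      using d(1)[OF that] by (simp add: has_vector_derivative_def)
    show "(\<lambda>n. q (\<sigma> n) \<tau>) \<longlonglongrightarrow> z \<tau>" by (rule z[OF \<tau>])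
    fix e :: real assume e: "0 < e"
    have "(\<lambda>n. \<epsilon> n * (1 + M + K * C)) \<longlonglongrightarrow> 0 * (1 + M + K * C)"
      by (intro tendsto_intros \<epsilon>0)
    then have "\<forall>\<^sub>F n in sequentially. \<epsilon> n * (1 + M + K * C) < e"
      using order_tendstoD(2) e by fastforce
    then show "\<forall>\<^sub>F n in sequentially. \<forall>x\<in>{a..b}. \<forall>h. norm (h *\<^sub>R d n x - h *\<^sub>R (A x (z x) + \<beta> x)) \<le> e * norm h"
    proof eventually_elim
      case (elim n)
      show ?case
      proof (intro ballI allI)
        fix x h assume x: "x \<in> {a..b}"
        have "norm (d n x - (A x (z x) + \<beta> x)) = norm ((d n x - (A x (q (\<sigma> n) x) + \<beta> x)) + A x (q (\<sigma> n) x - z x))"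
          by (simp add: linear_diff[OF A(1)[OF x]] algebra_simps)
        also have "\<dots> \<le> \<epsilon> n * (1 + M) + K * (C * \<epsilon> n)"
        proof (rule order_trans[OF norm_triangle_ineq], rule add_mono)
          show "norm (d n x - (A x (q (\<sigma> n) x) + \<beta> x)) \<le> \<epsilon> n * (1 + M)"
            using d(2)[OF x, of n] bound[OF \<sigma> \<epsilon> x, of n] \<epsilon>(1)[of n] by (smt (verit) mult_left_mono)
          show "norm (A x (q (\<sigma> n) x - z x)) \<le> K * (C * \<epsilon> n)"
            by (rule order_trans[OF A(2)[OF x]]) (use est[OF \<sigma> \<epsilon> x] K0 in \<open>auto intro: mult_left_mono\<close>)
        qed
        also have "\<dots> \<le> e" using elim by (simp add: algebra_simps)
        finally have "norm (d n x - (A x (z x) + \<beta> x)) \<le> e" .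
        then have "\<bar>h\<bar> * norm (d n x - (A x (z x) + \<beta> x)) \<le> \<bar>h\<bar> * e" by (rule mult_left_mono) simp
        then show "norm (h *\<^sub>R d n x - h *\<^sub>R (A x (z x) + \<beta> x)) \<le> e * norm h"
          by (simp add: scaleR_diff_right[symmetric] mult.commute)
      qed
    qed
  qed (use \<tau> in auto)
  then obtain g where g: "\<And>t. t \<in> {a..b} \<Longrightarrow> (\<lambda>n. q (\<sigma> n) t) \<longlonglongrightarrow> g t"
     "\<And>t. t \<in> {a..b} \<Longrightarrow> (g has_derivative (\<lambda>h. h *\<^sub>R (A t (z t) + \<beta> t))) (at t within {a..b})" by blast
  have gz: "g t = z t" if "t \<in> {a..b}" for t using LIMSEQ_unique g(1) z that by blast
  show thesis
  proof
    show "z \<tau> = c"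
    proof (rule LIMSEQ_unique[OF z[OF \<tau>]])
      show "(\<lambda>n. q (\<sigma> n) \<tau>) \<longlonglongrightarrow> c"
        by (rule metric_tendsto_imp_tendsto[OF \<epsilon>0])
          (use \<sigma> in \<open>auto simp: good_def dist_norm \<epsilon>(1) less_imp_le intro!: always_eventually\<close>)
    qed
    show "(z has_vector_derivative A t (z t) + \<beta> t) (at t within {a..b})" if "t \<in> {a..b}" for t
    proof (rule has_vector_derivative_transform[OF that])
      show "(g has_vector_derivative A t (z t) + \<beta> t) (at t within {a..b})"
        using g(2)[OF that] by (simp add: has_vector_derivative_def)
    qed (use gz in auto)
    fix e :: real assume e: "0 < e"
    \<comment> \<open>Small enough for \<open>est\<close>, which requires a tolerance at most
      \<open>1\<close>, and for the target bound \<open>C * e' \<le> e\<close>.\<close>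
    define e' where "e' = min 1 (e / C)"
    have e': "0 < e'" "e' \<le> 1" "C * e' \<le> e" unfolding e'_def using e C0 by (auto simp: min_def field_simps)
    have "\<forall>\<^sub>F s in F. good s e'" unfolding good_def using q[OF e'(1)] .
    then show "\<forall>\<^sub>F s in F. \<forall>t\<in>{a..b}. norm (q s t - z t) \<le> e"
      by eventually_elim (use est e' order_trans in blast)
  qed
qed

section \<open>Partial derivatives and joint continuity\<close>

lemma has_partial_iff:
  "has_partial i g x \<longleftrightarrow> ((\<lambda>s. g (x + s *\<^sub>R axis i 1)) has_vector_derivative partial i g x) (at 0)"
  unfolding has_partial_def partial_def by (rule vector_derivative_works)

lemma partialI:
  assumes "((\<lambda>s. g (x + s *\<^sub>R axis i 1)) has_vector_derivative d) (at 0)"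
  shows "has_partial i g x" "partial i g x = d"
  unfolding has_partial_def partial_def
  using assms by (auto intro: differentiableI_vector vector_derivative_at)

lemma has_partial_line:
  assumes "has_partial i g (x + \<sigma> *\<^sub>R axis i 1)"
  shows "((\<lambda>s. g (x + s *\<^sub>R axis i 1)) has_vector_derivative partial i g (x + \<sigma> *\<^sub>R axis i 1)) (at \<sigma>)"
proof -
  let ?G = "\<lambda>s. g ((x + \<sigma> *\<^sub>R axis i 1) + s *\<^sub>R axis i 1)"
  have "((\<lambda>s. s - \<sigma>) has_vector_derivative 1) (at \<sigma>)"
    by (auto intro!: derivative_eq_intros)
  moreover have "(?G has_vector_derivative partial i g (x + \<sigma> *\<^sub>R axis i 1)) (at ((\<lambda>s. s - \<sigma>) \<sigma>))"
    using assms by (simp add: has_partial_iff)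
  ultimately have "(?G \<circ> (\<lambda>s. s - \<sigma>) has_vector_derivative 1 *\<^sub>R partial i g (x + \<sigma> *\<^sub>R axis i 1)) (at \<sigma>)"
    by (rule vector_diff_chain_at)
  moreover have "?G \<circ> (\<lambda>s. s - \<sigma>) = (\<lambda>s. g (x + s *\<^sub>R axis i 1))"
    by (auto simp: algebra_simps fun_eq_iff)
  ultimately show ?thesis by simp
qed

text \<open>The mean value inequality for
  \<open>g (x + r *\<^sub>R axis i 1) - r *\<^sub>R d\<close> on the segment between
  \<open>0\<close> and \<open>s\<close>, whichever sign \<open>s\<close> has.\<close>

lemma partial_increment_axis:
  fixes g :: "real^'n \<Rightarrow> 'b::real_normed_vector"
  assumes "\<And>r. r \<in> closed_segment 0 s \<Longrightarrow>
      has_partial i g (x + r *\<^sub>R axis i 1) \<and> norm (partial i g (x + r *\<^sub>R axis i 1) - d) \<le> \<epsilon>"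
  shows "norm (g (x + s *\<^sub>R axis i 1) - g x - s *\<^sub>R d) \<le> \<epsilon> * \<bar>s\<bar>"
proof -
  let ?S = "closed_segment 0 s"
  let ?h = "\<lambda>r. g (x + r *\<^sub>R axis i 1) - r *\<^sub>R d"
  have "norm (?h s - ?h 0) \<le> \<epsilon> * norm (s - 0)"
  proof (rule differentiable_bound[where S = ?S and f = ?h])
    fix r assume r: "r \<in> ?S"
    let ?d = "partial i g (x + r *\<^sub>R axis i 1) - d"
    have "((\<lambda>r. g (x + r *\<^sub>R axis i 1)) has_vector_derivative partial i g (x + r *\<^sub>R axis i 1)) (at r within ?S)"
      using has_partial_line assms[OF r] has_vector_derivative_at_within by blast
    then have "(?h has_vector_derivative ?d) (at r within ?S)"
      by (auto intro!: derivative_eq_intros)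
    then show "(?h has_derivative (\<lambda>v. v *\<^sub>R ?d)) (at r within ?S)"
      by (simp add: has_vector_derivative_def)
    show "onorm (\<lambda>v. v *\<^sub>R ?d) \<le> \<epsilon>"
      by (rule onorm_le) (use assms[OF r] in \<open>auto simp: mult.commute[of \<epsilon>] intro: mult_left_mono\<close>)
  qed auto
  then show ?thesis by (simp add: algebra_simps)
qed

text \<open>The increment is telescoped along a path that changes one coordinate at a time. The
  reference values \<open>d k\<close> are free: partial derivatives at a base point give a
  first-order expansion, zero gives a Lipschitz bound.\<close>

lemma partial_increment:
  fixes g :: "real^'n \<Rightarrow> 'b::real_normed_vector"
  assumes "\<And>k z. norm (z - x) \<le> norm v \<Longrightarrow> has_partial k g z \<and> norm (partial k g z - d k) \<le> \<epsilon>"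
  shows "norm (g (x + v) - g x - (\<Sum>k\<in>UNIV. v $ k *\<^sub>R d k)) \<le> real CARD('n) * \<epsilon> * norm v"
proof -
  \<comment> \<open>The corners of the path are \<open>x + w S\<close>. Replacing coordinates by
    \<open>0\<close> cannot increase the norm, so the path stays within distance
    \<open>norm v\<close> of \<open>x\<close>.\<close>
  define w where "w = (\<lambda>S. \<chi> k. if k \<in> S then v $ k else 0)"
  have \<epsilon>: "0 \<le> \<epsilon>" using assms[of x undefined] order_trans[OF norm_ge_zero] by auto
  have "norm (g (x + w S) - g x - (\<Sum>k\<in>S. v $ k *\<^sub>R d k)) \<le> real (card S) * \<epsilon> * norm v" for S :: "'n set"
  proof (induction S rule: finite_induct[OF finite])
    case 1
    have "w {} = 0" by (simp add: w_def vec_eq_iff)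
    then show ?case by simp
  next
    case (2 k S)
    have wi: "w (insert k S) = w S + v $ k *\<^sub>R axis k 1"
      using 2(2) by (auto simp: w_def vec_eq_iff axis_def)
    have "norm (g ((x + w S) + v $ k *\<^sub>R axis k 1) - g (x + w S) - v $ k *\<^sub>R d k) \<le> \<epsilon> * \<bar>v $ k\<bar>"
    proof (rule partial_increment_axis)
      fix r assume r: "r \<in> closed_segment 0 (v $ k)"
      have "\<bar>r\<bar> \<le> \<bar>v $ k\<bar>" using segment_bound1[OF r] by simp
      then have "norm (w S + r *\<^sub>R axis k 1) \<le> norm v"
        using 2(2) by (intro norm_le_componentwise_cart) (auto simp: w_def axis_def)
      then show "has_partial k g (x + w S + r *\<^sub>R axis k 1) \<and> norm (partial k g (x + w S + r *\<^sub>R axis k 1) - d k) \<le> \<epsilon>"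
        by (intro assms) (simp add: algebra_simps)
    qed
    also have "\<dots> \<le> \<epsilon> * norm v" using \<epsilon> component_le_norm_cart by (intro mult_left_mono) auto
    finally have step: "norm (g (x + w (insert k S)) - g (x + w S) - v $ k *\<^sub>R d k) \<le> \<epsilon> * norm v"
      by (simp add: wi algebra_simps)
    have "g (x + w (insert k S)) - g x - (\<Sum>k\<in>insert k S. v $ k *\<^sub>R d k) =
       (g (x + w (insert k S)) - g (x + w S) - v $ k *\<^sub>R d k) + (g (x + w S) - g x - (\<Sum>k\<in>S. v $ k *\<^sub>R d k))"
      using 2 by simp
    also have "norm \<dots> \<le> \<epsilon> * norm v + real (card S) * \<epsilon> * norm v"
      by (rule order_trans[OF norm_triangle_ineq add_mono[OF step 2(3)]])
    finally show ?case using 2 by (simp add: algebra_simps)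
  qed
  from this[of UNIV] show ?thesis by (simp add: w_def)
qed

text \<open>The increment estimate with the partial derivatives at \<open>x\<close> as reference
  values. Total differentiability is required by the chain rule along the flow, which does not move
  parallel to the axes.\<close>

lemma continuous_partials_imp_has_derivative:
  fixes g :: "real^'n \<Rightarrow> 'b::real_normed_vector"
  assumes p: "\<And>k z. has_partial k g z" and c: "\<And>k. isCont (partial k g) x"
  shows "(g has_derivative (\<lambda>v. \<Sum>k\<in>UNIV. v $ k *\<^sub>R partial k g x)) (at x)"
  unfolding has_derivative_within_alt
proof (intro conjI allI impI)
  show "bounded_linear (\<lambda>v. \<Sum>k\<in>UNIV. v $ k *\<^sub>R partial k g x)"
    by (intro bounded_linear_sum bounded_linear_compose[OF bounded_linear_scaleR_left bounded_linear_vec_nth])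
  fix e :: real assume e: "0 < e"
  define \<epsilon> where "\<epsilon> = e / real CARD('n)"
  have \<epsilon>: "0 < \<epsilon>" using e by (simp add: \<epsilon>_def)
  have "\<forall>\<^sub>F z in nhds x. \<forall>k. dist (partial k g z) (partial k g x) < \<epsilon>"
    using c \<epsilon> by (intro eventually_all_finite tendstoD) (auto simp: isCont_def tendsto_at_iff_tendsto_nhds)
  then obtain r where r: "0 < r" "\<And>z k. dist z x < r \<Longrightarrow> dist (partial k g z) (partial k g x) < \<epsilon>"
    unfolding eventually_nhds_metric by blast
  show "\<exists>r>0. \<forall>y\<in>UNIV. norm (y - x) < r \<longrightarrow>
       norm (g y - g x - (\<Sum>k\<in>UNIV. (y - x) $ k *\<^sub>R partial k g x)) \<le> e * norm (y - x)"
  proof (intro exI[of _ r] conjI ballI impI r)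
    fix y assume y: "norm (y - x) < r"
    have "norm (g (x + (y - x)) - g x - (\<Sum>k\<in>UNIV. (y - x) $ k *\<^sub>R partial k g x)) \<le> real CARD('n) * \<epsilon> * norm (y - x)"
    proof (rule partial_increment)
      fix k z assume "norm (z - x) \<le> norm (y - x)"
      then show "has_partial k g z \<and> norm (partial k g z - partial k g x) \<le> \<epsilon>"
        using p r(2)[of z k] y by (simp add: dist_norm less_imp_le)
    qed
    then show "norm (g y - g x - (\<Sum>k\<in>UNIV. (y - x) $ k *\<^sub>R partial k g x)) \<le> e * norm (y - x)"
      by (simp add: \<epsilon>_def)
  qed
qed

lemma partial_bounded_bilinear:
  assumes "bounded_bilinear B" "has_partial i g p" "has_partial i h p"
  shows "has_partial i (\<lambda>p. B (g p) (h p)) p"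
    "partial i (\<lambda>p. B (g p) (h p)) p = B (g p) (partial i h p) + B (partial i g p) (h p)"
  using bounded_bilinear.has_vector_derivative[OF assms(1) assms(2,3)[unfolded has_partial_iff]]
  by (auto intro: partialI)

lemma partial_sum:
  assumes "finite S" "\<And>k. k \<in> S \<Longrightarrow> has_partial i (g k) p"
  shows "has_partial i (\<lambda>p. \<Sum>k\<in>S. g k p) p" "partial i (\<lambda>p. \<Sum>k\<in>S. g k p) p = (\<Sum>k\<in>S. partial i (g k) p)"
proof -
  have "((\<lambda>s. \<Sum>k\<in>S. g k (p + s *\<^sub>R axis i 1)) has_vector_derivative (\<Sum>k\<in>S. partial i (g k) p)) (at 0)"
    using assms by (intro has_vector_derivative_sum) (auto simp: has_partial_iff)
  then show "has_partial i (\<lambda>p. \<Sum>k\<in>S. g k p) p" "partial i (\<lambda>p. \<Sum>k\<in>S. g k p) p = (\<Sum>k\<in>S. partial i (g k) p)"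
    by (auto intro: partialI)
qed

lemma partial_chain:
  assumes "(G has_derivative G') (at (\<gamma> p))" "has_partial i \<gamma> p"
  shows "has_partial i (\<lambda>p. G (\<gamma> p)) p" "partial i (\<lambda>p. G (\<gamma> p)) p = G' (partial i \<gamma> p)"
proof -
  have "((\<lambda>s. \<gamma> (p + s *\<^sub>R axis i 1)) has_derivative (\<lambda>h. h *\<^sub>R partial i \<gamma> p)) (at 0)"
    using assms(2) by (simp add: has_partial_iff has_vector_derivative_def)
  then have "((\<lambda>s. G (\<gamma> (p + s *\<^sub>R axis i 1))) has_derivative (\<lambda>h. G' (h *\<^sub>R partial i \<gamma> p))) (at 0)"
    by (rule has_derivative_compose) (use assms in simp)
  then have "((\<lambda>s. G (\<gamma> (p + s *\<^sub>R axis i 1))) has_vector_derivative G' (partial i \<gamma> p)) (at 0)"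
    by (simp add: has_vector_derivative_def linear_scale[OF has_derivative_linear[OF assms(1)]])
  then show "has_partial i (\<lambda>p. G (\<gamma> p)) p" "partial i (\<lambda>p. G (\<gamma> p)) p = G' (partial i \<gamma> p)"
    by (auto intro: partialI)
qed

lemma partial_chain_C1:
  fixes G :: "real^'n \<Rightarrow> 'b::real_normed_vector"
  assumes "\<And>k z. has_partial k G z" "\<And>k. isCont (partial k G) (\<gamma> p)" "has_partial i \<gamma> p"
  shows "has_partial i (\<lambda>p. G (\<gamma> p)) p"
    "partial i (\<lambda>p. G (\<gamma> p)) p = (\<Sum>k\<in>UNIV. partial i \<gamma> p $ k *\<^sub>R partial k G (\<gamma> p))"
  using partial_chain[OF continuous_partials_imp_has_derivative[OF assms(1,2)] assms(3)] by auto

section \<open>Joint continuity in time and parameter\<close>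

abbreviation (input) jointly_continuous_on ::
  "real set \<Rightarrow> 'p::topological_space set \<Rightarrow> (real \<Rightarrow> 'p \<Rightarrow> 'b::topological_space) \<Rightarrow> bool" where
  "jointly_continuous_on T U F \<equiv> continuous_on (T \<times> U) (\<lambda>(t, p). F t p)"

lemma jointly_continuous_compose:
  assumes "jointly_continuous_on I V G" "jointly_continuous_on T U \<gamma>" "T \<subseteq> I"
    "\<And>t p. t \<in> T \<Longrightarrow> p \<in> U \<Longrightarrow> \<gamma> t p \<in> V"
  shows "jointly_continuous_on T U (\<lambda>t p. G t (\<gamma> t p))"
proof -
  have "continuous_on (T \<times> U) (\<lambda>x. (fst x, (\<lambda>(t, p). \<gamma> t p) x))"
    by (intro continuous_intros assms)
  moreover have "(\<lambda>x. (fst x, (\<lambda>(t, p). \<gamma> t p) x)) ` (T \<times> U) \<subseteq> I \<times> V"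
    using assms(3,4) by auto
  ultimately have "continuous_on (T \<times> U) (\<lambda>x. (\<lambda>(t, p). G t p) (fst x, (\<lambda>(t, p). \<gamma> t p) x))"
    by (rule continuous_on_compose2[OF assms(1)])
  then show ?thesis by (simp add: split_def)
qed

lemma jointly_continuous_slice:
  assumes "jointly_continuous_on T U F" "p \<in> U"
  shows "continuous_on T (\<lambda>t. F t p)"
proof -
  have "continuous_on T (\<lambda>t. (\<lambda>(t, p). F t p) (t, p))"
    by (rule continuous_on_compose2[OF assms(1)]) (auto intro!: continuous_intros assms)
  then show ?thesis by simp
qed

lemma jointly_continuous_isCont:
  assumes "jointly_continuous_on T UNIV F" "t \<in> T"
  shows "isCont (F t) p"
proof -
  have "continuous_on UNIV (\<lambda>p. (\<lambda>(t, p). F t p) (t, p))"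
    by (rule continuous_on_compose2[OF assms(1)]) (auto intro!: continuous_intros assms)
  then show ?thesis by (simp add: continuous_on_eq_continuous_at)
qed

text \<open>The tube lemma: compactness of the time set makes continuity at \<open>p\<close> uniform
  in time.\<close>

lemma jointly_continuous_uniform:
  fixes F :: "real \<Rightarrow> 'p::topological_space \<Rightarrow> 'b::real_normed_vector"
  assumes F: "jointly_continuous_on T U F" and "compact T" "open U" "p \<in> U" "0 < e"
  shows "\<forall>\<^sub>F r in nhds p. r \<in> U \<and> (\<forall>t\<in>T. norm (F t r - F t p) \<le> e)"
proof -
  have "continuous_on (U \<times> T) (\<lambda>x. (\<lambda>(t, p). F t p) (prod.swap x))"
    by (rule continuous_on_compose2[OF F, where f = prod.swap]) (auto intro: continuous_on_swap)
  then have "continuous_on (U \<times> T) (\<lambda>(p, t). F t p)" by (simp add: split_def)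
  from continuous_on_prod_compactE[OF this \<open>compact T\<close> \<open>p \<in> U\<close> \<open>0 < e\<close>]
  obtain X0 where X0: "p \<in> X0" "open X0"
      "\<forall>x\<in>X0 \<inter> U. \<forall>t\<in>T. dist (case (x, t) of (p, t) \<Rightarrow> F t p) (case (p, t) of (p, t) \<Rightarrow> F t p) \<le> e"
    by metis
  then show ?thesis using assms
    unfolding eventually_nhds by (intro exI[of _ "X0 \<inter> U"]) (auto simp: dist_norm)
qed

text \<open>Converse to the tube lemma: a move from \<open>(t, p)\<close> to \<open>(s, r)\<close>
  is split at \<open>(s, p)\<close>, where the change in the parameter is controlled uniformly in
  time. Gronwall estimates deliver exactly such uniform control.\<close>

lemma jointly_continuousI:
  fixes F :: "real \<Rightarrow> 'p::topological_space \<Rightarrow> 'b::real_normed_vector"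
  assumes "\<And>p. p \<in> U \<Longrightarrow> continuous_on T (\<lambda>t. F t p)"
    and u: "\<And>p e. p \<in> U \<Longrightarrow> 0 < e \<Longrightarrow> \<forall>\<^sub>F r in nhds p. \<forall>t\<in>T. norm (F t r - F t p) \<le> e"
  shows "jointly_continuous_on T U F"
  unfolding continuous_on_def
proof (intro ballI)
  fix x assume "x \<in> T \<times> U"
  then obtain t p where x: "x = (t, p)" "t \<in> T" "p \<in> U" by auto
  have "(((\<lambda>y. F (fst y) (snd y)) \<longlongrightarrow> F t p)) (at (t, p) within T \<times> U)"
  proof (rule tendstoI)
    fix e :: real assume e: "0 < e"
    then have e2: "0 < e / 2" by simp
    have "\<forall>\<^sub>F s in nhds t. s \<in> T \<longrightarrow> dist (F s p) (F t p) < e / 2"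
    proof -
      have "((\<lambda>t. F t p) \<longlongrightarrow> F t p) (at t within T)"
        using assms(1)[OF x(3)] x(2) by (simp add: continuous_on_def)
      from tendstoD[OF this e2] show ?thesis
        unfolding eventually_at_filter by eventually_elim (use e2 in auto)
    qed
    moreover have "\<forall>\<^sub>F r in nhds p. \<forall>t\<in>T. norm (F t r - F t p) \<le> e / 2" by (rule u[OF x(3) e2])
    ultimately have "\<forall>\<^sub>F y in nhds t \<times>\<^sub>F nhds p. (fst y \<in> T \<longrightarrow> dist (F (fst y) p) (F t p) < e / 2) \<and> (\<forall>t\<in>T. norm (F t (snd y) - F t p) \<le> e / 2)"
      by (rule eventually_prodI)
    then have "\<forall>\<^sub>F y in nhds (t, p). y \<in> T \<times> U \<longrightarrow> dist (F (fst y) (snd y)) (F t p) < e"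
      unfolding nhds_prod
    proof eventually_elim
      case (elim y)
      show ?case
      proof
        assume "y \<in> T \<times> U"
        then have "dist (F (fst y) (snd y)) (F (fst y) p) \<le> e / 2" "dist (F (fst y) p) (F t p) < e / 2"
          using elim by (auto simp: dist_norm)
        then show "dist (F (fst y) (snd y)) (F t p) < e"
          using dist_triangle[of "F (fst y) (snd y)" "F t p" "F (fst y) p"] by linarith
      qed
    qed
    then show "\<forall>\<^sub>F y in at (t, p) within T \<times> U. dist (F (fst y) (snd y)) (F t p) < e"
      unfolding eventually_at_filter by eventually_elim auto
  qed
  then show "((\<lambda>(t, p). F t p) \<longlongrightarrow> (case x of (t, p) \<Rightarrow> F t p)) (at x within T \<times> U)"
    by (simp add: x split_def)
qed

lemma tendsto_axis_nhds:
  fixes p :: "real^'n"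
  shows "filterlim (\<lambda>s. p + s *\<^sub>R axis i 1) (nhds p) (at 0)"
  by (auto intro!: tendsto_eq_intros)

text \<open>By the tube lemma the partial derivative stays within \<open>e\<close> of its value at
  \<open>p\<close> on a neighbourhood common to all times; the mean value inequality along the axis
  turns this into a statement on difference quotients.\<close>

lemma partial_difference_quotient_uniform:
  fixes F :: "real \<Rightarrow> real^'n \<Rightarrow> 'b::real_normed_vector"
  assumes p: "\<And>t p. t \<in> T \<Longrightarrow> p \<in> U \<Longrightarrow> has_partial i (F t) p"
    and j: "jointly_continuous_on T U (\<lambda>t. partial i (F t))"
    and T: "compact T" and U: "open U" "p \<in> U" and e: "0 < e"
  shows "\<forall>\<^sub>F s in at 0. \<forall>t\<in>T. norm ((F t (p + s *\<^sub>R axis i 1) - F t p) /\<^sub>R s - partial i (F t) p) \<le> e"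
proof -
  from jointly_continuous_uniform[OF j T U e]
  obtain r where r: "0 < r" "\<And>z. dist z p < r \<Longrightarrow> z \<in> U \<and> (\<forall>t\<in>T. norm (partial i (F t) z - partial i (F t) p) \<le> e)"
    unfolding eventually_nhds_metric by blast
  have "\<forall>\<^sub>F s in at (0::real). s \<noteq> 0 \<and> \<bar>s\<bar> < r"
    using r(1) by (auto simp: eventually_at dist_norm)
  then show ?thesis
  proof eventually_elim
    case (elim s)
    show ?case
    proof
      fix t assume t: "t \<in> T"
      have "norm (F t (p + s *\<^sub>R axis i 1) - F t p - s *\<^sub>R partial i (F t) p) \<le> e * \<bar>s\<bar>"
      proof (rule partial_increment_axis)
        fix y assume y: "y \<in> closed_segment 0 s"
        have "\<bar>y\<bar> \<le> \<bar>s\<bar>" using segment_bound1[OF y] by simp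
        then have "dist (p + y *\<^sub>R axis i 1) p < r" using elim by (simp add: dist_norm)
        then show "has_partial i (F t) (p + y *\<^sub>R axis i 1) \<and>
           norm (partial i (F t) (p + y *\<^sub>R axis i 1) - partial i (F t) p) \<le> e"
          using r(2) p t by blast
      qed
      then have "norm (F t (p + s *\<^sub>R axis i 1) - F t p - s *\<^sub>R partial i (F t) p) / \<bar>s\<bar> \<le> e"
        using elim by (simp add: field_simps)
      moreover have "(F t (p + s *\<^sub>R axis i 1) - F t p) /\<^sub>R s - partial i (F t) p =
         (F t (p + s *\<^sub>R axis i 1) - F t p - s *\<^sub>R partial i (F t) p) /\<^sub>R s"
        using elim by (simp add: scaleR_diff_right)
      ultimately show "norm ((F t (p + s *\<^sub>R axis i 1) - F t p) /\<^sub>R s - partial i (F t) p) \<le> e"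
        by (simp add: divide_inverse mult.commute)
    qed
  qed
qed

lemma partial_of_difference_quotient:
  assumes "\<And>e. 0 < e \<Longrightarrow> \<forall>\<^sub>F s in at 0. norm ((g (p + s *\<^sub>R axis i 1) - g p) /\<^sub>R s - d) \<le> e"
  shows "has_partial i g p" "partial i g p = d"
proof -
  have "((\<lambda>s. (g (p + s *\<^sub>R axis i 1) - g p) /\<^sub>R s) \<longlongrightarrow> d) (at 0)"
  proof (rule tendstoI)
    fix e :: real assume "0 < e"
    then have "0 < e / 2" by simp
    from assms[OF this] show "\<forall>\<^sub>F s in at 0. dist ((g (p + s *\<^sub>R axis i 1) - g p) /\<^sub>R s) d < e"
      by eventually_elim (use \<open>0 < e\<close> in \<open>simp add: dist_norm\<close>)
  qed
  then have "((\<lambda>s. (g (p + s *\<^sub>R axis i 1) - g p) /\<^sub>R s - d) \<longlongrightarrow> 0) (at 0)"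
    by (rule LIM_zero)
  then have "((\<lambda>s. norm ((g (p + s *\<^sub>R axis i 1) - g p) /\<^sub>R s - d)) \<longlongrightarrow> 0) (at 0)"
    by (rule tendsto_norm_zero)
  then have *: "((\<lambda>s. norm (g (p + s *\<^sub>R axis i 1) - g p - s *\<^sub>R d) / \<bar>s\<bar>) \<longlongrightarrow> 0) (at 0)"
  proof (rule Lim_transform_eventually)
    have "norm ((g (p + s *\<^sub>R axis i 1) - g p) /\<^sub>R s - d) = norm (g (p + s *\<^sub>R axis i 1) - g p - s *\<^sub>R d) / \<bar>s\<bar>"
      if "s \<noteq> 0" for s
    proof -
      have "(g (p + s *\<^sub>R axis i 1) - g p) /\<^sub>R s - d = (g (p + s *\<^sub>R axis i 1) - g p - s *\<^sub>R d) /\<^sub>R s"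
        using that by (simp add: scaleR_diff_right)
      then show ?thesis by (simp add: divide_inverse mult.commute)
    qed
    then show "\<forall>\<^sub>F s in at 0. norm ((g (p + s *\<^sub>R axis i 1) - g p) /\<^sub>R s - d) = norm (g (p + s *\<^sub>R axis i 1) - g p - s *\<^sub>R d) / \<bar>s\<bar>"
      by (auto simp: eventually_at_filter)
  qed
  have "((\<lambda>s. g (p + s *\<^sub>R axis i 1)) has_vector_derivative d) (at 0)"
    unfolding has_vector_derivative_def has_derivative_iff_norm
    using * by (auto intro: bounded_linear_scaleR_left)
  then show "has_partial i g p" "partial i g p = d" by (auto intro: partialI)
qed

section \<open>Dependence of maximal solutions on initial values\<close>

text \<open>A limit of the derivative at an endpoint is a one-sided derivative there. It is needed
  to glue two solutions at the boundary point where one of them ends.\<close>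

lemma vector_derivative_at_endpoint:
  fixes x :: "real \<Rightarrow> 'a::real_normed_vector"
  assumes \<beta>: "\<beta> \<noteq> \<tau>"
    and x: "\<And>s. s \<in> closed_segment \<tau> \<beta> \<Longrightarrow> s \<noteq> \<beta> \<Longrightarrow>
        (x has_vector_derivative x' s) (at s within closed_segment \<tau> \<beta>)"
    and c: "(x \<longlongrightarrow> x \<beta>) (at \<beta> within closed_segment \<tau> \<beta>)"
    and d: "(x' \<longlongrightarrow> d) (at \<beta> within closed_segment \<tau> \<beta>)"
  shows "(x has_vector_derivative d) (at \<beta> within closed_segment \<tau> \<beta>)"
proof -
  let ?S = "closed_segment \<tau> \<beta>"
  have cx: "continuous_on ?S x"
    unfolding continuous_on_eq_continuous_within
    using x c by (metis continuous_within has_vector_derivative_continuous)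
  show ?thesis
    unfolding has_vector_derivative_def has_derivative_within_alt
  proof (intro conjI allI impI)
    show "bounded_linear (\<lambda>h. h *\<^sub>R d)" by (rule bounded_linear_scaleR_left)
    fix e :: real assume e: "0 < e"
    from tendstoD[OF d e] obtain r where r: "0 < r"
      "\<And>s. s \<in> ?S \<Longrightarrow> s \<noteq> \<beta> \<Longrightarrow> dist s \<beta> < r \<Longrightarrow> dist (x' s) d < e"
      unfolding eventually_at by blast
    show "\<exists>\<delta>>0. \<forall>y\<in>?S. norm (y - \<beta>) < \<delta> \<longrightarrow> norm (x y - x \<beta> - (y - \<beta>) *\<^sub>R d) \<le> e * norm (y - \<beta>)"
    proof (intro exI[of _ r] conjI ballI impI r)
      fix y assume y: "y \<in> ?S" "norm (y - \<beta>) < r"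
      show "norm (x y - x \<beta> - (y - \<beta>) *\<^sub>R d) \<le> e * norm (y - \<beta>)"
      proof (cases "y = \<beta>")
        case False
        have sub: "closed_segment y \<beta> \<subseteq> ?S" using y by (simp add: closed_segment_subset)
        \<comment> \<open>The mean value inequality is applied only on segments that avoid
          \<open>\<beta>\<close>; the endpoint is then reached by continuity of both sides.\<close>
        have bd: "norm (x y - x s - (y - s) *\<^sub>R d) - e * norm (y - s) \<le> 0" if s: "s \<in> open_segment y \<beta>" for s
        proof -
          have sy: "closed_segment s y \<subseteq> ?S"
            using s y sub by (intro closed_segment_subset) (auto simp: open_segment_def)
          have ne: "r \<noteq> \<beta> \<and> dist r \<beta> < r'" if "r \<in> closed_segment s y" "norm (y - \<beta>) < r'" for r r'
            using that s by (auto simp: open_segment_eq_real_ivl closed_segment_eq_real_ivl dist_real_def split: if_splits)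
          have "norm ((\<lambda>r. x r - r *\<^sub>R d) y - (\<lambda>r. x r - r *\<^sub>R d) s) \<le> e * norm (y - s)"
          proof (rule differentiable_bound[where S = "closed_segment s y"])
            fix q assume q: "q \<in> closed_segment s y"
            have "(x has_vector_derivative x' q) (at q within closed_segment s y)"
              using x[of q] sy q ne[OF q y(2)] has_vector_derivative_within_subset by blast
            then have "((\<lambda>r. x r - r *\<^sub>R d) has_vector_derivative (x' q - d)) (at q within closed_segment s y)"
              by (auto intro!: derivative_eq_intros)
            then show "((\<lambda>r. x r - r *\<^sub>R d) has_derivative (\<lambda>h. h *\<^sub>R (x' q - d))) (at q within closed_segment s y)"
              by (simp add: has_vector_derivative_def)
            have "norm (x' q - d) \<le> e"
              using r(2)[of q] sy q ne[OF q y(2)] by (auto simp: dist_norm)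
            then show "onorm (\<lambda>h. h *\<^sub>R (x' q - d)) \<le> e"
              by (intro onorm_le) (auto simp: mult.commute[of e] intro: mult_left_mono)
          qed auto
          then show ?thesis by (simp add: algebra_simps)
        qed
        have "norm (x y - x \<beta> - (y - \<beta>) *\<^sub>R d) - e * norm (y - \<beta>) \<le> 0"
        proof (rule continuous_le_on_closure[where S = "open_segment y \<beta>"
              and f = "\<lambda>s. norm (x y - x s - (y - s) *\<^sub>R d) - e * norm (y - s)"])
          show "continuous_on (closure (open_segment y \<beta>)) (\<lambda>s. norm (x y - x s - (y - s) *\<^sub>R d) - e * norm (y - s))"
            using False sub by (auto intro!: continuous_intros continuous_on_subset[OF cx])
        qed (use bd False in auto)
        then show ?thesis by simp
      qed simp
    qed
  qed
qed

lemma has_vector_derivative_Un: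
  assumes "(f has_vector_derivative d) (at x within S)" "(f has_vector_derivative d) (at x within T)"
  shows "(f has_vector_derivative d) (at x within S \<union> T)"
  using assms unfolding has_vector_derivative_def has_derivative_iff_norm
  by (auto simp: Lim_within_Un)

lemma jointly_continuous_bounded:
  fixes F :: "real \<Rightarrow> 'p::topological_space \<Rightarrow> 'b::real_normed_vector"
  assumes "jointly_continuous_on T V F" "compact T" "compact V"
  obtains B where "\<And>t v. t \<in> T \<Longrightarrow> v \<in> V \<Longrightarrow> norm (F t v) \<le> B" "0 \<le> B"
proof -
  have "bounded ((\<lambda>(t, p). F t p) ` (T \<times> V))"
    by (intro compact_imp_bounded compact_continuous_image assms compact_Times)
  then obtain B where "\<And>y. y \<in> (\<lambda>(t, p). F t p) ` (T \<times> V) \<Longrightarrow> norm y \<le> B"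
    unfolding bounded_iff by blast
  then have "norm (F t v) \<le> \<bar>B\<bar>" if "t \<in> T" "v \<in> V" for t v
    using that by (metis (mono_tags, lifting) SigmaI abs_ge_self case_prod_conv image_eqI order_trans)
  then show thesis using that by (meson abs_ge_zero)
qed

text \<open>Since \<open>maximal\<close> covers every initial point over \<open>I\<close>, it is
  also the source of local existence: a solution starts at any point that another solution
  approaches.\<close>

locale C1_flow =
  fixes I :: "real set" and f :: "real \<Rightarrow> real^'n \<Rightarrow> real^'n"
    and J :: "real \<Rightarrow> real^'n \<Rightarrow> real set" and \<phi> :: "real \<Rightarrow> real \<Rightarrow> real^'n \<Rightarrow> real^'n"
  assumes f_cont: "jointly_continuous_on I UNIV f"
    and f_partial: "\<And>t x k. t \<in> I \<Longrightarrow> has_partial k (f t) x"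
    and f_partial_cont: "\<And>k. jointly_continuous_on I UNIV (\<lambda>t. partial k (f t))"
    and maximal: "\<And>\<tau> \<xi>. \<tau> \<in> I \<Longrightarrow> maximal_solution f I \<tau> \<xi> (J \<tau> \<xi>) (\<lambda>t. \<phi> t \<tau> \<xi>)"
begin

lemma solution:
  assumes "\<tau> \<in> I"
  shows "open (J \<tau> \<xi>)" "is_interval (J \<tau> \<xi>)" "J \<tau> \<xi> \<subseteq> I" "\<tau> \<in> J \<tau> \<xi>" "\<phi> \<tau> \<tau> \<xi> = \<xi>"
    "t \<in> J \<tau> \<xi> \<Longrightarrow> ((\<lambda>t. \<phi> t \<tau> \<xi>) has_vector_derivative f t (\<phi> t \<tau> \<xi>)) (at t)"
  using maximal[OF assms, of \<xi>] unfolding maximal_solution_def solution_through_def by auto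

lemma solution_continuous:
  assumes "\<tau> \<in> I" "S \<subseteq> J \<tau> \<xi>"
  shows "continuous_on S (\<lambda>t. \<phi> t \<tau> \<xi>)"
  using solution(6)[OF assms(1)] assms(2)
  by (meson continuous_at_imp_continuous_on has_vector_derivative_continuous subsetD)

text \<open>A solution with a limit \<open>l\<close> at a boundary point \<open>\<beta>\<close> of its interval is glued to the
  solution through \<open>(\<beta>, l)\<close>, contradicting maximality. The sign of \<open>(s - \<beta>) * (\<tau> - \<beta>)\<close> tells
  on which side of \<open>\<beta>\<close> the point \<open>s\<close> lies, so both time directions are covered at once.\<close>

lemma no_limit_at_boundary:
  assumes \<tau>: "\<tau> \<in> I" and \<beta>: "\<beta> \<in> I" "\<beta> \<notin> J \<tau> p"
    and seg: "\<And>s. s \<in> closed_segment \<tau> \<beta> \<Longrightarrow> s \<noteq> \<beta> \<Longrightarrow> s \<in> J \<tau> p"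
    and l: "((\<lambda>t. \<phi> t \<tau> p) \<longlongrightarrow> l) (at \<beta> within closed_segment \<tau> \<beta>)"
  shows False
proof -
  let ?S = "closed_segment \<tau> \<beta>"
  let ?x = "\<lambda>t. \<phi> t \<tau> p" and ?y = "\<lambda>t. \<phi> t \<beta> l"
  have ne: "\<beta> \<noteq> \<tau>" using solution(4)[OF \<tau>] \<beta> by metis
  define N where "N = {s. 0 < (s - \<beta>) * (\<tau> - \<beta>)}"
  define z where "z = (\<lambda>s. if s \<in> N then ?x s else ?y s)"
  have N: "open N" unfolding N_def by (intro open_Collect_less continuous_intros)
  \<comment> \<open>An interval that contains \<open>\<tau>\<close> but not \<open>\<beta>\<close>
    lies entirely on the side of \<open>\<tau>\<close>.\<close>
  have JN: "J \<tau> p \<subseteq> N"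
  proof
    fix s assume s: "s \<in> J \<tau> p"
    show "s \<in> N"
    proof (rule ccontr)
      assume "s \<notin> N"
      then have "(s \<le> \<beta> \<and> \<beta> \<le> \<tau>) \<or> (\<tau> \<le> \<beta> \<and> \<beta> \<le> s)"
        using ne unfolding N_def by (auto simp: zero_less_mult_iff not_less)
      then have "\<beta> \<in> J \<tau> p"
        using solution(2)[OF \<tau>, of p] s solution(4)[OF \<tau>, of p] by (meson mem_is_interval_1_I)
      then show False using \<beta> by simp
    qed
  qed
  have "\<beta> \<in> J \<beta> l" "open (J \<beta> l)" using solution[OF \<beta>(1)] by auto
  then obtain r0 where r0: "0 < r0" "ball \<beta> r0 \<subseteq> J \<beta> l" by (meson open_contains_ball)
  \<comment> \<open>The bound by \<open>\<bar>\<tau> - \<beta>\<bar>\<close> keeps those points of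
    the ball which lie on the side of \<open>\<tau>\<close> inside the segment, hence inside
    \<open>J \<tau> p\<close>.\<close>
  define r where "r = min r0 \<bar>\<tau> - \<beta>\<bar>"
  have r: "0 < r" "ball \<beta> r \<subseteq> J \<beta> l" "r \<le> \<bar>\<tau> - \<beta>\<bar>" using r0 ne by (auto simp: r_def)
  have ballN: "s \<in> J \<tau> p" if "s \<in> ball \<beta> r" "s \<in> N" for s
  proof (rule seg)
    show "s \<in> ?S" "s \<noteq> \<beta>" using that r(3) unfolding N_def
      by (auto simp: closed_segment_eq_real_ivl dist_real_def zero_less_mult_iff)
  qed
  have SN: "s \<in> N" if "s \<in> ?S" "s \<noteq> \<beta>" for s
    using seg[OF that] JN by auto
  have \<beta>N: "\<beta> \<notin> N" by (simp add: N_def)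
  have zl: "z \<beta> = l" using \<beta>N solution(5)[OF \<beta>(1)] by (simp add: z_def)
  have zx: "(z has_vector_derivative f s (z s)) (at s)" if "s \<in> J \<tau> p" for s
  proof (rule has_vector_derivative_transform_within_open[OF _ N])
    show "(?x has_vector_derivative f s (z s)) (at s)"
      using solution(6)[OF \<tau> that] JN that by (auto simp: z_def)
  qed (use JN that in \<open>auto simp: z_def\<close>)
  have zS: "(z has_vector_derivative f \<beta> l) (at \<beta> within ?S)"
  proof (rule vector_derivative_at_endpoint[OF ne])
    show "(z has_vector_derivative f s (z s)) (at s within ?S)" if "s \<in> ?S" "s \<noteq> \<beta>" for s
      using zx[OF seg[OF that]] by (rule has_vector_derivative_at_within)
    show zlim: "(z \<longlongrightarrow> z \<beta>) (at \<beta> within ?S)"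
      unfolding zl by (rule Lim_transform_within[OF l zero_less_one]) (use SN in \<open>auto simp: z_def\<close>)
    \<comment> \<open>Joint continuity of \<open>f\<close> at \<open>(\<beta>, l)\<close> makes the
      derivative of \<open>z\<close> converge as well, as the endpoint lemma requires.\<close>
    have "((\<lambda>s. (s, z s)) \<longlongrightarrow> (\<beta>, l)) (at \<beta> within ?S)"
      using zlim zl by (auto intro: tendsto_intros)
    moreover have "\<forall>\<^sub>F s in at \<beta> within ?S. (s, z s) \<in> I \<times> UNIV"
      unfolding eventually_at_filter
      by (rule always_eventually) (use seg solution(3)[OF \<tau>] in auto)
    ultimately have "((\<lambda>s. (\<lambda>(t, p). f t p) (s, z s)) \<longlongrightarrow> (\<lambda>(t, p). f t p) (\<beta>, l)) (at \<beta> within ?S)"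
      using continuous_on_tendsto_compose[OF f_cont] \<beta>(1) by blast
    then show "((\<lambda>s. f s (z s)) \<longlongrightarrow> f \<beta> l) (at \<beta> within ?S)" by simp
  qed
  have zF: "(z has_vector_derivative f \<beta> l) (at \<beta> within - N)"
  proof (rule has_vector_derivative_transform)
    show "(?y has_vector_derivative f \<beta> l) (at \<beta> within - N)"
      using solution(6)[OF \<beta>(1) \<open>\<beta> \<in> J \<beta> l\<close>] solution(5)[OF \<beta>(1)]
      by (auto intro: has_vector_derivative_at_within)
  qed (auto simp: z_def \<beta>N)
  \<comment> \<open>The one-sided derivatives agree: from the side of \<open>\<tau>\<close> the
    value is the limit of the derivatives, from the other side it is the equation of the solution
    through \<open>(\<beta>, l)\<close>.\<close>
  have z\<beta>: "(z has_vector_derivative f \<beta> l) (at \<beta>)"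
  proof -
    have "ball \<beta> r \<subseteq> ?S \<union> - N"
      using r(3) unfolding N_def
      by (auto simp: closed_segment_eq_real_ivl dist_real_def zero_less_mult_iff)
    then have "\<beta> \<in> interior (?S \<union> - N)"
      using r(1) by (meson centre_in_ball interiorI open_ball)
    then show ?thesis
      using has_vector_derivative_Un[OF zS zF] at_within_interior by metis
  qed
  have zy: "(z has_vector_derivative f s (z s)) (at s)" if "s \<in> ball \<beta> r" "s \<notin> J \<tau> p" "s \<noteq> \<beta>" for s
  proof -
    have sN: "s \<notin> N" using ballN that by blast
    have op: "open {s. (s - \<beta>) * (\<tau> - \<beta>) < 0}" by (intro open_Collect_less continuous_intros)
    show ?thesis
    proof (rule has_vector_derivative_transform_within_open[OF _ op])
      show "(?y has_vector_derivative f s (z s)) (at s)"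
        using solution(6)[OF \<beta>(1)] r(2) that sN by (auto simp: z_def)
      show "s \<in> {s. (s - \<beta>) * (\<tau> - \<beta>) < 0}"
        using sN that(3) ne by (auto simp: N_def not_less order_less_le)
    qed (auto simp: z_def N_def)
  qed
  let ?J = "J \<tau> p \<union> ball \<beta> r"
  have "solution_through f I \<tau> p ?J z"
    unfolding solution_through_def
  proof (intro conjI ballI)
    show "open ?J" using solution(1)[OF \<tau>] by auto
    \<comment> \<open>A point halfway into the ball on the side of \<open>\<tau>\<close>. It lies in
      both pieces, so their union is connected.\<close>
    define m where "m = \<beta> + sgn (\<tau> - \<beta>) * (r / 2)"
    have "m \<in> ball \<beta> r" "m \<in> N"
      using r(1) ne by (auto simp: m_def N_def dist_real_def sgn_if abs_mult mult_pos_neg)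
    then have "J \<tau> p \<inter> ball \<beta> r \<noteq> {}" using ballN by blast
    then show "is_interval ?J"
      using solution(2)[OF \<tau>, of p] unfolding is_interval_connected_1
      by (intro connected_Un) auto
    show "?J \<subseteq> I" using solution(3)[OF \<tau>] solution(3)[OF \<beta>(1)] r(2) by blast
    show "\<tau> \<in> ?J" using solution(4)[OF \<tau>] by simp
    show "z \<tau> = p" using solution(4,5)[OF \<tau>, of p] JN by (auto simp: z_def)
    show "(z has_vector_derivative f s (z s)) (at s)" if "s \<in> ?J" for s
      using that zx zy z\<beta> zl by (cases "s \<in> J \<tau> p"; cases "s = \<beta>") auto
  qed
  moreover have "\<forall>t\<in>J \<tau> p. z t = ?x t" using JN by (auto simp: z_def)
  ultimately have "?J = J \<tau> p"
    using maximal[OF \<tau>, of p] unfolding maximal_solution_def by blast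
  moreover have "\<beta> \<in> ?J" using r(1) by simp
  ultimately show False using \<beta>(2) by blast
qed

text \<open>Within distance \<open>1\<close> of the reference solution \<open>f\<close> is Lipschitz
  in \<open>x\<close>. As long as a neighbouring solution stays there, Gronwall keeps it at distance
  below \<open>1\<close>, so it cannot leave. Inside this tube its speed is bounded, so it has a
  limit wherever it might cease to exist, and \<open>no_limit_at_boundary\<close> excludes that it
  does.\<close>

lemma flow_stable:
  assumes \<tau>: "\<tau> \<in> I" "\<tau> \<in> {a..b}" and T: "{a..b} \<subseteq> J \<tau> p0"
  obtains C \<delta> where "0 < \<delta>" "0 < C"
    "\<And>p. norm (p - p0) < \<delta> \<Longrightarrow> {a..b} \<subseteq> J \<tau> p"
    "\<And>p t. norm (p - p0) < \<delta> \<Longrightarrow> t \<in> {a..b} \<Longrightarrow> norm (\<phi> t \<tau> p - \<phi> t \<tau> p0) \<le> C * norm (p - p0)"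
proof -
  let ?T = "{a..b}" and ?x0 = "\<lambda>t. \<phi> t \<tau> p0" and ?c = "cball (0::real^'n) 1"
  have TI: "?T \<subseteq> I" using T solution(3)[OF \<tau>(1)] by blast
  have x0: "continuous_on ?T ?x0" by (rule solution_continuous[OF \<tau>(1) T])
  \<comment> \<open>Shifting by the reference solution makes the tube the compact product of
    \<open>{a..b}\<close> and the unit ball, on which \<open>f\<close> and its partial derivatives
    are bounded.\<close>
  have sh: "jointly_continuous_on ?T ?c (\<lambda>t v. ?x0 t + v)"
    unfolding split_def
    by (auto intro!: continuous_intros continuous_on_compose2[OF x0])
  have "\<exists>K. 0 \<le> K \<and> (\<forall>t\<in>?T. \<forall>v\<in>?c. norm (partial k (f t) (?x0 t + v)) \<le> K)" for k
  proof -
    have "jointly_continuous_on ?T ?c (\<lambda>t v. partial k (f t) (?x0 t + v))"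
      by (rule jointly_continuous_compose[OF f_partial_cont sh TI]) simp
    from jointly_continuous_bounded[OF this compact_Icc compact_cball] show ?thesis by metis
  qed
  then obtain K where K: "\<And>k. 0 \<le> K k" "\<And>k t v. t \<in> ?T \<Longrightarrow> v \<in> ?c \<Longrightarrow> norm (partial k (f t) (?x0 t + v)) \<le> K k"
    by metis
  obtain B where B: "\<And>t v. t \<in> ?T \<Longrightarrow> v \<in> ?c \<Longrightarrow> norm (f t (?x0 t + v)) \<le> B" "0 \<le> B"
  proof -
    have "jointly_continuous_on ?T ?c (\<lambda>t v. f t (?x0 t + v))"
      by (rule jointly_continuous_compose[OF f_cont sh TI]) simp
    from jointly_continuous_bounded[OF this compact_Icc compact_cball] that show ?thesis by metis
  qed
  \<comment> \<open>The Lipschitz constant comes from \<open>partial_increment\<close> with all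
    reference values \<open>0\<close>.\<close>
  define L where "L = real CARD('n) * (\<Sum>k\<in>UNIV. K k)"
  have L0: "0 \<le> L" unfolding L_def using K by (auto intro!: mult_nonneg_nonneg sum_nonneg)
  have lip: "norm (f t y - f t (?x0 t)) \<le> L * norm (y - ?x0 t)"
    if t: "t \<in> ?T" and y: "norm (y - ?x0 t) \<le> 1" for t y
  proof -
    have "norm (f t (?x0 t + (y - ?x0 t)) - f t (?x0 t) - (\<Sum>k\<in>UNIV. (y - ?x0 t) $ k *\<^sub>R 0)) \<le>
       real CARD('n) * (\<Sum>k\<in>UNIV. K k) * norm (y - ?x0 t)"
    proof (rule partial_increment)
      fix k z assume z: "norm (z - ?x0 t) \<le> norm (y - ?x0 t)"
      have "norm (partial k (f t) (?x0 t + (z - ?x0 t))) \<le> K k"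
        using z y by (intro K(2)[OF t]) auto
      also have "\<dots> \<le> (\<Sum>k\<in>UNIV. K k)" using K(1) by (intro member_le_sum) auto
      finally show "has_partial k (f t) z \<and> norm (partial k (f t) z - 0) \<le> (\<Sum>k\<in>UNIV. K k)"
        using f_partial t TI by auto
    qed
    then show ?thesis by (simp add: L_def)
  qed
  define C where "C = exp ((2 * L + 1) * (b - a))"
  have C0: "0 < C" by (simp add: C_def)
  \<comment> \<open>Chosen so that the Gronwall bound \<open>C * norm (p - p0)\<close> is strictly
    below the tube radius \<open>1\<close>.\<close>
  define \<delta> where "\<delta> = 1 / C"
  have \<delta>0: "0 < \<delta>" using C0 by (simp add: \<delta>_def)
  have small: "C * norm (p - p0) < 1" if "norm (p - p0) < \<delta>" for p
    using that C0 by (simp add: \<delta>_def field_simps)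
  have bound: "norm (\<phi> t \<tau> p - ?x0 t) \<le> C * norm (p - p0)"
    if p: "norm (p - p0) < \<delta>" and t: "t \<in> ?T" and seg: "closed_segment \<tau> t \<subseteq> J \<tau> p" for p t
  proof -
    let ?u = "\<lambda>s. \<phi> s \<tau> p - ?x0 s"
    have segT: "closed_segment \<tau> t \<subseteq> ?T"
      using t \<tau>(2) by (intro closed_segment_subset) auto
    have u: "(?u has_vector_derivative f s (\<phi> s \<tau> p) - f s (?x0 s)) (at s)" if "s \<in> closed_segment \<tau> t" for s
      using that seg segT T by (intro has_vector_derivative_diff solution(6)[OF \<tau>(1)]) auto
    have cu: "continuous_on (closed_segment \<tau> t) ?u"
      using seg segT T by (intro continuous_intros solution_continuous[OF \<tau>(1)]) auto
    have u\<tau>: "?u \<tau> = p - p0" using solution(5)[OF \<tau>(1)] by simp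
    have gr: "norm (?u s) \<le> C * norm (p - p0)"
      if s: "s \<in> closed_segment \<tau> t" and small: "\<And>r. r \<in> closed_segment \<tau> s \<Longrightarrow> norm (?u r) \<le> 1" for s
    proof -
      have sub: "closed_segment \<tau> s \<subseteq> closed_segment \<tau> t" using s by (simp add: closed_segment_subset)
      have "norm (?u s) \<le> (norm (?u \<tau>) + 0) * exp ((2 * L + 1) * \<bar>s - \<tau>\<bar>)"
      proof (rule gronwall)
        fix r assume r: "r \<in> closed_segment \<tau> s"
        have "norm (f r (\<phi> r \<tau> p) - f r (?x0 r)) \<le> L * norm (?u r)"
          using lip small r sub segT by blast
        then show "\<exists>d. (?u has_vector_derivative d) (at r within closed_segment \<tau> s) \<and> norm d \<le> L * norm (?u r) + 0"
          using u[of r] r sub by (auto intro: has_vector_derivative_at_within)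
      qed (use L0 in auto)
      also have "\<dots> \<le> norm (?u \<tau>) * C"
      proof -
        have "s \<in> ?T" using s segT by blast
        then have "\<bar>s - \<tau>\<bar> \<le> b - a" using \<tau>(2) by auto
        then show ?thesis unfolding C_def using L0 by (auto intro!: mult_left_mono)
      qed
      finally show ?thesis by (simp only: u\<tau> mult.commute)
    qed
    have "norm (?u s) \<le> 1" if "s \<in> closed_segment \<tau> t" for s
    proof (rule ccontr)
      assume "\<not> norm (?u s) \<le> 1"
      \<comment> \<open>\<open>s0\<close> below is the first time, travelling from
        \<open>\<tau>\<close> towards \<open>t\<close>, at which the deviation reaches
        \<open>1\<close>. Up to and including \<open>s0\<close> the Gronwall estimate applies and
        gives a deviation below \<open>1\<close>, a contradiction.\<close>
      define A where "A = closed_segment \<tau> t \<inter> (\<lambda>s. norm (?u s)) -` {1..}"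
      have "closed A" unfolding A_def
        by (intro continuous_closed_preimage continuous_on_norm cu) auto
      moreover have "A \<noteq> {}" using that \<open>\<not> norm (?u s) \<le> 1\<close> by (auto simp: A_def)
      ultimately obtain s0 where s0: "s0 \<in> A" "\<And>y. y \<in> A \<Longrightarrow> dist \<tau> s0 \<le> dist \<tau> y"
        using distance_attains_inf by blast
      have s0t: "s0 \<in> closed_segment \<tau> t" using s0 by (simp add: A_def)
      then have sub: "closed_segment \<tau> s0 \<subseteq> closed_segment \<tau> t" by (simp add: closed_segment_subset)
      have op: "norm (?u r) \<le> 1" if r: "r \<in> open_segment \<tau> s0" for r
      proof -
        have "dist \<tau> r < dist \<tau> s0" using dist_in_open_segment r by (metis dist_commute)
        then have "r \<notin> A" using s0(2) by force
        then show ?thesis using r sub by (auto simp: A_def open_segment_def)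
      qed
      have s0\<tau>: "s0 \<noteq> \<tau>"
      proof
        assume "s0 = \<tau>"
        then have "1 \<le> norm (p - p0)" using s0(1) u\<tau> by (auto simp: A_def)
        \<comment> \<open>\<open>C\<close> is the exponential of a nonnegative number, so the
          initial deviation is itself below \<open>1\<close> and \<open>s0\<close> is not
          \<open>\<tau>\<close>.\<close>
        moreover have "norm (p - p0) \<le> C * norm (p - p0)"
          using \<tau>(2) L0 by (auto simp: C_def mult_le_cancel_right1)
        ultimately show False using small[OF p] by simp
      qed
      have "norm (?u r) \<le> 1" if "r \<in> closed_segment \<tau> s0" for r
      proof (rule continuous_le_on_closure[where S = "open_segment \<tau> s0" and f = "\<lambda>r. norm (?u r)"])
        show "continuous_on (closure (open_segment \<tau> s0)) (\<lambda>r. norm (?u r))"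
          using s0\<tau> sub by (auto intro!: continuous_on_norm continuous_on_subset[OF cu])
      qed (use that s0\<tau> op in auto)
      from gr[OF s0t this] small[OF p] s0(1) show False by (auto simp: A_def)
    qed
    then show ?thesis
      by (intro gr) auto
  qed
  have global: "?T \<subseteq> J \<tau> p" if p: "norm (p - p0) < \<delta>" for p
  proof (rule ccontr)
    assume "\<not> ?T \<subseteq> J \<tau> p"
    then obtain e where e: "e \<in> ?T" "e \<notin> J \<tau> p" by blast
    \<comment> \<open>The closest point \<open>\<beta>\<close> of this closed set is the first time
      at which the solution through \<open>p\<close> is missing.\<close>
    define A where "A = closed_segment \<tau> e - J \<tau> p"
    have "closed A" unfolding A_def by (intro closed_Diff solution(1)[OF \<tau>(1)]) auto
    moreover have "A \<noteq> {}" using e by (auto simp: A_def)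
    ultimately obtain \<beta> where \<beta>: "\<beta> \<in> A" "\<And>y. y \<in> A \<Longrightarrow> dist \<tau> \<beta> \<le> dist \<tau> y"
      using distance_attains_inf by blast
    have \<beta>J: "\<beta> \<notin> J \<tau> p" and \<beta>e: "\<beta> \<in> closed_segment \<tau> e" using \<beta> by (auto simp: A_def)
    have segT: "closed_segment \<tau> e \<subseteq> ?T" using e \<tau>(2) by (intro closed_segment_subset) auto
    have \<beta>\<tau>: "\<beta> \<noteq> \<tau>" using \<beta>J solution(4)[OF \<tau>(1)] by metis
    let ?S = "closed_segment \<tau> \<beta>"
    have sub: "?S \<subseteq> closed_segment \<tau> e" using \<beta>e by (simp add: closed_segment_subset)
    have SJ: "s \<in> J \<tau> p" if "s \<in> ?S" "s \<noteq> \<beta>" for s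
    proof -
      have "dist \<tau> s < dist \<tau> \<beta>"
        using that by (auto simp: closed_segment_eq_real_ivl dist_real_def split: if_splits)
      then have "s \<notin> A" using \<beta>(2) by force
      then show ?thesis using that sub by (auto simp: A_def)
    qed
    \<comment> \<open>On the half-open segment the solution is Lipschitz with constant
      \<open>B\<close>, hence uniformly continuous, and extends to \<open>\<beta>\<close>; this
      supplies the limit \<open>l\<close>.\<close>
    define X where "X = ?S - {\<beta>}"
    have X: "convex X" "\<beta> \<in> closure X"
    proof -
      have "X = (if \<tau> < \<beta> then {\<tau>..<\<beta>} else {\<beta><..\<tau>})"
        using \<beta>\<tau> by (auto simp: X_def closed_segment_eq_real_ivl)
      then show "convex X" "\<beta> \<in> closure X" using \<beta>\<tau> by (auto simp: closure_greaterThanAtMost closure_atLeastLessThan)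
    qed
    have dX: "((\<lambda>t. \<phi> t \<tau> p) has_vector_derivative f s (\<phi> s \<tau> p)) (at s within X) \<and> norm (f s (\<phi> s \<tau> p)) \<le> B"
      if s: "s \<in> X" for s
    proof -
      have sJ: "s \<in> J \<tau> p" and sT: "s \<in> ?T" using SJ s sub segT by (auto simp: X_def)
      have "r \<in> J \<tau> p" if r: "r \<in> closed_segment \<tau> s" for r
      proof (rule SJ)
        show "r \<in> ?S" "r \<noteq> \<beta>" using r s
          by (auto simp: X_def closed_segment_eq_real_ivl split: if_splits)
      qed
      then have "norm (\<phi> s \<tau> p - ?x0 s) \<le> C * norm (p - p0)"
        by (intro bound[OF p sT]) auto
      then have "norm (\<phi> s \<tau> p - ?x0 s) \<le> 1" using small[OF p] by simp
      then have "norm (f s (?x0 s + (\<phi> s \<tau> p - ?x0 s))) \<le> B"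
        by (intro B(1)[OF sT]) auto
      then show ?thesis using solution(6)[OF \<tau>(1) sJ] by (auto intro: has_vector_derivative_at_within)
    qed
    have "B-lipschitz_on X (\<lambda>t. \<phi> t \<tau> p)"
    proof (rule lipschitz_onI)
      fix s r assume s: "s \<in> X" "r \<in> X"
      have "norm (\<phi> s \<tau> p - \<phi> r \<tau> p) \<le> B * norm (s - r)"
      proof (rule differentiable_bound[OF X(1) _ _ s])
        show "((\<lambda>t. \<phi> t \<tau> p) has_derivative (\<lambda>h. h *\<^sub>R f q (\<phi> q \<tau> p))) (at q within X)" if "q \<in> X" for q
          using dX[OF that] by (simp add: has_vector_derivative_def)
        show "onorm (\<lambda>h. h *\<^sub>R f q (\<phi> q \<tau> p)) \<le> B" if "q \<in> X" for q
          using dX[OF that] by (intro onorm_le) (auto simp: mult.commute[of B] intro: mult_left_mono)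
      qed
      then show "dist (\<phi> s \<tau> p) (\<phi> r \<tau> p) \<le> B * dist s r" by (simp add: dist_norm)
    qed (rule B(2))
    then have "uniformly_continuous_on X (\<lambda>t. \<phi> t \<tau> p)" by (rule lipschitz_on_uniformly_continuous)
    then obtain l where "((\<lambda>t. \<phi> t \<tau> p) \<longlongrightarrow> l) (at \<beta> within X)"
      using uniformly_continuous_on_extension_at_closure[OF _ X(2)] by blast
    then have "((\<lambda>t. \<phi> t \<tau> p) \<longlongrightarrow> l) (at \<beta> within ?S)"
      by (simp add: X_def at_within_def)
    moreover have "\<beta> \<in> I" using \<beta>e segT TI by blast
    ultimately show False using no_limit_at_boundary[OF \<tau>(1) _ \<beta>J SJ] by blast
  qed
  show thesis
  proof
    fix p t assume p: "norm (p - p0) < \<delta>" and t: "t \<in> ?T"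
    have "closed_segment \<tau> t \<subseteq> ?T" using t \<tau>(2) by (intro closed_segment_subset) auto
    then show "norm (\<phi> t \<tau> p - ?x0 t) \<le> C * norm (p - p0)"
      using bound[OF p t] global[OF p] by blast
  qed (use \<delta>0 C0 global in auto)
qed

lemma flow_domain_open:
  assumes \<tau>: "\<tau> \<in> I" "\<tau> \<in> {a..b}"
  shows "open {p. {a..b} \<subseteq> J \<tau> p}"
  unfolding open_dist
proof
  fix p assume "p \<in> {p. {a..b} \<subseteq> J \<tau> p}"
  then have "{a..b} \<subseteq> J \<tau> p" by simp
  from flow_stable[OF \<tau> this] obtain \<delta> where "0 < \<delta>" "\<And>q. norm (q - p) < \<delta> \<Longrightarrow> {a..b} \<subseteq> J \<tau> q" by metis
  then show "\<exists>e>0. \<forall>y. dist y p < e \<longrightarrow> y \<in> {p. {a..b} \<subseteq> J \<tau> p}" by (auto simp: dist_norm)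
qed

lemma flow_jointly_continuous:
  assumes \<tau>: "\<tau> \<in> I" "\<tau> \<in> {a..b}"
  shows "jointly_continuous_on {a..b} {p. {a..b} \<subseteq> J \<tau> p} (\<lambda>t. \<phi> t \<tau>)"
proof (rule jointly_continuousI)
  fix p assume "p \<in> {p. {a..b} \<subseteq> J \<tau> p}"
  then have p: "{a..b} \<subseteq> J \<tau> p" by simp
  then show "continuous_on {a..b} (\<lambda>t. \<phi> t \<tau> p)" by (rule solution_continuous[OF \<tau>(1)])
  fix e :: real assume e: "0 < e"
  from flow_stable[OF \<tau> p] obtain C \<delta> where C: "0 < \<delta>" "0 < C"
    "\<And>q t. norm (q - p) < \<delta> \<Longrightarrow> t \<in> {a..b} \<Longrightarrow> norm (\<phi> t \<tau> q - \<phi> t \<tau> p) \<le> C * norm (q - p)" by metis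
  have "\<forall>t\<in>{a..b}. norm (\<phi> t \<tau> q - \<phi> t \<tau> p) \<le> e" if q: "dist q p < min \<delta> (e / C)" for q
  proof
    fix t assume "t \<in> {a..b}"
    then have "norm (\<phi> t \<tau> q - \<phi> t \<tau> p) \<le> C * norm (q - p)" using C(3) q by (simp add: dist_norm)
    also have "\<dots> \<le> e" using q C(2) by (simp add: dist_norm field_simps)
    finally show "norm (\<phi> t \<tau> q - \<phi> t \<tau> p) \<le> e" .
  qed
  then show "\<forall>\<^sub>F r in nhds p. \<forall>t\<in>{a..b}. norm (\<phi> t \<tau> r - \<phi> t \<tau> p) \<le> e"
    unfolding eventually_nhds_metric using C(1,2) e by (intro exI[of _ "min \<delta> (e / C)"]) auto
qed

end

section \<open>Linear equations with parameters\<close>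

lemma jointly_continuous_bilinear:
  assumes "bounded_bilinear B" "jointly_continuous_on T U F" "jointly_continuous_on T U G"
  shows "jointly_continuous_on T U (\<lambda>t p. B (F t p) (G t p))"
  using bounded_bilinear.continuous_on[OF assms] by (simp add: split_def)

lemma jointly_continuous_add:
  fixes F :: "real \<Rightarrow> 'p::topological_space \<Rightarrow> 'b::real_normed_vector"
  assumes "jointly_continuous_on T U F" "jointly_continuous_on T U G"
  shows "jointly_continuous_on T U (\<lambda>t p. F t p + G t p)"
  using continuous_on_add[OF assms] by (simp add: split_def)

lemma jointly_continuous_sum:
  fixes F :: "'k \<Rightarrow> real \<Rightarrow> 'p::topological_space \<Rightarrow> 'b::real_normed_vector"
  assumes "\<And>k. k \<in> S \<Longrightarrow> jointly_continuous_on T U (F k)"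
  shows "jointly_continuous_on T U (\<lambda>t p. \<Sum>k\<in>S. F k t p)"
  using continuous_on_sum[of S "T \<times> U" "\<lambda>k (t, p). F k t p"] assms by (simp add: split_def)

lemma bounded_bilinear_matrix_vector_mult:
  "bounded_bilinear ((*v) :: real^'n^'m \<Rightarrow> real^'n \<Rightarrow> real^'m)"
  by (intro bilinear_conv_bounded_bilinear[THEN iffD1])
     (auto simp: bilinear_def matrix_vector_right_distrib matrix_vector_mult_add_rdistrib
       scaleR_matrix_vector_assoc matrix_vector_mult_scaleR intro!: linearI)

text \<open>The common shape of \<open>D1\<close>, \<open>D2\<close> and \<open>D3\<close>, with
  single indices, pairs or triples as column indices. A product with a Kronecker power then becomes
  a sum over these indices.\<close>

definition matrix_of_columns :: "('k \<Rightarrow> real^'r) \<Rightarrow> real^'k^'r" where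
  "matrix_of_columns a = (\<chi> r k. a k $ r)"

lemma matrix_of_columns_mult: "matrix_of_columns a *v v = (\<Sum>k\<in>UNIV. v $ k *\<^sub>R a k)"
  by (simp add: vec_eq_iff matrix_of_columns_def matrix_vector_mult_def sum_component mult.commute)

lemma jointly_continuous_matrix_of_columns:
  assumes "\<And>k. jointly_continuous_on T U (a k)"
  shows "jointly_continuous_on T U (\<lambda>t p. matrix_of_columns (\<lambda>k. a k t p))"
  using assms unfolding matrix_of_columns_def split_def
  by (intro continuous_on_vec_lambda continuous_on_component) auto

lemma has_vector_derivative_vec_lambda:
  assumes "\<And>r. (g r has_vector_derivative d r) (at x within S)"
  shows "((\<lambda>s. \<chi> r. g r s) has_vector_derivative (\<chi> r. d r)) (at x within S)"
  unfolding has_vector_derivative_def has_derivative_within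
proof (intro conjI vec_tendstoI)
  fix r
  have "((\<lambda>y. (1 / norm (y - x)) *\<^sub>R (g r y - (g r x + (y - x) *\<^sub>R d r))) \<longlongrightarrow> 0) (at x within S)"
    using assms[of r] unfolding has_vector_derivative_def has_derivative_within by blast
  then show "((\<lambda>y. ((1 / norm (y - x)) *\<^sub>R ((\<chi> r. g r y) - ((\<chi> r. g r x) + (y - x) *\<^sub>R (\<chi> r. d r)))) $ r) \<longlongrightarrow> 0 $ r)
     (at x within S)" by simp
qed (rule bounded_linear_scaleR_left)

lemma has_vector_derivative_matrix_of_columns:
  assumes "\<And>k. (a k has_vector_derivative d k) (at x within S)"
  shows "((\<lambda>s. matrix_of_columns (\<lambda>k. a k s)) has_vector_derivative matrix_of_columns d) (at x within S)"
  unfolding matrix_of_columns_def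
  by (intro has_vector_derivative_vec_lambda bounded_linear.has_vector_derivative[OF bounded_linear_vec_nth] assms)

lemma partial_matrix_of_columns:
  assumes "\<And>k. has_partial i (a k) p"
  shows "has_partial i (\<lambda>p. matrix_of_columns (\<lambda>k. a k p)) p"
    "partial i (\<lambda>p. matrix_of_columns (\<lambda>k. a k p)) p = matrix_of_columns (\<lambda>k. partial i (a k) p)"
proof -
  have "((\<lambda>s. matrix_of_columns (\<lambda>k. a k (p + s *\<^sub>R axis i 1))) has_vector_derivative
      matrix_of_columns (\<lambda>k. partial i (a k) p)) (at 0)"
    by (rule has_vector_derivative_matrix_of_columns) (rule assms[unfolded has_partial_iff])
  then show "has_partial i (\<lambda>p. matrix_of_columns (\<lambda>k. a k p)) p"
    "partial i (\<lambda>p. matrix_of_columns (\<lambda>k. a k p)) p = matrix_of_columns (\<lambda>k. partial i (a k) p)"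
    by (auto intro: partialI)
qed

lemma D_vec_columns: "D_vec g x = matrix_of_columns (\<lambda>i. partial i g x)"
  by (simp add: D_vec_def matrix_of_columns_def)

lemma D_mat_columns:
  assumes "\<And>i c. has_partial i (m c) x"
  shows "D_mat (\<lambda>x. matrix_of_columns (\<lambda>c. m c x)) x = matrix_of_columns (\<lambda>(i, c). partial i (m c) x)"
  unfolding D_mat_def partial_matrix_of_columns(2)[OF assms]
  by (simp add: matrix_of_columns_def vec_eq_iff split_def)

text \<open>The column form of \<open>D2\<close> is available only where second partial derivatives
  exist, for the flow an open set of initial values; differentiating it needs no more than local
  agreement.\<close>

lemma partial_cong_open:
  assumes "open U" "p \<in> U" "\<And>q. q \<in> U \<Longrightarrow> g q = h q"
  shows "partial i g p = partial i h p"
proof -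
  have "\<forall>\<^sub>F q in nhds p. g q = h q" using assms unfolding eventually_nhds by blast
  then have "\<forall>\<^sub>F s in nhds 0. g (p + s *\<^sub>R axis i 1) = h (p + s *\<^sub>R axis i 1)"
    by (rule eventually_compose_filterlim) (auto intro!: tendsto_eq_intros filterlim_ident)
  then have "((\<lambda>s. g (p + s *\<^sub>R axis i 1)) has_vector_derivative d) (at 0) \<longleftrightarrow>
     ((\<lambda>s. h (p + s *\<^sub>R axis i 1)) has_vector_derivative d) (at 0)" for d
    by (intro has_vector_derivative_cong_ev) (auto elim: eventually_mono dest: eventually_nhds_x_imp_x)
  then show ?thesis unfolding partial_def vector_derivative_def by simp
qed

section \<open>Symmetry of second partial derivatives\<close>

lemma mixed_difference_estimate:
  fixes g :: "real^'n \<Rightarrow> 'b::real_normed_vector"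
  assumes "\<And>z. has_partial i g z" "\<And>z. has_partial j (partial i g) z"
    and c: "isCont (partial j (partial i g)) x" and e: "0 < e"
  shows "\<exists>r>0. \<forall>s. \<bar>s\<bar> < r \<longrightarrow>
     norm (g (x + s *\<^sub>R axis i 1 + s *\<^sub>R axis j 1) - g (x + s *\<^sub>R axis i 1) - (g (x + s *\<^sub>R axis j 1) - g x)
        - s *\<^sub>R s *\<^sub>R partial j (partial i g) x) \<le> e * (s * s)"
proof -
  let ?d = "partial j (partial i g) x"
  from c[unfolded continuous_at_eps_delta] e obtain \<delta> where \<delta>: "0 < \<delta>"
    "\<And>y. dist y x < \<delta> \<Longrightarrow> dist (partial j (partial i g) y) ?d < e" by blast
  show ?thesis
  \<comment> \<open>Half of \<open>\<delta>\<close>, because a point of the square is displaced by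
    up to \<open>\<bar>s\<bar>\<close> in each of the two directions.\<close>
  proof (intro exI[of _ "\<delta> / 2"] conjI allI impI)
    fix s :: real assume s: "\<bar>s\<bar> < \<delta> / 2"
    \<comment> \<open>The second difference of \<open>g\<close> is the increment of \<open>G\<close>
      in direction \<open>i\<close>, whose partial derivative is an increment of
      \<open>partial i g\<close> in direction \<open>j\<close>. Two applications of the mean value
      inequality give the factor \<open>s * s\<close>.\<close>
    define G where "G = (\<lambda>y. g (y + s *\<^sub>R axis j 1) - g y)"
    have "norm (G (x + s *\<^sub>R axis i 1) - G x - s *\<^sub>R s *\<^sub>R ?d) \<le> (e * \<bar>s\<bar>) * \<bar>s\<bar>"
    proof (rule partial_increment_axis)
      fix r assume r: "r \<in> closed_segment 0 s"
      let ?y = "x + r *\<^sub>R axis i 1"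
      have rs: "\<bar>r\<bar> \<le> \<bar>s\<bar>" using segment_bound1[OF r] by simp
      have "((\<lambda>q. G (?y + q *\<^sub>R axis i 1)) has_vector_derivative
          partial i g (?y + s *\<^sub>R axis j 1) - partial i g ?y) (at 0)"
        using has_vector_derivative_diff[OF assms(1)[of "?y + s *\<^sub>R axis j 1", unfolded has_partial_iff] assms(1)[of ?y, unfolded has_partial_iff]]
        by (simp add: G_def algebra_simps)
      then have p: "has_partial i G ?y" "partial i G ?y = partial i g (?y + s *\<^sub>R axis j 1) - partial i g ?y"
        by (auto intro: partialI)
      have "norm (partial i g (?y + s *\<^sub>R axis j 1) - partial i g ?y - s *\<^sub>R ?d) \<le> e * \<bar>s\<bar>"
      proof (rule partial_increment_axis)
        fix q assume q: "q \<in> closed_segment 0 s"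
        have "\<bar>q\<bar> \<le> \<bar>s\<bar>" using segment_bound1[OF q] by simp
        then have "norm (r *\<^sub>R axis i 1 + q *\<^sub>R axis j (1::real) :: real^'n) \<le> \<bar>s\<bar> + \<bar>s\<bar>"
          using rs by (intro norm_triangle_le) auto
        then have "dist (?y + q *\<^sub>R axis j 1) x < \<delta>" using s by (simp add: dist_norm add.assoc)
        then show "has_partial j (partial i g) (?y + q *\<^sub>R axis j 1) \<and>
           norm (partial j (partial i g) (?y + q *\<^sub>R axis j 1) - ?d) \<le> e"
          using \<delta>(2) assms(2) by (simp add: dist_norm less_imp_le)
      qed
      then show "has_partial i G ?y \<and> norm (partial i G ?y - s *\<^sub>R ?d) \<le> e * \<bar>s\<bar>" using p by simp
    qed
    then show "norm (g (x + s *\<^sub>R axis i 1 + s *\<^sub>R axis j 1) - g (x + s *\<^sub>R axis i 1) - (g (x + s *\<^sub>R axis j 1) - g x)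
        - s *\<^sub>R s *\<^sub>R ?d) \<le> e * (s * s)"
      by (simp add: G_def mult.assoc)
  qed (use \<delta> in simp)
qed

lemma partials_commute:
  fixes g :: "real^'n \<Rightarrow> 'b::real_normed_vector"
  assumes p: "\<And>i z. has_partial i g z" "\<And>i j z. has_partial j (partial i g) z"
    and c: "\<And>i j. isCont (partial j (partial i g)) x"
  shows "partial j (partial i g) x = partial i (partial j g) x"
proof (rule ccontr)
  let ?a = "partial j (partial i g) x" and ?b = "partial i (partial j g) x"
  assume "?a \<noteq> ?b"
  \<comment> \<open>The second difference is the same for both orders of differentiation. With a
    third of the gap as tolerance, the two errors add up to only two thirds of it.\<close>
  then have e: "0 < norm (?a - ?b) / 3" by simp
  let ?e = "norm (?a - ?b) / 3"
  obtain r where r: "0 < r" "\<And>s. \<bar>s\<bar> < r \<Longrightarrow>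
     norm (g (x + s *\<^sub>R axis i 1 + s *\<^sub>R axis j 1) - g (x + s *\<^sub>R axis i 1) - (g (x + s *\<^sub>R axis j 1) - g x)
        - s *\<^sub>R s *\<^sub>R ?a) \<le> ?e * (s * s)"
    using mixed_difference_estimate[OF p c e] by blast
  obtain r' where r': "0 < r'" "\<And>s. \<bar>s\<bar> < r' \<Longrightarrow>
     norm (g (x + s *\<^sub>R axis j 1 + s *\<^sub>R axis i 1) - g (x + s *\<^sub>R axis j 1) - (g (x + s *\<^sub>R axis i 1) - g x)
        - s *\<^sub>R s *\<^sub>R ?b) \<le> ?e * (s * s)"
    using mixed_difference_estimate[OF p c e] by blast
  define s where "s = min r r' / 2"
  have s: "0 < s" "\<bar>s\<bar> < r" "\<bar>s\<bar> < r'" using r(1) r'(1) by (auto simp: s_def)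
  define X where "X = g (x + s *\<^sub>R axis i 1 + s *\<^sub>R axis j 1) - g (x + s *\<^sub>R axis i 1) - (g (x + s *\<^sub>R axis j 1) - g x)"
  have 1: "norm (X - s *\<^sub>R s *\<^sub>R ?a) \<le> ?e * (s * s)" using r(2)[OF s(2)] by (simp add: X_def)
  have 2: "norm (X - s *\<^sub>R s *\<^sub>R ?b) \<le> ?e * (s * s)" using r'(2)[OF s(3)] by (simp add: X_def algebra_simps)
  have "(s * s) * norm (?a - ?b) = norm ((X - s *\<^sub>R s *\<^sub>R ?b) - (X - s *\<^sub>R s *\<^sub>R ?a))"
    by (simp add: scaleR_diff_right[symmetric] abs_mult)
  also have "\<dots> \<le> ?e * (s * s) + ?e * (s * s)"
    by (rule order_trans[OF norm_triangle_ineq4 add_mono[OF 2 1]])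
  also have "\<dots> = (s * s) * (2 / 3 * norm (?a - ?b))" by simp
  finally have "norm (?a - ?b) \<le> 2 / 3 * norm (?a - ?b)"
    using s(1) by (simp only: mult_le_cancel_left_pos mult_pos_pos)
  then show False using e by simp
qed

lemma matrix_vector_mult_bound:
  fixes A :: "'s \<Rightarrow> real^'n^'m"
  assumes "\<And>t. t \<in> T \<Longrightarrow> norm (A t) \<le> B"
  obtains K where "0 \<le> K" "\<And>t v. t \<in> T \<Longrightarrow> norm (A t *v v) \<le> K * norm v"
proof -
  obtain C where C: "0 < C" "\<And>(X :: real^'n^'m) v. norm (X *v v) \<le> norm X * norm v * C"
    using bounded_bilinear.pos_bounded[OF bounded_bilinear_matrix_vector_mult] by blast
  have "norm (A t *v v) \<le> \<bar>B\<bar> * C * norm v" if "t \<in> T" for t v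
  proof -
    have "norm (A t *v v) \<le> norm (A t) * norm v * C" by (rule C(2))
    also have "\<dots> \<le> \<bar>B\<bar> * norm v * C"
      using assms[OF that] C(1) by (intro mult_right_mono) auto
    finally show ?thesis by (simp add: ac_simps)
  qed
  then show thesis using that[of "\<bar>B\<bar> * C"] C(1) by simp
qed

lemma continuous_on_Icc_bounded:
  fixes F :: "real \<Rightarrow> 'b::real_normed_vector"
  assumes "continuous_on {a..b} F"
  obtains B where "0 \<le> B" "\<And>t. t \<in> {a..b} \<Longrightarrow> norm (F t) \<le> B"
proof -
  have "bounded (F ` {a..b})"
    by (intro compact_imp_bounded compact_continuous_image assms compact_Icc)
  then obtain B where "\<And>t. t \<in> {a..b} \<Longrightarrow> norm (F t) \<le> B" unfolding bounded_iff by blast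
  then show thesis using that[of "\<bar>B\<bar>"] by (meson abs_ge_self abs_ge_zero order_trans)
qed

section \<open>Continuity and differentiability of solutions in the parameter\<close>

context
  fixes a b \<tau> :: real and U :: "(real^'n) set" and A :: "real \<Rightarrow> real^'n \<Rightarrow> real^'m^'m"
    and z g :: "real \<Rightarrow> real^'n \<Rightarrow> real^'m"
    and c :: "real^'m"
  assumes U: "open U" and \<tau>: "\<tau> \<in> {a..b}"
    and A: "jointly_continuous_on {a..b} U A" and g: "jointly_continuous_on {a..b} U g"
    and z: "\<And>t p. t \<in> {a..b} \<Longrightarrow> p \<in> U \<Longrightarrow>
       ((\<lambda>t. z t p) has_vector_derivative A t p *v z t p + g t p) (at t within {a..b})"
    and z\<tau>: "\<And>p. p \<in> U \<Longrightarrow> z \<tau> p = c"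
begin

lemma coefficient_bound:
  assumes "p \<in> U"
  obtains K where "0 \<le> K" "\<And>t v. t \<in> {a..b} \<Longrightarrow> norm (A t p *v v) \<le> K * norm v"
proof -
  obtain B where "0 \<le> B" "\<And>t. t \<in> {a..b} \<Longrightarrow> norm (A t p) \<le> B"
    using continuous_on_Icc_bounded[OF jointly_continuous_slice[OF A assms]] by blast
  then obtain K where "0 \<le> K" "\<And>t v. t \<in> {a..b} \<Longrightarrow> norm (A t p *v v) \<le> K * norm v"
    using matrix_vector_mult_bound[of "{a..b}" "\<lambda>t. A t p" B] by blast
  then show thesis by (rule that)
qed

text \<open>For \<open>s\<close> near \<open>p\<close>, the solution with parameter \<open>s\<close>
  is an approximate solution of the equation with parameter \<open>p\<close>; the filter is
  \<open>nhds p\<close>.\<close>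

lemma linear_ode_jointly_continuous: "jointly_continuous_on {a..b} U z"
proof (rule jointly_continuousI)
  fix p assume p: "p \<in> U"
  show "continuous_on {a..b} (\<lambda>t. z t p)"
    by (rule continuous_on_vector_derivative[where f' = "\<lambda>t. A t p *v z t p + g t p"]) (rule z[OF _ p])
  fix e :: real assume e: "0 < e"
  obtain K where K: "0 \<le> K" "\<And>t v. t \<in> {a..b} \<Longrightarrow> norm (A t p *v v) \<le> K * norm v"
    using coefficient_bound[OF p] by blast
  obtain B where B: "0 \<le> B" "\<And>t. t \<in> {a..b} \<Longrightarrow> norm (g t p) \<le> B"
    using continuous_on_Icc_bounded[OF jointly_continuous_slice[OF g p]] by blast
  obtain C where C: "0 < C" "\<And>(X :: real^'m^'m) v. norm (X *v v) \<le> norm X * norm v * C"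
    using bounded_bilinear.pos_bounded[OF bounded_bilinear_matrix_vector_mult] by blast
  have nb: "nhds p \<noteq> bot" by simp
  have approx: "\<forall>\<^sub>F s in nhds p. norm (z \<tau> s - c) \<le> e \<and>
       (\<forall>t\<in>{a..b}. \<exists>d. ((\<lambda>t. z t s) has_vector_derivative d) (at t within {a..b}) \<and>
           norm (d - (A t p *v z t s + g t p)) \<le> e * (1 + norm (z t s)))" if e: "0 < e" for e
  proof -
    \<comment> \<open>\<open>C\<close> bounds the matrix-vector product. The coefficient error then
      contributes at most \<open>e * norm (z t s)\<close>, the error in \<open>g\<close> at most
      \<open>e\<close>.\<close>
    define \<delta> where "\<delta> = e / (C + 1)"
    have \<delta>: "0 < \<delta>" "\<delta> * C \<le> e" "\<delta> \<le> e" using e C(1) by (auto simp: \<delta>_def field_simps)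
    show ?thesis
      using jointly_continuous_uniform[OF A compact_Icc U p \<delta>(1)]
        jointly_continuous_uniform[OF g compact_Icc U p \<delta>(1)]
    proof eventually_elim
      case (elim s)
      show ?case
      proof (intro conjI ballI)
        show "norm (z \<tau> s - c) \<le> e" using z\<tau> elim e by simp
        fix t assume t: "t \<in> {a..b}"
        have "norm ((A t s *v z t s + g t s) - (A t p *v z t s + g t p)) = norm ((A t s - A t p) *v z t s + (g t s - g t p))"
          by (simp add: algebra_simps)
        also have "\<dots> \<le> \<delta> * norm (z t s) * C + \<delta>"
        proof (rule norm_triangle_le, rule add_mono)
          have "norm ((A t s - A t p) *v z t s) \<le> norm (A t s - A t p) * norm (z t s) * C" by (rule C(2))
          also have "\<dots> \<le> \<delta> * norm (z t s) * C"
            using elim t C(1) by (intro mult_right_mono) auto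
          finally show "norm ((A t s - A t p) *v z t s) \<le> \<delta> * norm (z t s) * C" .
        qed (use elim t in auto)
        also have "\<dots> \<le> e * norm (z t s) + e"
          using mult_right_mono[OF \<delta>(2) norm_ge_zero[of "z t s"]] \<delta>(3) by (simp add: ac_simps)
        finally show "\<exists>d. ((\<lambda>t. z t s) has_vector_derivative d) (at t within {a..b}) \<and>
           norm (d - (A t p *v z t s + g t p)) \<le> e * (1 + norm (z t s))"
          using z[OF t] elim by (intro exI[of _ "A t s *v z t s + g t s"]) (auto simp: algebra_simps)
      qed
    qed
  qed
  obtain y where y: "\<And>e. 0 < e \<Longrightarrow> \<forall>\<^sub>F s in nhds p. \<forall>t\<in>{a..b}. norm (z t s - y t) \<le> e"
    using approximate_solutions_converge[OF nb \<tau> matrix_vector_mul_linear K(2) B(2) approx] by blast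
  \<comment> \<open>The filter \<open>nhds p\<close> includes \<open>p\<close> itself, so the
    approximations at parameter \<open>p\<close> must equal their limit.\<close>
  have "z t p = y t" if t: "t \<in> {a..b}" for t
  proof (rule ccontr)
    assume "z t p \<noteq> y t"
    then have "0 < norm (z t p - y t) / 2" by simp
    from eventually_nhds_x_imp_x[OF y[OF this]] t have "norm (z t p - y t) \<le> norm (z t p - y t) / 2" by blast
    with \<open>z t p \<noteq> y t\<close> show False by simp
  qed
  then show "\<forall>\<^sub>F r in nhds p. \<forall>t\<in>{a..b}. norm (z t r - z t p) \<le> e"
    using y[OF e] by (auto elim: eventually_mono)
qed

text \<open>The difference quotient solves the formally differentiated equation up to a small error.
  Its initial value is exactly \<open>0\<close>, because \<open>c\<close> is the same for all
  parameters. Its limit is therefore both the partial derivative and a solution of the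
  differentiated equation.\<close>

lemma linear_ode_partial:
  assumes Ai: "\<And>t p. t \<in> {a..b} \<Longrightarrow> p \<in> U \<Longrightarrow> has_partial i (A t) p"
      "jointly_continuous_on {a..b} U (\<lambda>t. partial i (A t))"
    and gi: "\<And>t p. t \<in> {a..b} \<Longrightarrow> p \<in> U \<Longrightarrow> has_partial i (g t) p"
      "jointly_continuous_on {a..b} U (\<lambda>t. partial i (g t))"
    and p: "p \<in> U"
  shows "partial i (z \<tau>) p = 0"
    "t \<in> {a..b} \<Longrightarrow> has_partial i (z t) p"
    "t \<in> {a..b} \<Longrightarrow> ((\<lambda>t. partial i (z t) p) has_vector_derivative
       A t p *v partial i (z t) p + (partial i (A t) p *v z t p + partial i (g t) p)) (at t within {a..b})"
proof -
  define q where "q = (\<lambda>s t. (z t (p + s *\<^sub>R axis i 1) - z t p) /\<^sub>R s)"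
  define \<beta> where "\<beta> = (\<lambda>t. partial i (A t) p *v z t p + partial i (g t) p)"
  obtain K where K: "0 \<le> K" "\<And>t v. t \<in> {a..b} \<Longrightarrow> norm (A t p *v v) \<le> K * norm v"
    using coefficient_bound[OF p] by blast
  have c\<beta>: "continuous_on {a..b} \<beta>"
    unfolding \<beta>_def
    by (intro continuous_on_add bounded_bilinear.continuous_on[OF bounded_bilinear_matrix_vector_mult]
        jointly_continuous_slice[OF _ p] Ai gi linear_ode_jointly_continuous)
  obtain B where B: "0 \<le> B" "\<And>t. t \<in> {a..b} \<Longrightarrow> norm (\<beta> t) \<le> B"
    using continuous_on_Icc_bounded[OF c\<beta>] by blast
  obtain Z where Z: "0 \<le> Z" "\<And>t. t \<in> {a..b} \<Longrightarrow> norm (z t p) \<le> Z"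
    using continuous_on_Icc_bounded[OF jointly_continuous_slice[OF linear_ode_jointly_continuous p]] by blast
  obtain C where C: "0 < C" "\<And>(X :: real^'m^'m) v. norm (X *v v) \<le> norm X * norm v * C"
    using bounded_bilinear.pos_bounded[OF bounded_bilinear_matrix_vector_mult] by blast
  have nb: "at (0::real) \<noteq> bot" by simp
  have approx: "\<forall>\<^sub>F s in at 0. norm (q s \<tau> - 0) \<le> e \<and>
       (\<forall>t\<in>{a..b}. \<exists>d. (q s has_vector_derivative d) (at t within {a..b}) \<and>
           norm (d - (A t p *v q s t + \<beta> t)) \<le> e * (1 + norm (q s t)))" if e: "0 < e" for e
  proof -
    \<comment> \<open>One \<open>C\<close> pays for the perturbed coefficient acting on the
      quotient, \<open>Z * C\<close> for the difference quotient of the coefficient acting on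
      \<open>z\<close>, and \<open>1\<close> for that of \<open>g\<close>.\<close>
    define \<delta> where "\<delta> = e / (C + Z * C + 1)"
    have "0 < C + Z * C + 1" using C(1) Z(1) by (simp add: add_nonneg_pos)
    then have \<delta>: "0 < \<delta>" "\<delta> * (C + Z * C + 1) = e" using e by (auto simp: \<delta>_def)
    have \<delta>C: "\<delta> * C \<le> e" "\<delta> * Z * C + \<delta> \<le> e" using \<delta> C(1) Z(1) by (auto simp: algebra_simps)
    have "\<forall>\<^sub>F s in at 0. p + s *\<^sub>R axis i 1 \<in> U \<and> (\<forall>t\<in>{a..b}. norm (A t (p + s *\<^sub>R axis i 1) - A t p) \<le> \<delta>)"
      by (rule eventually_compose_filterlim[OF jointly_continuous_uniform[OF A compact_Icc U p \<delta>(1)] tendsto_axis_nhds])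
    moreover have "\<forall>\<^sub>F s in at 0. \<forall>t\<in>{a..b}. norm ((A t (p + s *\<^sub>R axis i 1) - A t p) /\<^sub>R s - partial i (A t) p) \<le> \<delta>"
      by (rule partial_difference_quotient_uniform[OF _ Ai(2) compact_Icc U p \<delta>(1)]) (rule Ai(1))
    moreover have "\<forall>\<^sub>F s in at 0. \<forall>t\<in>{a..b}. norm ((g t (p + s *\<^sub>R axis i 1) - g t p) /\<^sub>R s - partial i (g t) p) \<le> \<delta>"
      by (rule partial_difference_quotient_uniform[OF _ gi(2) compact_Icc U p \<delta>(1)]) (rule gi(1))
    moreover have "\<forall>\<^sub>F s in at (0::real). s \<noteq> 0" by (rule eventually_neq_at_within)
    ultimately show ?thesis
    proof eventually_elim
      case (elim s)
      let ?p = "p + s *\<^sub>R axis i 1"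
      show ?case
      proof (intro conjI ballI)
        show "norm (q s \<tau> - 0) \<le> e" using z\<tau> p elim e by (simp add: q_def)
        fix t assume t: "t \<in> {a..b}"
        let ?d = "((A t ?p *v z t ?p + g t ?p) - (A t p *v z t p + g t p)) /\<^sub>R s"
        have d: "(q s has_vector_derivative ?d) (at t within {a..b})"
          unfolding q_def using z[OF t] p elim
          by (intro bounded_linear.has_vector_derivative[OF bounded_linear_scaleR_right] has_vector_derivative_diff) auto
        let ?X = "(A t ?p - A t p) /\<^sub>R s - partial i (A t) p" and ?y = "(g t ?p - g t p) /\<^sub>R s - partial i (g t) p"
        \<comment> \<open>The difference of products is split as
          \<open>A ?p *v (z ?p - z p) + (A ?p - A p) *v z p\<close>, which puts the unperturbed
          solution next to the difference quotient of \<open>A\<close>.\<close>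
        have "?d - (A t p *v q s t + \<beta> t) = (A t ?p - A t p) *v q s t + (?X *v z t p + ?y)"
          unfolding q_def \<beta>_def
          by (simp add: algebra_simps scaleR_matrix_vector_assoc[symmetric])
        also have "norm \<dots> \<le> \<delta> * norm (q s t) * C + (\<delta> * Z * C + \<delta>)"
        proof (rule norm_triangle_le, rule add_mono)
          have "norm ((A t ?p - A t p) *v q s t) \<le> norm (A t ?p - A t p) * norm (q s t) * C" by (rule C(2))
          also have "\<dots> \<le> \<delta> * norm (q s t) * C" using elim t C(1) by (intro mult_right_mono) auto
          finally show "norm ((A t ?p - A t p) *v q s t) \<le> \<delta> * norm (q s t) * C" .
          have "norm (?X *v z t p) \<le> norm ?X * norm (z t p) * C" by (rule C(2))
          also have "\<dots> \<le> \<delta> * Z * C"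
            using elim t C(1) Z \<delta>(1) by (intro mult_right_mono mult_mono) auto
          finally have X: "norm (?X *v z t p) \<le> \<delta> * Z * C" .
          have y: "norm ?y \<le> \<delta>" using elim t by blast
          show "norm (?X *v z t p + ?y) \<le> \<delta> * Z * C + \<delta>"
            by (rule norm_triangle_le[OF add_mono[OF X y]])
        qed
        also have "\<dots> \<le> e * norm (q s t) + e"
          using mult_right_mono[OF \<delta>C(1) norm_ge_zero[of "q s t"]] \<delta>C(2) by (simp add: ac_simps)
        finally show "\<exists>d. (q s has_vector_derivative d) (at t within {a..b}) \<and>
           norm (d - (A t p *v q s t + \<beta> t)) \<le> e * (1 + norm (q s t))"
          using d by (intro exI[of _ ?d]) (auto simp: algebra_simps)
      qed
    qed
  qed
  obtain y where y: "y \<tau> = 0" "\<And>t. t \<in> {a..b} \<Longrightarrow> (y has_vector_derivative A t p *v y t + \<beta> t) (at t within {a..b})"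
      "\<And>e. 0 < e \<Longrightarrow> \<forall>\<^sub>F s in at 0. \<forall>t\<in>{a..b}. norm (q s t - y t) \<le> e"
    using approximate_solutions_converge[OF nb \<tau> matrix_vector_mul_linear K(2) B(2) approx] by blast
  have py: "has_partial i (z t) p" "partial i (z t) p = y t" if t: "t \<in> {a..b}" for t
  proof -
    have "\<forall>\<^sub>F s in at 0. norm ((z t (p + s *\<^sub>R axis i 1) - z t p) /\<^sub>R s - y t) \<le> e" if "0 < e" for e
      using y(3)[OF that] by eventually_elim (use t in \<open>auto simp: q_def\<close>)
    from partial_of_difference_quotient[OF this]
    show "has_partial i (z t) p" "partial i (z t) p = y t" by auto
  qed
  show "partial i (z \<tau>) p = 0" using py(2)[OF \<tau>] y(1) by simp
  show "t \<in> {a..b} \<Longrightarrow> has_partial i (z t) p" by (rule py(1))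
  show "((\<lambda>t. partial i (z t) p) has_vector_derivative
       A t p *v partial i (z t) p + (partial i (A t) p *v z t p + partial i (g t) p)) (at t within {a..b})"
    if t: "t \<in> {a..b}"
    using has_vector_derivative_transform[OF t _ y(2)[OF t]] py(2) t by (simp add: \<beta>_def)
qed

end

section \<open>Derivatives of the flow\<close>

lemma partial_const: "has_partial i (\<lambda>p. c) p" "partial i (\<lambda>p. c) p = 0"
  by (auto intro!: partialI has_vector_derivative_const)

lemma bounded_bilinear_component_scaleR:
  "bounded_bilinear (\<lambda>(v :: real^'n) (w :: 'b::real_normed_vector). v $ l *\<^sub>R w)"
  by (rule bounded_bilinear.comp[OF bounded_bilinear_scaleR bounded_linear_vec_nth bounded_linear_ident])

lemma jointly_continuous_cong:
  assumes "jointly_continuous_on T U F" "\<And>t p. t \<in> T \<Longrightarrow> p \<in> U \<Longrightarrow> G t p = F t p"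
  shows "jointly_continuous_on T U G"
  by (rule continuous_on_cong[THEN iffD1, OF refl _ assms(1)]) (use assms(2) in auto)

context C1_flow
begin

abbreviation flow_domain :: "real \<Rightarrow> real \<Rightarrow> real \<Rightarrow> (real^'n) set" where
  "flow_domain a b \<tau> \<equiv> {p. {a..b} \<subseteq> J \<tau> p}"

abbreviation flow_derivative_matrix :: "real \<Rightarrow> real \<Rightarrow> real^'n \<Rightarrow> real^'n^'n" where
  "flow_derivative_matrix \<tau> t p \<equiv> matrix_of_columns (\<lambda>k. partial k (f t) (\<phi> t \<tau> p))"

context
  fixes a b \<tau> :: real
  assumes \<tau>I: "\<tau> \<in> I" and \<tau>: "\<tau> \<in> {a..b}"
begin

lemma time_subset: "p \<in> flow_domain a b \<tau> \<Longrightarrow> {a..b} \<subseteq> I"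
  using solution(3)[OF \<tau>I] by blast

lemma jointly_continuous_along_flow:
  assumes "jointly_continuous_on I UNIV G"
  shows "jointly_continuous_on {a..b} (flow_domain a b \<tau>) (\<lambda>t p. G t (\<phi> t \<tau> p))"
proof (cases "flow_domain a b \<tau> = {}")
  case False
  then obtain p where "p \<in> flow_domain a b \<tau>" by blast
  from time_subset[OF this] show ?thesis
    by (rule jointly_continuous_compose[OF assms flow_jointly_continuous[OF \<tau>I \<tau>]]) simp
qed simp

lemma flow_derivative_matrix_continuous: "jointly_continuous_on {a..b} (flow_domain a b \<tau>) (flow_derivative_matrix \<tau>)"
  by (intro jointly_continuous_matrix_of_columns jointly_continuous_along_flow f_partial_cont)

text \<open>The difference quotient of the flow starts at \<open>axis i 1\<close> exactly and
  satisfies the variational equation up to the first-order remainder of \<open>f\<close>. Stability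
  of the flow makes that remainder small uniformly in time.\<close>

lemma flow_partial_at:
  assumes p: "p \<in> flow_domain a b \<tau>"
  shows "partial i (\<phi> \<tau> \<tau>) p = axis i 1"
    "t \<in> {a..b} \<Longrightarrow> has_partial i (\<phi> t \<tau>) p"
    "t \<in> {a..b} \<Longrightarrow> ((\<lambda>t. partial i (\<phi> t \<tau>) p) has_vector_derivative
       flow_derivative_matrix \<tau> t p *v partial i (\<phi> t \<tau>) p) (at t within {a..b})"
proof -
  let ?T = "{a..b}" and ?A = "\<lambda>t. flow_derivative_matrix \<tau> t p"
  define q where "q = (\<lambda>s t. (\<phi> t \<tau> (p + s *\<^sub>R axis i 1) - \<phi> t \<tau> p) /\<^sub>R s)"
  have T: "?T \<subseteq> J \<tau> p" using p by simp
  have TI: "?T \<subseteq> I" by (rule time_subset[OF p])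
  have U: "open (flow_domain a b \<tau>)" by (rule flow_domain_open[OF \<tau>I \<tau>])
  obtain B where B: "0 \<le> B" "\<And>t. t \<in> ?T \<Longrightarrow> norm (?A t) \<le> B"
    using continuous_on_Icc_bounded[OF jointly_continuous_slice[OF flow_derivative_matrix_continuous p]] by blast
  obtain K where K: "0 \<le> K" "\<And>t v. t \<in> ?T \<Longrightarrow> norm (?A t *v v) \<le> K * norm v"
    using matrix_vector_mult_bound[of ?T ?A B] B(2) by blast
  have nb: "at (0::real) \<noteq> bot" by simp
  \<comment> \<open>Shifted to the base solution, continuity of the partial derivatives becomes
    continuity in \<open>v\<close> at \<open>0\<close>, uniformly in time.\<close>
  have sh: "jointly_continuous_on ?T UNIV (\<lambda>t v. partial k (f t) (\<phi> t \<tau> p + v))" for k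
  proof (rule jointly_continuous_compose[OF f_partial_cont _ TI])
    show "jointly_continuous_on ?T UNIV (\<lambda>t v. \<phi> t \<tau> p + v)"
      unfolding split_def
      by (auto intro!: continuous_intros continuous_on_compose2[OF solution_continuous[OF \<tau>I T]])
  qed simp
  have approx: "\<forall>\<^sub>F s in at 0. norm (q s \<tau> - axis i 1) \<le> e \<and>
       (\<forall>t\<in>?T. \<exists>d. (q s has_vector_derivative d) (at t within ?T) \<and>
           norm (d - (?A t *v q s t + 0)) \<le> e * (1 + norm (q s t)))" if e: "0 < e" for e
  proof -
    define \<delta> where "\<delta> = e / real CARD('n)"
    have \<delta>: "0 < \<delta>" "real CARD('n) * \<delta> = e" using e by (auto simp: \<delta>_def)
    have "\<forall>\<^sub>F v in nhds 0. \<forall>k. \<forall>t\<in>?T. norm (partial k (f t) (\<phi> t \<tau> p + v) - partial k (f t) (\<phi> t \<tau> p + 0)) \<le> \<delta>"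
    proof (intro eventually_all_finite)
      fix k
      show "\<forall>\<^sub>F v in nhds 0. \<forall>t\<in>?T. norm (partial k (f t) (\<phi> t \<tau> p + v) - partial k (f t) (\<phi> t \<tau> p + 0)) \<le> \<delta>"
        using jointly_continuous_uniform[OF sh[of k] compact_Icc open_UNIV UNIV_I \<delta>(1), of 0] by (rule eventually_mono) simp
    qed
    then obtain r where r: "0 < r"
      "\<And>v k t. norm v < r \<Longrightarrow> t \<in> ?T \<Longrightarrow> norm (partial k (f t) (\<phi> t \<tau> p + v) - partial k (f t) (\<phi> t \<tau> p)) \<le> \<delta>"
      unfolding eventually_nhds_metric dist_norm by auto
    \<comment> \<open>The bound \<open>r / 2\<close> keeps every point no farther from the base
      solution than the perturbed one strictly within \<open>r\<close>.\<close>
    have "\<forall>\<^sub>F s in at 0. p + s *\<^sub>R axis i 1 \<in> flow_domain a b \<tau> \<and> (\<forall>t\<in>?T. norm (\<phi> t \<tau> (p + s *\<^sub>R axis i 1) - \<phi> t \<tau> p) \<le> r / 2)"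
      using r(1)
      by (intro eventually_compose_filterlim[OF jointly_continuous_uniform[OF flow_jointly_continuous[OF \<tau>I \<tau>] compact_Icc U p] tendsto_axis_nhds]) simp
    moreover have "\<forall>\<^sub>F s in at (0::real). s \<noteq> 0" by (rule eventually_neq_at_within)
    ultimately show ?thesis
    proof eventually_elim
      case (elim s)
      let ?p = "p + s *\<^sub>R axis i 1"
      have pU: "?p \<in> flow_domain a b \<tau>" using elim by blast
      show ?case
      proof (intro conjI ballI)
        show "norm (q s \<tau> - axis i 1) \<le> e"
          using e elim solution(5)[OF \<tau>I] by (simp add: q_def)
        fix t assume t: "t \<in> ?T"
        let ?v = "\<phi> t \<tau> ?p - \<phi> t \<tau> p"
        let ?d = "(f t (\<phi> t \<tau> ?p) - f t (\<phi> t \<tau> p)) /\<^sub>R s"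
        have d: "(q s has_vector_derivative ?d) (at t within ?T)"
          unfolding q_def using pU T t
          by (intro bounded_linear.has_vector_derivative[OF bounded_linear_scaleR_right] has_vector_derivative_diff
              has_vector_derivative_at_within[OF solution(6)[OF \<tau>I]]) auto
        have "norm (f t (\<phi> t \<tau> p + ?v) - f t (\<phi> t \<tau> p) - (\<Sum>k\<in>UNIV. ?v $ k *\<^sub>R partial k (f t) (\<phi> t \<tau> p)))
           \<le> real CARD('n) * \<delta> * norm ?v"
        proof (rule partial_increment)
          fix k z assume z: "norm (z - \<phi> t \<tau> p) \<le> norm ?v"
          have "norm ?v \<le> r / 2" using elim t by blast
          then have "norm (z - \<phi> t \<tau> p) < r" using z r(1) by linarith
          from r(2)[OF this t, of k]
          show "has_partial k (f t) z \<and> norm (partial k (f t) z - partial k (f t) (\<phi> t \<tau> p)) \<le> \<delta>"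
            using f_partial t TI by auto
        qed
        then have "norm (f t (\<phi> t \<tau> ?p) - f t (\<phi> t \<tau> p) - ?A t *v ?v) / \<bar>s\<bar> \<le> e * norm ?v / \<bar>s\<bar>"
          by (intro divide_right_mono) (auto simp: \<delta>(2) matrix_of_columns_mult)
        moreover have "?A t *v q s t = (?A t *v ?v) /\<^sub>R s"
          by (simp only: q_def matrix_vector_mult_scaleR)
        then have "?d - (?A t *v q s t + 0) = (f t (\<phi> t \<tau> ?p) - f t (\<phi> t \<tau> p) - ?A t *v ?v) /\<^sub>R s"
          by (simp only: add_0_right scaleR_diff_right)
        ultimately have "norm (?d - (?A t *v q s t + 0)) \<le> e * norm (q s t)"
          by (simp add: q_def divide_inverse mult.commute mult.left_commute)
        also have "\<dots> \<le> e * (1 + norm (q s t))" using e by (intro mult_left_mono) auto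
        finally show "\<exists>d. (q s has_vector_derivative d) (at t within ?T) \<and>
           norm (d - (?A t *v q s t + 0)) \<le> e * (1 + norm (q s t))" using d by blast
      qed
    qed
  qed
  have z0: "norm (0 :: real^'n) \<le> 0" by simp
  obtain y where y: "y \<tau> = axis i 1" "\<And>t. t \<in> ?T \<Longrightarrow> (y has_vector_derivative ?A t *v y t + 0) (at t within ?T)"
      "\<And>e. 0 < e \<Longrightarrow> \<forall>\<^sub>F s in at 0. \<forall>t\<in>?T. norm (q s t - y t) \<le> e"
    using approximate_solutions_converge[OF nb \<tau> matrix_vector_mul_linear K(2) z0 approx] by blast
  have py: "has_partial i (\<phi> t \<tau>) p" "partial i (\<phi> t \<tau>) p = y t" if t: "t \<in> ?T" for t
  proof -
    have "\<forall>\<^sub>F s in at 0. norm ((\<phi> t \<tau> (p + s *\<^sub>R axis i 1) - \<phi> t \<tau> p) /\<^sub>R s - y t) \<le> e" if "0 < e" for e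
      using y(3)[OF that] by eventually_elim (use t in \<open>auto simp: q_def\<close>)
    from partial_of_difference_quotient[OF this]
    show "has_partial i (\<phi> t \<tau>) p" "partial i (\<phi> t \<tau>) p = y t" by auto
  qed
  show "partial i (\<phi> \<tau> \<tau>) p = axis i 1" using py(2)[OF \<tau>] y(1) by simp
  show "t \<in> ?T \<Longrightarrow> has_partial i (\<phi> t \<tau>) p" by (rule py(1))
  show "((\<lambda>t. partial i (\<phi> t \<tau>) p) has_vector_derivative ?A t *v partial i (\<phi> t \<tau>) p) (at t within ?T)"
    if t: "t \<in> ?T"
    using has_vector_derivative_transform[OF t _ y(2)[OF t]] py(2) t by simp
qed

lemma flow_partial_continuous: "jointly_continuous_on {a..b} (flow_domain a b \<tau>) (\<lambda>t. partial i (\<phi> t \<tau>))"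
proof (rule linear_ode_jointly_continuous[where A = "flow_derivative_matrix \<tau>" and g = "\<lambda>t p. 0" and c = "axis i 1"])
  show "((\<lambda>t. partial i (\<phi> t \<tau>) p) has_vector_derivative
       flow_derivative_matrix \<tau> t p *v partial i (\<phi> t \<tau>) p + 0) (at t within {a..b})"
    if "t \<in> {a..b}" "p \<in> flow_domain a b \<tau>" for t p
    using flow_partial_at(3)[OF that(2,1)] by simp
qed (use \<tau> flow_domain_open[OF \<tau>I \<tau>] flow_derivative_matrix_continuous flow_partial_at(1) in auto)

end

end

locale C3_flow = C1_flow I f J \<phi>
  for I :: "real set" and f :: "real \<Rightarrow> real^'n \<Rightarrow> real^'n"
    and J :: "real \<Rightarrow> real^'n \<Rightarrow> real set" and \<phi> :: "real \<Rightarrow> real \<Rightarrow> real^'n \<Rightarrow> real^'n" +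
  assumes f_partial2: "\<And>t x k l. t \<in> I \<Longrightarrow> has_partial l (partial k (f t)) x"
    and f_partial2_cont: "\<And>k l. jointly_continuous_on I UNIV (\<lambda>t. partial l (partial k (f t)))"
    and f_partial3: "\<And>t x k l m. t \<in> I \<Longrightarrow> has_partial m (partial l (partial k (f t))) x"
    and f_partial3_cont: "\<And>k l m. jointly_continuous_on I UNIV (\<lambda>t. partial m (partial l (partial k (f t))))"
begin

context
  fixes a b \<tau> :: real
  assumes \<tau>I: "\<tau> \<in> I" and \<tau>: "\<tau> \<in> {a..b}"
begin

lemma open_flow_domain: "open (flow_domain a b \<tau>)"
  by (rule flow_domain_open[OF \<tau>I \<tau>])

lemmas flow1 = flow_partial_at[OF \<tau>I \<tau>]
lemmas along_flow = jointly_continuous_along_flow[OF \<tau>I \<tau>]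

lemma partial_f_along_flow:
  assumes p: "p \<in> flow_domain a b \<tau>" and t: "t \<in> {a..b}"
  shows "has_partial i (\<lambda>p. partial k (f t) (\<phi> t \<tau> p)) p"
    "partial i (\<lambda>p. partial k (f t) (\<phi> t \<tau> p)) p =
       (\<Sum>l\<in>UNIV. partial i (\<phi> t \<tau>) p $ l *\<^sub>R partial l (partial k (f t)) (\<phi> t \<tau> p))"
    "has_partial i (\<lambda>p. partial l (partial k (f t)) (\<phi> t \<tau> p)) p"
    "partial i (\<lambda>p. partial l (partial k (f t)) (\<phi> t \<tau> p)) p =
       (\<Sum>m\<in>UNIV. partial i (\<phi> t \<tau>) p $ m *\<^sub>R partial m (partial l (partial k (f t))) (\<phi> t \<tau> p))"
proof -
  have tI: "t \<in> I" using time_subset[OF \<tau>I \<tau> p] t by blast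
  show "has_partial i (\<lambda>p. partial k (f t) (\<phi> t \<tau> p)) p"
    "partial i (\<lambda>p. partial k (f t) (\<phi> t \<tau> p)) p =
       (\<Sum>l\<in>UNIV. partial i (\<phi> t \<tau>) p $ l *\<^sub>R partial l (partial k (f t)) (\<phi> t \<tau> p))"
    using partial_chain_C1[where G = "partial k (f t)" and \<gamma> = "\<phi> t \<tau>", OF f_partial2[OF tI]
        jointly_continuous_isCont[OF f_partial2_cont tI] flow1(2)[OF p t]] by blast+
  show "has_partial i (\<lambda>p. partial l (partial k (f t)) (\<phi> t \<tau> p)) p"
    "partial i (\<lambda>p. partial l (partial k (f t)) (\<phi> t \<tau> p)) p =
       (\<Sum>m\<in>UNIV. partial i (\<phi> t \<tau>) p $ m *\<^sub>R partial m (partial l (partial k (f t))) (\<phi> t \<tau> p))"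
    using partial_chain_C1[where G = "partial l (partial k (f t))" and \<gamma> = "\<phi> t \<tau>", OF f_partial3[OF tI]
        jointly_continuous_isCont[OF f_partial3_cont tI] flow1(2)[OF p t]] by blast+
qed

text \<open>The partial derivative of \<open>Df\<close> along the flow, as the chain rule gives it.
  In this explicit form its joint continuity and its next partial derivative can be read
  off.\<close>

definition matrix_partial :: "'n \<Rightarrow> real \<Rightarrow> real^'n \<Rightarrow> real^'n^'n" where
  "matrix_partial i t p = matrix_of_columns (\<lambda>k. \<Sum>l\<in>UNIV. partial i (\<phi> t \<tau>) p $ l *\<^sub>R partial l (partial k (f t)) (\<phi> t \<tau> p))"

lemma flow_derivative_matrix_partial:
  assumes "p \<in> flow_domain a b \<tau>" "t \<in> {a..b}"
  shows "has_partial i (flow_derivative_matrix \<tau> t) p"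
    "partial i (flow_derivative_matrix \<tau> t) p = matrix_partial i t p"
  unfolding matrix_partial_def partial_f_along_flow(2)[OF assms, symmetric]
  by (rule partial_matrix_of_columns partial_f_along_flow(1)[OF assms])+

lemma matrix_partial_continuous: "jointly_continuous_on {a..b} (flow_domain a b \<tau>) (matrix_partial i)"
  unfolding matrix_partial_def
  by (intro jointly_continuous_matrix_of_columns jointly_continuous_sum
      jointly_continuous_bilinear[OF bounded_bilinear_component_scaleR]
      flow_partial_continuous[OF \<tau>I \<tau>] along_flow f_partial2_cont)

lemma flow_derivative_matrix_partial_continuous:
  "jointly_continuous_on {a..b} (flow_domain a b \<tau>) (\<lambda>t. partial i (flow_derivative_matrix \<tau> t))"
  by (rule jointly_continuous_cong[OF matrix_partial_continuous[of i]]) (rule flow_derivative_matrix_partial(2))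

text \<open>The first variational equation has no forcing term and the constant initial value
  \<open>axis j 1\<close>. Differentiating its coefficient creates the forcing term of the
  second.\<close>

lemma flow_partial2:
  assumes p: "p \<in> flow_domain a b \<tau>"
  shows "partial i (partial j (\<phi> \<tau> \<tau>)) p = 0"
    "t \<in> {a..b} \<Longrightarrow> has_partial i (partial j (\<phi> t \<tau>)) p"
    "t \<in> {a..b} \<Longrightarrow> ((\<lambda>t. partial i (partial j (\<phi> t \<tau>)) p) has_vector_derivative
       flow_derivative_matrix \<tau> t p *v partial i (partial j (\<phi> t \<tau>)) p + matrix_partial i t p *v partial j (\<phi> t \<tau>) p)
       (at t within {a..b})"
proof -
  have z: "((\<lambda>t. partial j (\<phi> t \<tau>) p) has_vector_derivative
       flow_derivative_matrix \<tau> t p *v partial j (\<phi> t \<tau>) p + 0) (at t within {a..b})"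
    if "t \<in> {a..b}" "p \<in> flow_domain a b \<tau>" for t p
    using flow1(3)[OF that(2,1)] by simp
  note * = linear_ode_partial[OF open_flow_domain \<tau> flow_derivative_matrix_continuous[OF \<tau>I \<tau>] _ z flow1(1)
      flow_derivative_matrix_partial(1) flow_derivative_matrix_partial_continuous _ _ p]
  show "partial i (partial j (\<phi> \<tau> \<tau>)) p = 0"
    by (rule *(1)) (auto simp: partial_const)
  show "has_partial i (partial j (\<phi> t \<tau>)) p" if "t \<in> {a..b}"
    by (rule *(2)) (use that in \<open>auto simp: partial_const\<close>)
  show "((\<lambda>t. partial i (partial j (\<phi> t \<tau>)) p) has_vector_derivative
       flow_derivative_matrix \<tau> t p *v partial i (partial j (\<phi> t \<tau>)) p + matrix_partial i t p *v partial j (\<phi> t \<tau>) p)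
       (at t within {a..b})" if t: "t \<in> {a..b}"
  proof -
    have "((\<lambda>t. partial i (partial j (\<phi> t \<tau>)) p) has_vector_derivative
       flow_derivative_matrix \<tau> t p *v partial i (partial j (\<phi> t \<tau>)) p +
         (partial i (flow_derivative_matrix \<tau> t) p *v partial j (\<phi> t \<tau>) p + partial i (\<lambda>p. 0) p))
       (at t within {a..b})"
      by (rule *(3)) (use t in \<open>auto simp: partial_const\<close>)
    then show ?thesis by (simp add: partial_const flow_derivative_matrix_partial(2)[OF p t])
  qed
qed

lemma flow_partial2_continuous: "jointly_continuous_on {a..b} (flow_domain a b \<tau>) (\<lambda>t. partial i (partial j (\<phi> t \<tau>)))"
  by (rule linear_ode_jointly_continuous[OF open_flow_domain \<tau> flow_derivative_matrix_continuous[OF \<tau>I \<tau>]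
        jointly_continuous_bilinear[OF bounded_bilinear_matrix_vector_mult matrix_partial_continuous[of i] flow_partial_continuous[OF \<tau>I \<tau>, of j]]
        flow_partial2(3) flow_partial2(1)])

text \<open>The product rule applied to \<open>matrix_partial j\<close>: one summand differentiates
  the second partial derivatives of \<open>f\<close>, the other the first derivative of the
  flow.\<close>

definition matrix_partial2 :: "'n \<Rightarrow> 'n \<Rightarrow> real \<Rightarrow> real^'n \<Rightarrow> real^'n^'n" where
  "matrix_partial2 i j t p = matrix_of_columns (\<lambda>k. \<Sum>l\<in>UNIV.
     partial j (\<phi> t \<tau>) p $ l *\<^sub>R (\<Sum>m\<in>UNIV. partial i (\<phi> t \<tau>) p $ m *\<^sub>R partial m (partial l (partial k (f t))) (\<phi> t \<tau> p))
     + partial i (partial j (\<phi> t \<tau>)) p $ l *\<^sub>R partial l (partial k (f t)) (\<phi> t \<tau> p))"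

lemma matrix_partial_partial:
  assumes p: "p \<in> flow_domain a b \<tau>" and t: "t \<in> {a..b}"
  shows "has_partial i (matrix_partial j t) p" "partial i (matrix_partial j t) p = matrix_partial2 i j t p"
proof -
  have 1: "has_partial i (\<lambda>p. partial j (\<phi> t \<tau>) p $ l *\<^sub>R partial l (partial k (f t)) (\<phi> t \<tau> p)) p"
    "partial i (\<lambda>p. partial j (\<phi> t \<tau>) p $ l *\<^sub>R partial l (partial k (f t)) (\<phi> t \<tau> p)) p =
     partial j (\<phi> t \<tau>) p $ l *\<^sub>R (\<Sum>m\<in>UNIV. partial i (\<phi> t \<tau>) p $ m *\<^sub>R partial m (partial l (partial k (f t))) (\<phi> t \<tau> p))
     + partial i (partial j (\<phi> t \<tau>)) p $ l *\<^sub>R partial l (partial k (f t)) (\<phi> t \<tau> p)" for k l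
    unfolding partial_f_along_flow(4)[OF p t, symmetric]
    by (rule partial_bounded_bilinear[OF bounded_bilinear_component_scaleR] flow_partial2(2)[OF p t] partial_f_along_flow(3)[OF p t])+
  note 2 = partial_sum[OF finite 1(1)]
  have "matrix_partial j t = (\<lambda>p. matrix_of_columns (\<lambda>k. \<Sum>l\<in>UNIV. partial j (\<phi> t \<tau>) p $ l *\<^sub>R partial l (partial k (f t)) (\<phi> t \<tau> p)))"
    by (simp add: fun_eq_iff matrix_partial_def)
  then show "has_partial i (matrix_partial j t) p" "partial i (matrix_partial j t) p = matrix_partial2 i j t p"
    using partial_matrix_of_columns[OF 2(1)] unfolding matrix_partial2_def 1(2)[symmetric] by (simp_all add: 2(2))
qed

lemma matrix_partial2_continuous: "jointly_continuous_on {a..b} (flow_domain a b \<tau>) (matrix_partial2 i j)"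
  unfolding matrix_partial2_def
  by (intro jointly_continuous_matrix_of_columns jointly_continuous_sum jointly_continuous_add
      jointly_continuous_bilinear[OF bounded_bilinear_component_scaleR]
      flow_partial_continuous[OF \<tau>I \<tau>] flow_partial2_continuous along_flow f_partial2_cont f_partial3_cont)

text \<open>The same step applied to the second variational equation, with initial value
  \<open>0\<close>. The coefficient contributes one new term and its product-form forcing two, each
  again continuous.\<close>

lemma flow_partial3:
  assumes p: "p \<in> flow_domain a b \<tau>"
  shows "partial i (partial j (partial k (\<phi> \<tau> \<tau>))) p = 0"
    "t \<in> {a..b} \<Longrightarrow> has_partial i (partial j (partial k (\<phi> t \<tau>))) p"
    "t \<in> {a..b} \<Longrightarrow> ((\<lambda>t. partial i (partial j (partial k (\<phi> t \<tau>))) p) has_vector_derivative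
       flow_derivative_matrix \<tau> t p *v partial i (partial j (partial k (\<phi> t \<tau>))) p +
       (matrix_partial i t p *v partial j (partial k (\<phi> t \<tau>)) p +
        (matrix_partial j t p *v partial i (partial k (\<phi> t \<tau>)) p + matrix_partial2 i j t p *v partial k (\<phi> t \<tau>) p)))
       (at t within {a..b})"
proof -
  let ?g = "\<lambda>t p. matrix_partial j t p *v partial k (\<phi> t \<tau>) p"
  have g: "has_partial i (?g t) p"
    "partial i (?g t) p = matrix_partial j t p *v partial i (partial k (\<phi> t \<tau>)) p + matrix_partial2 i j t p *v partial k (\<phi> t \<tau>) p"
    if "t \<in> {a..b}" "p \<in> flow_domain a b \<tau>" for t p
    using partial_bounded_bilinear[OF bounded_bilinear_matrix_vector_mult matrix_partial_partial(1)[OF that(2,1)] flow_partial2(2)[OF that(2,1)]]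
    by (simp_all add: matrix_partial_partial(2)[OF that(2,1)])
  have gc: "jointly_continuous_on {a..b} (flow_domain a b \<tau>) ?g"
    by (intro jointly_continuous_bilinear[OF bounded_bilinear_matrix_vector_mult] matrix_partial_continuous flow_partial_continuous[OF \<tau>I \<tau>])
  have "jointly_continuous_on {a..b} (flow_domain a b \<tau>) (\<lambda>t p. matrix_partial j t p *v partial i (partial k (\<phi> t \<tau>)) p + matrix_partial2 i j t p *v partial k (\<phi> t \<tau>) p)"
    by (intro jointly_continuous_add jointly_continuous_bilinear[OF bounded_bilinear_matrix_vector_mult] matrix_partial_continuous
        flow_partial_continuous[OF \<tau>I \<tau>] flow_partial2_continuous matrix_partial2_continuous)
  then have gic: "jointly_continuous_on {a..b} (flow_domain a b \<tau>) (\<lambda>t. partial i (?g t))"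
    by (rule jointly_continuous_cong) (rule g(2))
  note * = linear_ode_partial[OF open_flow_domain \<tau> flow_derivative_matrix_continuous[OF \<tau>I \<tau>] gc flow_partial2(3) flow_partial2(1)
      flow_derivative_matrix_partial(1) flow_derivative_matrix_partial_continuous g(1) gic p]
  show "partial i (partial j (partial k (\<phi> \<tau> \<tau>))) p = 0"
    by (rule *(1))
  show "has_partial i (partial j (partial k (\<phi> t \<tau>))) p" if "t \<in> {a..b}"
    by (rule *(2)) (use that in auto)
  show "((\<lambda>t. partial i (partial j (partial k (\<phi> t \<tau>))) p) has_vector_derivative
       flow_derivative_matrix \<tau> t p *v partial i (partial j (partial k (\<phi> t \<tau>))) p +
       (matrix_partial i t p *v partial j (partial k (\<phi> t \<tau>)) p +
        (matrix_partial j t p *v partial i (partial k (\<phi> t \<tau>)) p + matrix_partial2 i j t p *v partial k (\<phi> t \<tau>) p)))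
       (at t within {a..b})" if t: "t \<in> {a..b}"
    unfolding g(2)[OF t p, symmetric] flow_derivative_matrix_partial(2)[OF p t, of i, symmetric]
    by (rule *(3)) (use t in auto)
qed

end

end

section \<open>Kronecker products\<close>

lemma bounded_bilinear_kron_vec: "bounded_bilinear (kron_vec :: real^'a \<Rightarrow> real^'b \<Rightarrow> _)"
  by (intro bilinear_conv_bounded_bilinear[THEN iffD1])
     (auto simp: bilinear_def kron_vec_def vec_eq_iff algebra_simps intro!: linearI)

lemma bounded_bilinear_kron_mat: "bounded_bilinear (kron_mat :: real^'c^'r \<Rightarrow> real^'d^'s \<Rightarrow> _)"
  by (intro bilinear_conv_bounded_bilinear[THEN iffD1])
     (auto simp: bilinear_def kron_mat_def vec_eq_iff algebra_simps intro!: linearI)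

interpretation kron_vec: bounded_bilinear "kron_vec :: real^'a \<Rightarrow> real^'b \<Rightarrow> _"
  by (rule bounded_bilinear_kron_vec)

interpretation kron_mat: bounded_bilinear "kron_mat :: real^'c^'r \<Rightarrow> real^'d^'s \<Rightarrow> _"
  by (rule bounded_bilinear_kron_mat)

lemma sum_UNIV_prod: "(\<Sum>p\<in>UNIV. g p) = (\<Sum>i\<in>UNIV. \<Sum>j\<in>UNIV. g (i, j))"
  for g :: "'a::finite \<times> 'b::finite \<Rightarrow> 'c::comm_monoid_add"
  unfolding UNIV_Times_UNIV[symmetric] sum.cartesian_product by simp

lemma kron_mat_kron_vec: "(A \<otimes>\<^sub>m B) *v (x \<otimes>\<^sub>v y) = (A *v x) \<otimes>\<^sub>v (B *v y)"
  by (simp add: vec_eq_iff matrix_vector_mult_def kron_mat_def kron_vec_def sum_UNIV_prod sum_product ac_simps)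

lemma kron_mat_mult: "(A \<otimes>\<^sub>m B) ** (C \<otimes>\<^sub>m D) = (A ** C) \<otimes>\<^sub>m (B ** D)"
  by (simp add: vec_eq_iff matrix_matrix_mult_def kron_mat_def sum_UNIV_prod sum_product ac_simps)

lemma matrix_add_rdistrib: "(A + B) ** C = A ** C + B ** C" for A :: "real^'n^'m"
  by (simp add: vec_eq_iff matrix_matrix_mult_def sum.distrib distrib_right)

lemma kron_mat_one: "mat 1 \<otimes>\<^sub>m mat 1 = (mat 1 :: real^('a::finite \<times> 'b::finite)^('a \<times> 'b))"
  by (auto simp: vec_eq_iff kron_mat_def mat_def)

lemma invertible_kron_mat:
  fixes A :: "real^'a^'a" and B :: "real^'b^'b"
  assumes "invertible A" "invertible B"
  shows "invertible (A \<otimes>\<^sub>m B)"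
  using assms by (auto simp: invertible_def) (metis kron_mat_mult kron_mat_one)

lemma reindex_cols_mult:
  assumes "bij \<sigma>"
  shows "reindex_cols \<sigma> A *v reindex \<sigma> w = A *v w"
proof -
  have "(\<Sum>j\<in>UNIV. A $ r $ \<sigma> j * w $ \<sigma> j) = (\<Sum>i\<in>UNIV. A $ r $ i * w $ i)" for r
    by (rule sum.reindex_bij_betw[where g = "\<lambda>i. A $ r $ i * w $ i"]) (use assms in simp)
  then show ?thesis
    by (simp add: vec_eq_iff reindex_cols_def reindex_def matrix_vector_mult_def)
qed

lemma bij_assoc: "bij assoc3" "bij assoc4"
  unfolding bij_def inj_def surj_def assoc3_def assoc4_def by auto

lemma reindex_assoc3: "reindex assoc3 ((x \<otimes>\<^sub>v y) \<otimes>\<^sub>v z) = x \<otimes>\<^sub>v y \<otimes>\<^sub>v z"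
  by (simp add: vec_eq_iff reindex_def assoc3_def kron_vec_def split_def)

lemma reindex_assoc4: "reindex assoc4 ((x \<otimes>\<^sub>v y \<otimes>\<^sub>v z) \<otimes>\<^sub>v w) = x \<otimes>\<^sub>v y \<otimes>\<^sub>v z \<otimes>\<^sub>v w"
  by (simp add: vec_eq_iff reindex_def assoc4_def kron_vec_def split_def)

text \<open>Re-bracketing the columns of a matrix and the entries of a vector by the same bijection
  leaves their product unchanged. This transfers the mixed product rule to powers bracketed to the
  right.\<close>

lemma reindexed_kron_mult:
  "reindex_cols assoc3 (A \<otimes>\<^sub>m B) *v (x \<otimes>\<^sub>v y \<otimes>\<^sub>v z) = (A *v (x \<otimes>\<^sub>v y)) \<otimes>\<^sub>v (B *v z)"
  "reindex_cols assoc4 (C \<otimes>\<^sub>m B) *v (x \<otimes>\<^sub>v y \<otimes>\<^sub>v w \<otimes>\<^sub>v z) = (C *v (x \<otimes>\<^sub>v y \<otimes>\<^sub>v w)) \<otimes>\<^sub>v (B *v z)"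
  by (simp_all only: reindex_assoc3[symmetric, of x y z] reindex_assoc4[symmetric] reindex_cols_mult bij_assoc kron_mat_kron_vec)

lemma matrix_mult_inv_right:
  assumes "invertible A"
  shows "A ** matrix_inv A = mat 1"
  using someI_ex[OF assms[unfolded invertible_def]] unfolding matrix_inv_def by blast

text \<open>Cramer's rule makes \<open>matrix_inv A *v b\<close> a rational function of the entries.\<close>

lemma continuous_on_matrix_inv_mult:
  fixes A :: "real \<Rightarrow> real^'k^'k"
  assumes "continuous_on S A" "continuous_on S b" "\<And>s. s \<in> S \<Longrightarrow> invertible (A s)"
  shows "continuous_on S (\<lambda>s. matrix_inv (A s) *v b s)"
proof -
  have det: "det (A s) \<noteq> 0" if "s \<in> S" for s
    using assms(3)[OF that] by (simp add: invertible_det_nz)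
  have Ac: "continuous_on S (\<lambda>s. A s $ i $ j)" for i j
    by (intro continuous_on_component assms)
  have bc: "continuous_on S (\<lambda>s. b s $ i)" for i
    by (intro continuous_on_component assms)
  have dc: "continuous_on S (\<lambda>s. det (A s))"
    unfolding det_def by (intro continuous_intros Ac)
  have nc: "continuous_on S (\<lambda>s. det (\<chi> i j. if j = k then b s $ i else A s $ i $ j))" for k
  proof -
    have "continuous_on S (\<lambda>s. if j = k then b s $ i else A s $ i $ j)" for i j
      by (cases "j = k") (auto intro: Ac bc)
    then show ?thesis unfolding det_def vec_lambda_beta by (intro continuous_intros)
  qed
  have "continuous_on S (\<lambda>s. \<chi> k. det (\<chi> i j. if j = k then b s $ i else A s $ i $ j) / det (A s))"
    using det by (intro continuous_on_vec_lambda continuous_on_divide nc dc) auto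
  moreover have "matrix_inv (A s) *v b s = (\<chi> k. det (\<chi> i j. if j = k then b s $ i else A s $ i $ j) / det (A s))"
    if s: "s \<in> S" for s
  proof -
    have "A s *v (matrix_inv (A s) *v b s) = b s"
      by (simp add: matrix_vector_mul_assoc matrix_mult_inv_right[OF assms(3)[OF s]])
    then show ?thesis using cramer[OF det[OF s]] by blast
  qed
  ultimately show ?thesis by (simp cong: continuous_on_cong)
qed

text \<open>If \<open>X s\<close> kills \<open>w\<close>, then \<open>X r *v w\<close> is a solution
  vanishing at \<open>r = s\<close>, hence also at \<open>\<tau>\<close>, where it equals
  \<open>w\<close>.\<close>

lemma fundamental_matrix_invertible:
  fixes A X :: "real \<Rightarrow> real^'n^'n"
  assumes A: "continuous_on {a..b} A" and \<tau>: "\<tau> \<in> {a..b}" "s \<in> {a..b}" and X\<tau>: "X \<tau> = mat 1"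
    and X: "\<And>s. s \<in> {a..b} \<Longrightarrow> (X has_vector_derivative A s ** X s) (at s within {a..b})"
  shows "invertible (X s)"
proof -
  obtain B where B: "0 \<le> B" "\<And>t. t \<in> {a..b} \<Longrightarrow> norm (A t) \<le> B"
    using continuous_on_Icc_bounded[OF A] by blast
  obtain K where K: "0 \<le> K" "\<And>t v. t \<in> {a..b} \<Longrightarrow> norm (A t *v v) \<le> K * norm v"
    using matrix_vector_mult_bound[of "{a..b}" A B] B(2) by blast
  have "w = 0" if w: "X s *v w = 0" for w
  proof -
    have "(\<lambda>r. X r *v w) \<tau> = 0"
    proof (rule linear_ode_unique[where u = "\<lambda>r. X r *v w" and A = "\<lambda>r. (*v) (A r)", OF _ K(2) \<tau>(2,1) w])
      fix r assume "r \<in> {a..b}"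
      from bounded_linear.has_vector_derivative[OF bounded_bilinear.bounded_linear_left[OF bounded_bilinear_matrix_vector_mult, of w] X[OF this]]
      show "((\<lambda>r. X r *v w) has_vector_derivative A r *v (X r *v w)) (at r within {a..b})"
        by (simp add: matrix_vector_mul_assoc)
    qed
    then show "w = 0" by (simp add: X\<tau>)
  qed
  then show ?thesis
    by (simp add: invertible_left_inverse matrix_left_invertible_ker)
qed

text \<open>Both sides solve the linear equation \<open>y' = (A \<otimes> E + E \<otimes> A) y + F\<close> with the same forcing
  term \<open>F\<close> and vanish at \<open>\<tau>\<close>. The forcing term of the left-hand side contains
  \<open>-3 (v \<otimes> P u\<^sup>2 + P u\<^sup>2 \<otimes> v) + 3 (P (v \<otimes> u) \<otimes> u + u \<otimes> P (u \<otimes> v))\<close>, which is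
  \<open>3 (P \<otimes> E - E \<otimes> P) (v \<otimes> u\<^sup>2 - u\<^sup>2 \<otimes> v)\<close>.\<close>

lemma kron_variation_of_constants:
  fixes A X :: "real \<Rightarrow> real^'n^'n" and P :: "real \<Rightarrow> real^('n \<times> 'n)^'n" and Q :: "real \<Rightarrow> real^('n \<times> 'n \<times> 'n)^'n"
    and u v w :: "real \<Rightarrow> real^'n"
  assumes cont: "continuous_on {a..b} A" "continuous_on {a..b} P" "continuous_on {a..b} Q"
    and \<tau>: "\<tau> \<in> {a..b}" and t: "t \<in> {a..b}"
    and init: "X \<tau> = mat 1" "v \<tau> = 0" "w \<tau> = 0"
    and X: "\<And>s. s \<in> {a..b} \<Longrightarrow> (X has_vector_derivative A s ** X s) (at s within {a..b})"
    and u: "\<And>s. s \<in> {a..b} \<Longrightarrow> (u has_vector_derivative A s *v u s) (at s within {a..b})"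
    and v: "\<And>s. s \<in> {a..b} \<Longrightarrow> (v has_vector_derivative A s *v v s + P s *v (u s \<otimes>\<^sub>v u s)) (at s within {a..b})"
    and w: "\<And>s. s \<in> {a..b} \<Longrightarrow> (w has_vector_derivative
       A s *v w s + (3 *\<^sub>R (P s *v (v s \<otimes>\<^sub>v u s)) + Q s *v (u s \<otimes>\<^sub>v u s \<otimes>\<^sub>v u s))) (at s within {a..b})"
    and P: "\<And>s x y. s \<in> {a..b} \<Longrightarrow> P s *v (x \<otimes>\<^sub>v y) = P s *v (y \<otimes>\<^sub>v x)"
  shows "w t \<otimes>\<^sub>v u t + u t \<otimes>\<^sub>v w t - 3 *\<^sub>R (v t \<otimes>\<^sub>v v t)
       = (X t \<otimes>\<^sub>m X t) *v
         ((LBINT s=\<tau>..t. matrix_inv (X s \<otimes>\<^sub>m X s) *v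
             ((reindex_cols assoc4 (Q s \<otimes>\<^sub>m (mat 1 :: real^'n^'n)) + (mat 1 :: real^'n^'n) \<otimes>\<^sub>m Q s) *v
              (u s \<otimes>\<^sub>v u s \<otimes>\<^sub>v u s \<otimes>\<^sub>v u s)))
          + 3 *\<^sub>R
          (LBINT s=\<tau>..t. matrix_inv (X s \<otimes>\<^sub>m X s) *v
             ((reindex_cols assoc3 (P s \<otimes>\<^sub>m (mat 1 :: real^'n^'n)) - (mat 1 :: real^'n^'n) \<otimes>\<^sub>m P s) *v
              (v s \<otimes>\<^sub>v u s \<otimes>\<^sub>v u s - reindex assoc3 ((u s \<otimes>\<^sub>v u s) \<otimes>\<^sub>v v s)))))"
proof -
  let ?T = "{a..b}"
  let ?E = "mat 1 :: real^'n^'n"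
  let ?M = "\<lambda>s. X s \<otimes>\<^sub>m X s"
  let ?A = "\<lambda>s. A s \<otimes>\<^sub>m ?E + ?E \<otimes>\<^sub>m A s"
  define F1 where "F1 = (\<lambda>s. (Q s *v (u s \<otimes>\<^sub>v u s \<otimes>\<^sub>v u s)) \<otimes>\<^sub>v u s + u s \<otimes>\<^sub>v (Q s *v (u s \<otimes>\<^sub>v u s \<otimes>\<^sub>v u s)))"
  \<comment> \<open>The four terms of the expanded product: \<open>P \<otimes> E\<close> acts on the
    first two factors, \<open>E \<otimes> P\<close> on the last two. The last term thus contains
    \<open>P\<close> on \<open>u \<otimes> v\<close>, in this order.\<close>
  define F2 where "F2 = (\<lambda>s. (P s *v (v s \<otimes>\<^sub>v u s)) \<otimes>\<^sub>v u s - v s \<otimes>\<^sub>v (P s *v (u s \<otimes>\<^sub>v u s))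
      - ((P s *v (u s \<otimes>\<^sub>v u s)) \<otimes>\<^sub>v v s - u s \<otimes>\<^sub>v (P s *v (u s \<otimes>\<^sub>v v s))))"
  have F1: "(reindex_cols assoc4 (Q s \<otimes>\<^sub>m ?E) + ?E \<otimes>\<^sub>m Q s) *v (u s \<otimes>\<^sub>v u s \<otimes>\<^sub>v u s \<otimes>\<^sub>v u s) = F1 s" for s
    by (simp add: F1_def matrix_vector_mult_add_rdistrib reindexed_kron_mult kron_mat_kron_vec)
  have F2: "(reindex_cols assoc3 (P s \<otimes>\<^sub>m ?E) - ?E \<otimes>\<^sub>m P s) *v
              (v s \<otimes>\<^sub>v u s \<otimes>\<^sub>v u s - reindex assoc3 ((u s \<otimes>\<^sub>v u s) \<otimes>\<^sub>v v s)) = F2 s" for s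
    by (simp add: F2_def matrix_vector_mult_diff_rdistrib matrix_vector_mult_diff_distrib
        reindex_assoc3 reindexed_kron_mult kron_mat_kron_vec)
  have cu: "continuous_on ?T u" and cv: "continuous_on ?T v" and cX: "continuous_on ?T X"
    by (rule continuous_on_vector_derivative, erule u v X)+
  have cM: "continuous_on ?T ?M" by (intro kron_mat.continuous_on cX)
  note mv = bounded_bilinear.continuous_on[OF bounded_bilinear_matrix_vector_mult]
  have cF1: "continuous_on ?T F1" and cF2: "continuous_on ?T F2"
    unfolding F1_def F2_def
    by (intro continuous_on_add continuous_on_diff kron_vec.continuous_on mv cont cu cv)+
  have inv: "invertible (?M s)" if "s \<in> ?T" for s
    by (intro invertible_kron_mat fundamental_matrix_invertible[OF cont(1) \<tau> that init(1) X])
  define g1 where "g1 = (\<lambda>s. matrix_inv (?M s) *v F1 s)"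
  define g2 where "g2 = (\<lambda>s. matrix_inv (?M s) *v F2 s)"
  have cg: "continuous_on ?T g1" "continuous_on ?T g2"
    unfolding g1_def g2_def by (intro continuous_on_matrix_inv_mult cM cF1 cF2 inv; assumption)+
  \<comment> \<open>The interval integral is oriented, so the fundamental theorem covers upper
    limits on both sides of \<open>\<tau>\<close>.\<close>
  define H where "H = (\<lambda>r::real. (LBINT s=\<tau>..r. g1 s) + 3 *\<^sub>R (LBINT s=\<tau>..r. g2 s))"
  define L where "L = (\<lambda>s. w s \<otimes>\<^sub>v u s + u s \<otimes>\<^sub>v w s - 3 *\<^sub>R (v s \<otimes>\<^sub>v v s))"
  have H: "(H has_vector_derivative g1 s + 3 *\<^sub>R g2 s) (at s within ?T)" if s: "s \<in> ?T" for s
    unfolding H_def using \<tau> s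
    by (intro has_vector_derivative_add bounded_linear.has_vector_derivative[OF bounded_linear_scaleR_right]
        interval_integral_FTC2 cg) auto
  have M: "(?M has_vector_derivative ?A s ** ?M s) (at s within ?T)" if s: "s \<in> ?T" for s
    using kron_mat.has_vector_derivative[OF X[OF s] X[OF s]]
    by (simp add: matrix_add_rdistrib kron_mat_mult add.commute)
  have MH: "((\<lambda>s. ?M s *v H s) has_vector_derivative ?A s *v (?M s *v H s) + (F1 s + 3 *\<^sub>R F2 s)) (at s within ?T)"
    if s: "s \<in> ?T" for s
  proof -
    have "?M s *v g1 s = F1 s" "?M s *v g2 s = F2 s"
      by (simp_all add: g1_def g2_def matrix_vector_mul_assoc matrix_mult_inv_right[OF inv[OF s]])
    then have "?M s *v (g1 s + 3 *\<^sub>R g2 s) + (?A s ** ?M s) *v H s = ?A s *v (?M s *v H s) + (F1 s + 3 *\<^sub>R F2 s)"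
      by (simp add: matrix_vector_right_distrib matrix_vector_mult_scaleR matrix_vector_mul_assoc add.commute)
    then show ?thesis
      using bounded_bilinear.has_vector_derivative[OF bounded_bilinear_matrix_vector_mult M[OF s] H[OF s]] by simp
  qed
  have L: "(L has_vector_derivative ?A s *v L s + (F1 s + 3 *\<^sub>R F2 s)) (at s within ?T)" if s: "s \<in> ?T" for s
  proof -
    let ?R = "3 *\<^sub>R (P s *v (v s \<otimes>\<^sub>v u s)) + Q s *v (u s \<otimes>\<^sub>v u s \<otimes>\<^sub>v u s)" and ?S = "P s *v (u s \<otimes>\<^sub>v u s)"
    have "(L has_vector_derivative
       (w s \<otimes>\<^sub>v (A s *v u s) + (A s *v w s + ?R) \<otimes>\<^sub>v u s) + (u s \<otimes>\<^sub>v (A s *v w s + ?R) + (A s *v u s) \<otimes>\<^sub>v w s)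
       - 3 *\<^sub>R (v s \<otimes>\<^sub>v (A s *v v s + ?S) + (A s *v v s + ?S) \<otimes>\<^sub>v v s)) (at s within ?T)"
      unfolding L_def
      by (intro has_vector_derivative_add has_vector_derivative_diff
          bounded_linear.has_vector_derivative[OF bounded_linear_scaleR_right]
          kron_vec.has_vector_derivative u[OF s] v[OF s] w[OF s])
    moreover have "(w s \<otimes>\<^sub>v (A s *v u s) + (A s *v w s + ?R) \<otimes>\<^sub>v u s) + (u s \<otimes>\<^sub>v (A s *v w s + ?R) + (A s *v u s) \<otimes>\<^sub>v w s)
       - 3 *\<^sub>R (v s \<otimes>\<^sub>v (A s *v v s + ?S) + (A s *v v s + ?S) \<otimes>\<^sub>v v s) = ?A s *v L s + (F1 s + 3 *\<^sub>R F2 s)"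
      \<comment> \<open>Symmetry of \<open>P\<close> enters here: it turns \<open>P\<close> on
        \<open>u \<otimes> v\<close> into \<open>P\<close> on \<open>v \<otimes> u\<close>, the form
        in which the equation for \<open>w\<close> produces it.\<close>
      unfolding L_def F1_def F2_def P[OF s, of "u s" "v s"]
      by (simp add: matrix_vector_mult_add_rdistrib matrix_vector_right_distrib matrix_vector_mult_diff_distrib
          matrix_vector_mult_scaleR kron_mat_kron_vec kron_vec.add_left kron_vec.add_right
          kron_vec.scaleR_left kron_vec.scaleR_right algebra_simps)
    ultimately show ?thesis by simp
  qed
  have cA: "continuous_on ?T ?A" by (intro continuous_on_add kron_mat.continuous_on cont continuous_on_const)
  obtain B where B: "0 \<le> B" "\<And>t. t \<in> ?T \<Longrightarrow> norm (?A t) \<le> B"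
    using continuous_on_Icc_bounded[OF cA] by blast
  obtain K where K: "0 \<le> K" "\<And>t x. t \<in> ?T \<Longrightarrow> norm (?A t *v x) \<le> K * norm x"
    using matrix_vector_mult_bound[of ?T ?A B] B(2) by blast
  have "(\<lambda>s. L s - ?M s *v H s) t = 0"
  proof (rule linear_ode_unique[where A = "\<lambda>s. (*v) (?A s)", OF _ K(2) \<tau> t])
    show "((\<lambda>s. L s - ?M s *v H s) has_vector_derivative ?A s *v (L s - ?M s *v H s)) (at s within ?T)"
      if s: "s \<in> ?T" for s
      using has_vector_derivative_diff[OF L[OF s] MH[OF s]] by (simp add: matrix_vector_mult_diff_distrib)
    show "L \<tau> - ?M \<tau> *v H \<tau> = 0"
      by (simp add: L_def H_def init kron_vec.zero_left kron_vec.zero_right)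
  qed
  then have "L t = ?M t *v H t" by simp
  then show ?thesis unfolding F1 F2 by (simp add: L_def H_def g1_def g2_def)
qed

section \<open>Derivative matrices of higher order by columns\<close>

lemma D2_columns:
  assumes "\<And>i k. has_partial i (partial k g) x"
  shows "D2 g x = matrix_of_columns (\<lambda>(i, k). partial i (partial k g) x)"
proof -
  have "D1 g = (\<lambda>y. matrix_of_columns (\<lambda>k. partial k g y))" by (simp add: fun_eq_iff D_vec_columns)
  then show ?thesis using D_mat_columns[of "\<lambda>k. partial k g" x, OF assms] by simp
qed

text \<open>Second partial derivatives are required on a neighbourhood, since \<open>D2 g\<close> is
  itself differentiated there; third ones only at the point. For the flow, the neighbourhood is
  \<open>flow_domain\<close>.\<close>

lemma D3_columns:
  assumes U: "open U" "x \<in> U" and p2: "\<And>y i k. y \<in> U \<Longrightarrow> has_partial i (partial k g) y"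
    and p3: "\<And>i j k. has_partial i (partial j (partial k g)) x"
  shows "D3 g x = matrix_of_columns (\<lambda>(i, j, k). partial i (partial j (partial k g)) x)"
proof -
  let ?m = "\<lambda>c. partial (fst c) (partial (snd c) g)"
  have "partial i (D2 g) x = partial i (\<lambda>y. matrix_of_columns (\<lambda>c. ?m c y)) x" for i
    by (rule partial_cong_open[OF U]) (simp add: D2_columns[OF p2] split_def)
  then have "D3 g x = D_mat (\<lambda>y. matrix_of_columns (\<lambda>c. ?m c y)) x"
    by (simp add: D_mat_def)
  also have "\<dots> = matrix_of_columns (\<lambda>(i, c). partial i (?m c) x)"
    by (rule D_mat_columns[OF p3])
  finally show ?thesis by (simp add: split_def)
qed

lemma matrix_of_columns_pair_mult:
  "matrix_of_columns (\<lambda>(i, k). m i k) *v (x \<otimes>\<^sub>v y) = (\<Sum>i\<in>UNIV. \<Sum>k\<in>UNIV. (x $ i * y $ k) *\<^sub>R m i k)"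
  by (simp add: matrix_of_columns_mult sum_UNIV_prod kron_vec_def)

lemma matrix_of_columns_triple_mult:
  "matrix_of_columns (\<lambda>(i, j, k). m i j k) *v (x \<otimes>\<^sub>v y \<otimes>\<^sub>v z) =
    (\<Sum>i\<in>UNIV. \<Sum>j\<in>UNIV. \<Sum>k\<in>UNIV. (x $ i * y $ j * z $ k) *\<^sub>R m i j k)"
  by (simp add: matrix_of_columns_mult sum_UNIV_prod kron_vec_def mult.assoc)

section \<open>The equations for the directional derivatives\<close>

lemma matrix_mult_columns: "A ** matrix_of_columns m = matrix_of_columns (\<lambda>k. A *v m k)"
  by (simp add: vec_eq_iff matrix_matrix_mult_def matrix_vector_mult_def matrix_of_columns_def)

text \<open>Here \<open>x\<close> and \<open>y\<close> stand for first and second partial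
  derivatives of the flow. The two expansions of \<open>u \<otimes>\<^sub>v v\<close> match the two
  index patterns that arise when the third derivative is differentiated in a fixed order.\<close>

lemma kron_vec_of_sums:
  fixes h :: "'n::finite \<Rightarrow> real" and x :: "'n \<Rightarrow> real^'m" and y :: "'n \<Rightarrow> 'n \<Rightarrow> real^'m"
  defines "u \<equiv> \<Sum>i\<in>UNIV. h i *\<^sub>R x i" and "v \<equiv> \<Sum>i\<in>UNIV. \<Sum>j\<in>UNIV. (h i * h j) *\<^sub>R y i j"
  shows "u \<otimes>\<^sub>v u = (\<Sum>i\<in>UNIV. \<Sum>j\<in>UNIV. (h i * h j) *\<^sub>R (x i \<otimes>\<^sub>v x j))"
    and "u \<otimes>\<^sub>v u \<otimes>\<^sub>v u = (\<Sum>i\<in>UNIV. \<Sum>j\<in>UNIV. \<Sum>k\<in>UNIV. (h i * h j * h k) *\<^sub>R (x i \<otimes>\<^sub>v x j \<otimes>\<^sub>v x k))"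
    and "u \<otimes>\<^sub>v v = (\<Sum>i\<in>UNIV. \<Sum>j\<in>UNIV. \<Sum>k\<in>UNIV. (h i * h j * h k) *\<^sub>R (x i \<otimes>\<^sub>v y j k))"
    and "u \<otimes>\<^sub>v v = (\<Sum>i\<in>UNIV. \<Sum>j\<in>UNIV. \<Sum>k\<in>UNIV. (h i * h j * h k) *\<^sub>R (x j \<otimes>\<^sub>v y i k))"
    and "v \<otimes>\<^sub>v u = (\<Sum>i\<in>UNIV. \<Sum>j\<in>UNIV. \<Sum>k\<in>UNIV. (h i * h j * h k) *\<^sub>R (y i j \<otimes>\<^sub>v x k))"
proof -
  note l = kron_vec.sum_left and r = kron_vec.sum_right and s = kron_vec.scaleR_left kron_vec.scaleR_right
  show "u \<otimes>\<^sub>v u = (\<Sum>i\<in>UNIV. \<Sum>j\<in>UNIV. (h i * h j) *\<^sub>R (x i \<otimes>\<^sub>v x j))"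
    unfolding u_def by (simp only: l, simp only: r, simp add: s mult.commute)
  show "u \<otimes>\<^sub>v u \<otimes>\<^sub>v u = (\<Sum>i\<in>UNIV. \<Sum>j\<in>UNIV. \<Sum>k\<in>UNIV. (h i * h j * h k) *\<^sub>R (x i \<otimes>\<^sub>v x j \<otimes>\<^sub>v x k))"
    unfolding u_def by (simp only: l, simp only: r, simp add: s ac_simps)
  show 1: "u \<otimes>\<^sub>v v = (\<Sum>i\<in>UNIV. \<Sum>j\<in>UNIV. \<Sum>k\<in>UNIV. (h i * h j * h k) *\<^sub>R (x i \<otimes>\<^sub>v y j k))"
    unfolding u_def v_def by (simp only: l, simp only: r, simp add: s ac_simps)
  show "u \<otimes>\<^sub>v v = (\<Sum>i\<in>UNIV. \<Sum>j\<in>UNIV. \<Sum>k\<in>UNIV. (h i * h j * h k) *\<^sub>R (x j \<otimes>\<^sub>v y i k))"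
    \<comment> \<open>The weight \<open>h i * h j * h k\<close> is symmetric, so renaming the first
      two summation indices changes nothing.\<close>
    unfolding 1 by (subst sum.swap) (simp add: ac_simps)
  show "v \<otimes>\<^sub>v u = (\<Sum>i\<in>UNIV. \<Sum>j\<in>UNIV. \<Sum>k\<in>UNIV. (h i * h j * h k) *\<^sub>R (y i j \<otimes>\<^sub>v x k))"
    unfolding u_def v_def by (simp only: l, simp only: r, simp add: s ac_simps)
qed

lemma matrix_vector_mult_sum: "A *v (\<Sum>i\<in>S. g i) = (\<Sum>i\<in>S. A *v g i)" for A :: "real^'n^'m"
  by (rule linear_sum[OF matrix_vector_mul_linear])

context C3_flow
begin

lemma D2_f_mult:
  assumes "t \<in> I"
  shows "D2 (f t) x *v (v \<otimes>\<^sub>v w) = (\<Sum>l\<in>UNIV. \<Sum>k\<in>UNIV. (v $ l * w $ k) *\<^sub>R partial l (partial k (f t)) x)"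
  by (simp add: D2_columns[OF f_partial2[OF assms]] matrix_of_columns_pair_mult)

lemma D2_f_symmetric:
  assumes t: "t \<in> I"
  shows "D2 (f t) x *v (v \<otimes>\<^sub>v w) = D2 (f t) x *v (w \<otimes>\<^sub>v v)"
proof -
  have "partial l (partial k (f t)) x = partial k (partial l (f t)) x" for k l
    by (rule partials_commute[OF f_partial[OF t] f_partial2[OF t] jointly_continuous_isCont[OF f_partial2_cont t]])
  then show ?thesis
    unfolding D2_f_mult[OF t] by (subst sum.swap) (simp add: mult.commute)
qed

lemma D3_f_columns:
  assumes "t \<in> I"
  shows "D3 (f t) x = matrix_of_columns (\<lambda>(m, l, k). partial m (partial l (partial k (f t))) x)"
  by (rule D3_columns[OF open_UNIV UNIV_I f_partial2[OF assms] f_partial3[OF assms]])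

context
  fixes a b \<tau> :: real and p h :: "real^'n"
  assumes \<tau>I: "\<tau> \<in> I" and \<tau>: "\<tau> \<in> {a..b}" and p: "p \<in> flow_domain a b \<tau>"
begin

lemma time_in_I: "s \<in> {a..b} \<Longrightarrow> s \<in> I"
  using time_subset[OF \<tau>I \<tau> p] by blast

text \<open>The direction of the outer differentiation is the block index of \<open>D2\<close>,
  hence the left Kronecker factor; the matrix column becomes the right one.\<close>

lemma matrix_partial_mult:
  assumes s: "s \<in> {a..b}"
  shows "matrix_partial \<tau> i s p *v x = D2 (f s) (\<phi> s \<tau> p) *v (partial i (\<phi> s \<tau>) p \<otimes>\<^sub>v x)"
proof -
  have "matrix_partial \<tau> i s p *v x = (\<Sum>k\<in>UNIV. \<Sum>l\<in>UNIV. (partial i (\<phi> s \<tau>) p $ l * x $ k) *\<^sub>R partial l (partial k (f s)) (\<phi> s \<tau> p))"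
    by (simp add: matrix_partial_def[OF \<tau>I \<tau>] matrix_of_columns_mult scaleR_sum_right mult.commute)
  then show ?thesis unfolding D2_f_mult[OF time_in_I[OF s]] by (subst sum.swap) simp
qed

lemma matrix_partial2_mult:
  assumes s: "s \<in> {a..b}"
  shows "matrix_partial2 \<tau> i j s p *v x =
    D3 (f s) (\<phi> s \<tau> p) *v (partial i (\<phi> s \<tau>) p \<otimes>\<^sub>v partial j (\<phi> s \<tau>) p \<otimes>\<^sub>v x) +
    D2 (f s) (\<phi> s \<tau> p) *v (partial i (partial j (\<phi> s \<tau>)) p \<otimes>\<^sub>v x)"
proof -
  let ?i = "partial i (\<phi> s \<tau>) p" and ?j = "partial j (\<phi> s \<tau>) p" and ?ij = "partial i (partial j (\<phi> s \<tau>)) p"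
  let ?f = "\<lambda>l k. partial l (partial k (f s)) (\<phi> s \<tau> p)" and ?g = "\<lambda>m l k. partial m (partial l (partial k (f s))) (\<phi> s \<tau> p)"
  have "matrix_partial2 \<tau> i j s p *v x =
     (\<Sum>k\<in>UNIV. \<Sum>l\<in>UNIV. \<Sum>m\<in>UNIV. (?i $ m * ?j $ l * x $ k) *\<^sub>R ?g m l k) + (\<Sum>k\<in>UNIV. \<Sum>l\<in>UNIV. (?ij $ l * x $ k) *\<^sub>R ?f l k)"
    by (simp add: matrix_partial2_def[OF \<tau>I \<tau>] matrix_of_columns_mult scaleR_sum_right scaleR_add_right sum.distrib ac_simps)
  also have "(\<Sum>k\<in>UNIV. \<Sum>l\<in>UNIV. (?ij $ l * x $ k) *\<^sub>R ?f l k) = D2 (f s) (\<phi> s \<tau> p) *v (?ij \<otimes>\<^sub>v x)"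
    unfolding D2_f_mult[OF time_in_I[OF s]] by (rule sum.swap)
  also have "(\<Sum>k\<in>UNIV. \<Sum>l\<in>UNIV. \<Sum>m\<in>UNIV. (?i $ m * ?j $ l * x $ k) *\<^sub>R ?g m l k) =
     (\<Sum>l\<in>UNIV. \<Sum>k\<in>UNIV. \<Sum>m\<in>UNIV. (?i $ m * ?j $ l * x $ k) *\<^sub>R ?g m l k)"
    by (rule sum.swap)
  also have "\<dots> = (\<Sum>l\<in>UNIV. \<Sum>m\<in>UNIV. \<Sum>k\<in>UNIV. (?i $ m * ?j $ l * x $ k) *\<^sub>R ?g m l k)"
    by (rule sum.cong[OF refl], rule sum.swap)
  also have "\<dots> = (\<Sum>m\<in>UNIV. \<Sum>l\<in>UNIV. \<Sum>k\<in>UNIV. (?i $ m * ?j $ l * x $ k) *\<^sub>R ?g m l k)"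
    by (rule sum.swap)
  also have "\<dots> = D3 (f s) (\<phi> s \<tau> p) *v (?i \<otimes>\<^sub>v ?j \<otimes>\<^sub>v x)"
    by (simp add: D3_f_columns[OF time_in_I[OF s]] matrix_of_columns_triple_mult)
  finally show ?thesis .
qed

lemma d1_flow: "D1 (\<phi> s \<tau>) p *v h = (\<Sum>i\<in>UNIV. h $ i *\<^sub>R partial i (\<phi> s \<tau>) p)"
  by (simp add: D_vec_columns matrix_of_columns_mult)

lemma d2_flow:
  assumes s: "s \<in> {a..b}"
  shows "D2 (\<phi> s \<tau>) p *v (h \<otimes>\<^sub>v h) = (\<Sum>i\<in>UNIV. \<Sum>j\<in>UNIV. (h $ i * h $ j) *\<^sub>R partial i (partial j (\<phi> s \<tau>)) p)"
  using D2_columns[OF flow_partial2(2)[OF \<tau>I \<tau> p s]] by (simp add: matrix_of_columns_pair_mult)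

lemma d3_flow:
  assumes s: "s \<in> {a..b}"
  shows "D3 (\<phi> s \<tau>) p *v (h \<otimes>\<^sub>v h \<otimes>\<^sub>v h) =
    (\<Sum>i\<in>UNIV. \<Sum>j\<in>UNIV. \<Sum>k\<in>UNIV. (h $ i * h $ j * h $ k) *\<^sub>R partial i (partial j (partial k (\<phi> s \<tau>))) p)"
proof -
  have "D3 (\<phi> s \<tau>) p = matrix_of_columns (\<lambda>(i, j, k). partial i (partial j (partial k (\<phi> s \<tau>))) p)"
    by (rule D3_columns[OF open_flow_domain[OF \<tau>I \<tau>] p flow_partial2(2)[OF \<tau>I \<tau> _ s] flow_partial3(2)[OF \<tau>I \<tau> p s]])
  then show ?thesis by (simp add: matrix_of_columns_triple_mult)
qed

lemma D1_flow_equation: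
  assumes "s \<in> {a..b}"
  shows "((\<lambda>s. D1 (\<phi> s \<tau>) p) has_vector_derivative flow_derivative_matrix \<tau> s p ** D1 (\<phi> s \<tau>) p) (at s within {a..b})"
  unfolding D_vec_columns matrix_mult_columns
  by (rule has_vector_derivative_matrix_of_columns) (rule flow_partial_at(3)[OF \<tau>I \<tau> p assms])

lemma d1_flow_equation:
  assumes "s \<in> {a..b}"
  shows "((\<lambda>s. D1 (\<phi> s \<tau>) p *v h) has_vector_derivative flow_derivative_matrix \<tau> s p *v (D1 (\<phi> s \<tau>) p *v h)) (at s within {a..b})"
  using bounded_linear.has_vector_derivative[OF bounded_bilinear.bounded_linear_left[OF bounded_bilinear_matrix_vector_mult, of h] D1_flow_equation[OF assms]]
  by (simp add: matrix_vector_mul_assoc)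

lemma d2_flow_equation:
  assumes s: "s \<in> {a..b}"
  shows "((\<lambda>s. D2 (\<phi> s \<tau>) p *v (h \<otimes>\<^sub>v h)) has_vector_derivative
     flow_derivative_matrix \<tau> s p *v (D2 (\<phi> s \<tau>) p *v (h \<otimes>\<^sub>v h)) +
     D2 (f s) (\<phi> s \<tau> p) *v ((D1 (\<phi> s \<tau>) p *v h) \<otimes>\<^sub>v (D1 (\<phi> s \<tau>) p *v h))) (at s within {a..b})"
proof (rule has_vector_derivative_transform[OF s])
  \<comment> \<open>The coordinate sum is known to agree with \<open>D2\<close> on
    \<open>{a..b}\<close>, where the second partial derivatives exist; a derivative within
    \<open>{a..b}\<close> depends on nothing else.\<close>
  show "D2 (\<phi> r \<tau>) p *v (h \<otimes>\<^sub>v h) = (\<Sum>i\<in>UNIV. \<Sum>j\<in>UNIV. (h $ i * h $ j) *\<^sub>R partial i (partial j (\<phi> r \<tau>)) p)"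
    if "r \<in> {a..b}" for r by (rule d2_flow[OF that])
  have "((\<lambda>s. \<Sum>i\<in>UNIV. \<Sum>j\<in>UNIV. (h $ i * h $ j) *\<^sub>R partial i (partial j (\<phi> s \<tau>)) p) has_vector_derivative
     (\<Sum>i\<in>UNIV. \<Sum>j\<in>UNIV. (h $ i * h $ j) *\<^sub>R
       (flow_derivative_matrix \<tau> s p *v partial i (partial j (\<phi> s \<tau>)) p +
        D2 (f s) (\<phi> s \<tau> p) *v (partial i (\<phi> s \<tau>) p \<otimes>\<^sub>v partial j (\<phi> s \<tau>) p)))) (at s within {a..b})"
    using flow_partial2(3)[OF \<tau>I \<tau> p s] unfolding matrix_partial_mult[OF s]
    by (intro has_vector_derivative_sum bounded_linear.has_vector_derivative[OF bounded_linear_scaleR_right]) auto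
  moreover have "(\<Sum>i\<in>UNIV. \<Sum>j\<in>UNIV. (h $ i * h $ j) *\<^sub>R
       (flow_derivative_matrix \<tau> s p *v partial i (partial j (\<phi> s \<tau>)) p +
        D2 (f s) (\<phi> s \<tau> p) *v (partial i (\<phi> s \<tau>) p \<otimes>\<^sub>v partial j (\<phi> s \<tau>) p))) =
     flow_derivative_matrix \<tau> s p *v (D2 (\<phi> s \<tau>) p *v (h \<otimes>\<^sub>v h)) +
     D2 (f s) (\<phi> s \<tau> p) *v ((D1 (\<phi> s \<tau>) p *v h) \<otimes>\<^sub>v (D1 (\<phi> s \<tau>) p *v h))"
    unfolding d2_flow[OF s] d1_flow kron_vec_of_sums(1)
    by (simp add: matrix_vector_mult_sum matrix_vector_mult_scaleR scaleR_add_right sum.distrib)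
  ultimately show "((\<lambda>s. \<Sum>i\<in>UNIV. \<Sum>j\<in>UNIV. (h $ i * h $ j) *\<^sub>R partial i (partial j (\<phi> s \<tau>)) p) has_vector_derivative
     flow_derivative_matrix \<tau> s p *v (D2 (\<phi> s \<tau>) p *v (h \<otimes>\<^sub>v h)) +
     D2 (f s) (\<phi> s \<tau> p) *v ((D1 (\<phi> s \<tau>) p *v h) \<otimes>\<^sub>v (D1 (\<phi> s \<tau>) p *v h))) (at s within {a..b})" by simp
qed

text \<open>Contracting the third variational equations with \<open>h\<close> sends the three ways
  of splitting three differentiations into one and two to the same vector, whence the factor
  \<open>3\<close>.\<close>

lemma d3_flow_equation:
  assumes s: "s \<in> {a..b}"
  defines "u \<equiv> D1 (\<phi> s \<tau>) p *v h" and "v \<equiv> D2 (\<phi> s \<tau>) p *v (h \<otimes>\<^sub>v h)"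
  shows "((\<lambda>s. D3 (\<phi> s \<tau>) p *v (h \<otimes>\<^sub>v h \<otimes>\<^sub>v h)) has_vector_derivative
     flow_derivative_matrix \<tau> s p *v (D3 (\<phi> s \<tau>) p *v (h \<otimes>\<^sub>v h \<otimes>\<^sub>v h)) +
     (3 *\<^sub>R (D2 (f s) (\<phi> s \<tau> p) *v (v \<otimes>\<^sub>v u)) + D3 (f s) (\<phi> s \<tau> p) *v (u \<otimes>\<^sub>v u \<otimes>\<^sub>v u))) (at s within {a..b})"
proof (rule has_vector_derivative_transform[OF s])
  let ?A = "flow_derivative_matrix \<tau> s p" and ?P = "D2 (f s) (\<phi> s \<tau> p)" and ?Q = "D3 (f s) (\<phi> s \<tau> p)"
  let ?x = "\<lambda>i. partial i (\<phi> s \<tau>) p" and ?y = "\<lambda>i j. partial i (partial j (\<phi> s \<tau>)) p"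
  let ?z = "\<lambda>i j k. partial i (partial j (partial k (\<phi> s \<tau>))) p" and ?h = "\<lambda>i j k. h $ i * h $ j * h $ k"
  show "D3 (\<phi> r \<tau>) p *v (h \<otimes>\<^sub>v h \<otimes>\<^sub>v h) =
     (\<Sum>i\<in>UNIV. \<Sum>j\<in>UNIV. \<Sum>k\<in>UNIV. ?h i j k *\<^sub>R partial i (partial j (partial k (\<phi> r \<tau>))) p)"
    if "r \<in> {a..b}" for r by (rule d3_flow[OF that])
  have "((\<lambda>s. \<Sum>i\<in>UNIV. \<Sum>j\<in>UNIV. \<Sum>k\<in>UNIV. ?h i j k *\<^sub>R partial i (partial j (partial k (\<phi> s \<tau>))) p) has_vector_derivative
     (\<Sum>i\<in>UNIV. \<Sum>j\<in>UNIV. \<Sum>k\<in>UNIV. ?h i j k *\<^sub>R (?A *v ?z i j k + (?P *v (?x i \<otimes>\<^sub>v ?y j k) +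
        (?P *v (?x j \<otimes>\<^sub>v ?y i k) + (?Q *v (?x i \<otimes>\<^sub>v ?x j \<otimes>\<^sub>v ?x k) + ?P *v (?y i j \<otimes>\<^sub>v ?x k)))))))
     (at s within {a..b})"
    using flow_partial3(3)[OF \<tau>I \<tau> p s] unfolding matrix_partial_mult[OF s] matrix_partial2_mult[OF s]
    by (intro has_vector_derivative_sum bounded_linear.has_vector_derivative[OF bounded_linear_scaleR_right]) auto
  moreover have "(\<Sum>i\<in>UNIV. \<Sum>j\<in>UNIV. \<Sum>k\<in>UNIV. ?h i j k *\<^sub>R (?A *v ?z i j k + (?P *v (?x i \<otimes>\<^sub>v ?y j k) +
        (?P *v (?x j \<otimes>\<^sub>v ?y i k) + (?Q *v (?x i \<otimes>\<^sub>v ?x j \<otimes>\<^sub>v ?x k) + ?P *v (?y i j \<otimes>\<^sub>v ?x k)))))) =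
     ?A *v (D3 (\<phi> s \<tau>) p *v (h \<otimes>\<^sub>v h \<otimes>\<^sub>v h)) + (3 *\<^sub>R (?P *v (v \<otimes>\<^sub>v u)) + ?Q *v (u \<otimes>\<^sub>v u \<otimes>\<^sub>v u))"
  proof -
    \<comment> \<open>Two of the three mixed terms arrive as \<open>?P\<close> on
      \<open>u \<otimes>\<^sub>v v\<close> and are turned round by the symmetry of
      \<open>D2 (f s)\<close>; the third already has the form
      \<open>v \<otimes>\<^sub>v u\<close>.\<close>
    have 1: "(\<Sum>i\<in>UNIV. \<Sum>j\<in>UNIV. \<Sum>k\<in>UNIV. ?h i j k *\<^sub>R (?P *v (?x i \<otimes>\<^sub>v ?y j k))) = ?P *v (v \<otimes>\<^sub>v u)"
      unfolding D2_f_symmetric[OF time_in_I[OF s], of _ v u] unfolding u_def v_def d2_flow[OF s] d1_flow kron_vec_of_sums(3)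
      by (simp add: matrix_vector_mult_sum matrix_vector_mult_scaleR)
    have 2: "(\<Sum>i\<in>UNIV. \<Sum>j\<in>UNIV. \<Sum>k\<in>UNIV. ?h i j k *\<^sub>R (?P *v (?x j \<otimes>\<^sub>v ?y i k))) = ?P *v (v \<otimes>\<^sub>v u)"
      unfolding D2_f_symmetric[OF time_in_I[OF s], of _ v u] unfolding u_def v_def d2_flow[OF s] d1_flow kron_vec_of_sums(4)
      by (simp add: matrix_vector_mult_sum matrix_vector_mult_scaleR)
    have 3: "(\<Sum>i\<in>UNIV. \<Sum>j\<in>UNIV. \<Sum>k\<in>UNIV. ?h i j k *\<^sub>R (?P *v (?y i j \<otimes>\<^sub>v ?x k))) = ?P *v (v \<otimes>\<^sub>v u)"
      unfolding u_def v_def d2_flow[OF s] d1_flow kron_vec_of_sums(5)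
      by (simp add: matrix_vector_mult_sum matrix_vector_mult_scaleR)
    have 4: "(\<Sum>i\<in>UNIV. \<Sum>j\<in>UNIV. \<Sum>k\<in>UNIV. ?h i j k *\<^sub>R (?Q *v (?x i \<otimes>\<^sub>v ?x j \<otimes>\<^sub>v ?x k))) = ?Q *v (u \<otimes>\<^sub>v u \<otimes>\<^sub>v u)"
      unfolding u_def d1_flow kron_vec_of_sums(2)
      by (simp add: matrix_vector_mult_sum matrix_vector_mult_scaleR)
    have 5: "(\<Sum>i\<in>UNIV. \<Sum>j\<in>UNIV. \<Sum>k\<in>UNIV. ?h i j k *\<^sub>R (?A *v ?z i j k)) = ?A *v (D3 (\<phi> s \<tau>) p *v (h \<otimes>\<^sub>v h \<otimes>\<^sub>v h))"
      unfolding d3_flow[OF s] by (simp add: matrix_vector_mult_sum matrix_vector_mult_scaleR)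
    have "3 *\<^sub>R c = c + c + c" for c :: "real^'n" by (simp add: vec_eq_iff)
    then show ?thesis
      by (simp add: scaleR_add_right sum.distrib 1 2 3 4 5)
  qed
  ultimately show "((\<lambda>s. \<Sum>i\<in>UNIV. \<Sum>j\<in>UNIV. \<Sum>k\<in>UNIV. ?h i j k *\<^sub>R partial i (partial j (partial k (\<phi> s \<tau>))) p) has_vector_derivative
     ?A *v (D3 (\<phi> s \<tau>) p *v (h \<otimes>\<^sub>v h \<otimes>\<^sub>v h)) + (3 *\<^sub>R (?P *v (v \<otimes>\<^sub>v u)) + ?Q *v (u \<otimes>\<^sub>v u \<otimes>\<^sub>v u)))
     (at s within {a..b})" by simp
qed

lemma flow_coefficients_continuous:
  "continuous_on {a..b} (\<lambda>s. flow_derivative_matrix \<tau> s p)"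
  "continuous_on {a..b} (\<lambda>s. D2 (f s) (\<phi> s \<tau> p))"
  "continuous_on {a..b} (\<lambda>s. D3 (f s) (\<phi> s \<tau> p))"
proof -
  show "continuous_on {a..b} (\<lambda>s. flow_derivative_matrix \<tau> s p)"
    by (rule jointly_continuous_slice[OF flow_derivative_matrix_continuous[OF \<tau>I \<tau>] p])
  have "jointly_continuous_on {a..b} (flow_domain a b \<tau>)
      (\<lambda>t p. matrix_of_columns (\<lambda>c. partial (fst c) (partial (snd c) (f t)) (\<phi> t \<tau> p)))"
    by (intro jointly_continuous_matrix_of_columns jointly_continuous_along_flow[OF \<tau>I \<tau>] f_partial2_cont)
  from jointly_continuous_slice[OF this p] show "continuous_on {a..b} (\<lambda>s. D2 (f s) (\<phi> s \<tau> p))"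
    by (rule continuous_on_eq) (simp add: split_def D2_columns[OF f_partial2[OF time_in_I]])
  have "jointly_continuous_on {a..b} (flow_domain a b \<tau>)
      (\<lambda>t p. matrix_of_columns (\<lambda>c. partial (fst c) (partial (fst (snd c)) (partial (snd (snd c)) (f t))) (\<phi> t \<tau> p)))"
    by (intro jointly_continuous_matrix_of_columns jointly_continuous_along_flow[OF \<tau>I \<tau>] f_partial3_cont)
  from jointly_continuous_slice[OF this p] show "continuous_on {a..b} (\<lambda>s. D3 (f s) (\<phi> s \<tau> p))"
    by (rule continuous_on_eq) (simp add: split_def D3_f_columns[OF time_in_I])
qed

lemma flow_initial_values:
  "D1 (\<phi> \<tau> \<tau>) p = mat 1" "D2 (\<phi> \<tau> \<tau>) p *v (h \<otimes>\<^sub>v h) = 0" "D3 (\<phi> \<tau> \<tau>) p *v (h \<otimes>\<^sub>v h \<otimes>\<^sub>v h) = 0"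
proof -
  show "D1 (\<phi> \<tau> \<tau>) p = mat 1"
    by (auto simp: D_vec_columns matrix_of_columns_def flow_partial_at(1)[OF \<tau>I \<tau> p] vec_eq_iff mat_def axis_def)
qed (simp_all add: d2_flow[OF \<tau>] d3_flow[OF \<tau>] flow_partial2(1)[OF \<tau>I \<tau> p] flow_partial3(1)[OF \<tau>I \<tau> p])

text \<open>Variation of constants with \<open>D1\<close> of the flow as fundamental matrix and with
  its first three directional derivatives as \<open>u\<close>, \<open>v\<close>, \<open>w\<close>.
  The open premise is membership of the time \<open>t\<close> in \<open>{a..b}\<close>.\<close>

lemmas flow_kron_identity = kron_variation_of_constants[OF flow_coefficients_continuous \<tau> _ flow_initial_values
    D1_flow_equation d1_flow_equation d2_flow_equation d3_flow_equation D2_f_symmetric[OF time_in_I]]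

end

end

theorem mainTheorem1:
  fixes I :: "real set"
    and f :: "real \<Rightarrow> real^'n \<Rightarrow> real^'n"
    and J :: "real \<Rightarrow> real^'n \<Rightarrow> real set"
    and \<phi> :: "real \<Rightarrow> real \<Rightarrow> real^'n \<Rightarrow> real^'n"
    and \<tau> t :: real and \<xi> h :: "real^'n"
  assumes "open I" and "is_interval I"
    and "continuous_on (I \<times> UNIV) (\<lambda>(t, x). f t x)"
    and "C_in_x 3 I f"
    and "\<And>\<tau> \<xi>. \<tau> \<in> I \<Longrightarrow> maximal_solution f I \<tau> \<xi> (J \<tau> \<xi>) (\<lambda>t. \<phi> t \<tau> \<xi>)"
    and "\<tau> \<in> I" and "t \<in> J \<tau> \<xi>"
  shows
    "let D\<phi> = (\<lambda>s. D1 (\<phi> s \<tau>) \<xi>);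
         d\<phi> = (\<lambda>s. D1 (\<phi> s \<tau>) \<xi> *v h);
         d2\<phi> = (\<lambda>s. D2 (\<phi> s \<tau>) \<xi> *v (h \<otimes>\<^sub>v h));
         d3\<phi> = (\<lambda>s. D3 (\<phi> s \<tau>) \<xi> *v (h \<otimes>\<^sub>v h \<otimes>\<^sub>v h));
         D2f = (\<lambda>s. D2 (f s) (\<phi> s \<tau> \<xi>));
         D3f = (\<lambda>s. D3 (f s) (\<phi> s \<tau> \<xi>));
         E = (mat 1 :: real^'n^'n)
     in
       d3\<phi> t \<otimes>\<^sub>v d\<phi> t + d\<phi> t \<otimes>\<^sub>v d3\<phi> t - 3 *\<^sub>R (d2\<phi> t \<otimes>\<^sub>v d2\<phi> t)
       = (D\<phi> t \<otimes>\<^sub>m D\<phi> t) *v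
         ((LBINT s=\<tau>..t.
             matrix_inv (D\<phi> s \<otimes>\<^sub>m D\<phi> s) *v
             ((reindex_cols assoc4 (D3f s \<otimes>\<^sub>m E) + E \<otimes>\<^sub>m D3f s) *v
              (d\<phi> s \<otimes>\<^sub>v d\<phi> s \<otimes>\<^sub>v d\<phi> s \<otimes>\<^sub>v d\<phi> s)))
          + 3 *\<^sub>R
          (LBINT s=\<tau>..t.
             matrix_inv (D\<phi> s \<otimes>\<^sub>m D\<phi> s) *v
             ((reindex_cols assoc3 (D2f s \<otimes>\<^sub>m E) - E \<otimes>\<^sub>m D2f s) *v
              (d2\<phi> s \<otimes>\<^sub>v d\<phi> s \<otimes>\<^sub>v d\<phi> s
               - reindex assoc3 ((d\<phi> s \<otimes>\<^sub>v d\<phi> s) \<otimes>\<^sub>v d2\<phi> s)))))"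
proof -
  \<comment> \<open>Writing \<open>3\<close> as iterated \<open>Suc\<close> unfolds
    \<open>C_in_x\<close> down to order \<open>0\<close>, which is joint continuity; the locale
    assumptions are read off level by level.\<close>
  interpret C3_flow I f J \<phi>
    using assms(3-5) by unfold_locales (auto simp: eval_nat_numeral)
  \<comment> \<open>The compact interval is the hull of \<open>\<tau>\<close> and \<open>t\<close>;
    it lies in \<open>J \<tau> \<xi>\<close> because that set is an interval containing both, in
    whichever order they come.\<close>
  have "s \<in> J \<tau> \<xi>" if "s \<in> {min \<tau> t..max \<tau> t}" for s
    using that solution(2,4)[OF \<open>\<tau> \<in> I\<close>, of \<xi>] \<open>t \<in> J \<tau> \<xi>\<close>
      mem_is_interval_1_I[of "J \<tau> \<xi>" \<tau> t s] mem_is_interval_1_I[of "J \<tau> \<xi>" t \<tau> s]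
    by (cases "\<tau> \<le> t") simp_all
  then have \<xi>: "\<xi> \<in> flow_domain (min \<tau> t) (max \<tau> t) \<tau>" by blast
  have "\<tau> \<in> {min \<tau> t..max \<tau> t}" "t \<in> {min \<tau> t..max \<tau> t}" by simp_all
  from flow_kron_identity[OF \<open>\<tau> \<in> I\<close> this(1) \<xi> this(2), of h] show ?thesis
    unfolding Let_def .
qed

end
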